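(* For every integer $p\ge3$, $3$-List Colouring is NP-complete for planar graphs of girth at least $p$ that have a list assignment in which each list is one of $\{1,2\}$, $\{1,3\}$, $\{2,3\}$, $\{1,2,3\}$.
   Context: A colouring of a graph $G=(V,E)$ is a map $c:V\to\{1,2,\dots\}$ with $c(u)\neq c(v)$ for every edge $uv$. A list assignment $L$ gives each vertex $u$ a set $L(u)\subseteq\{1,2,\dots\}$; a colouring respects $L$ if $c(u)\in L(u)$ for all $u$. $3$-List Colouring: given a graph $G$ and a list assignment $L$ with $|L(u)|\le 3$ for all $u$, decide whether $G$ has a colouring respecting $L$. The statement concerns the restriction to instances where $G$ is planar of girth (length of a shortest cycle) at least $p$ and every list is one of $\{1,2\},\{1,3\},\{2,3\},\{1,2,3\}$. *)

theory Defs
  imports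
    "HOL-Analysis.Analysis"
    "HOL-Computational_Algebra.Polynomial"
    "HOL-Library.Extended_Nat"
begin

section \<open>Graphs\<close>

definition simple_graph :: "'a set \<Rightarrow> 'a set set \<Rightarrow> bool" where
  "simple_graph V E \<longleftrightarrow> finite V \<and> (\<forall>e\<in>E. e \<subseteq> V \<and> card e = 2)"

definition is_cycle :: "'a set set \<Rightarrow> 'a list \<Rightarrow> bool" where
  "is_cycle E vs \<longleftrightarrow> 3 \<le> length vs \<and> distinct vs \<and>
     (\<forall>i<length vs. {vs ! i, vs ! (Suc i mod length vs)} \<in> E)"

text \<open>The girth of a forest is \<open>\<infinity>\<close>, the infimum of the empty set.\<close>

definition girth :: "'a set set \<Rightarrow> enat" where
  "girth E = (INF vs\<in>{vs. is_cycle E vs}. enat (length vs))"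

text \<open>Planarity is meant topologically: vertices are distinct points of the plane \<open>\<complex>\<close>, edges are
  arcs (injective paths) joining their end vertices and avoiding all other vertices, and two
  different edges meet at most in common end vertices.\<close>

definition planar :: "'a set \<Rightarrow> 'a set set \<Rightarrow> bool" where
  "planar V E \<longleftrightarrow>
     (\<exists>(pos :: 'a \<Rightarrow> complex) (\<gamma> :: 'a set \<Rightarrow> real \<Rightarrow> complex).
        inj_on pos V \<and>
        (\<forall>e\<in>E. arc (\<gamma> e) \<and> {pathstart (\<gamma> e), pathfinish (\<gamma> e)} = pos ` e \<and>
               path_image (\<gamma> e) \<inter> pos ` V = pos ` e) \<and>
        (\<forall>e\<in>E. \<forall>f\<in>E. e \<noteq> f \<longrightarrow> path_image (\<gamma> e) \<inter> path_image (\<gamma> f) \<subseteq> pos ` (e \<inter> f)))"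

definition colouring :: "'a set \<Rightarrow> 'a set set \<Rightarrow> ('a \<Rightarrow> nat) \<Rightarrow> bool" where
  "colouring V E c \<longleftrightarrow> (\<forall>u\<in>V. 1 \<le> c u) \<and> (\<forall>u v. {u, v} \<in> E \<longrightarrow> c u \<noteq> c v)"

definition respects_lists :: "'a set \<Rightarrow> ('a \<Rightarrow> nat) \<Rightarrow> ('a \<Rightarrow> nat set) \<Rightarrow> bool" where
  "respects_lists V c L \<longleftrightarrow> (\<forall>u\<in>V. c u \<in> L u)"


section \<open>Multi-tape Turing machines\<close>

datatype direction = MoveLeft | Stay | MoveRight

text \<open>The states are \<open>0, \<dots>, halt_state M\<close>; the machine starts in state \<open>0\<close> and stops in
  \<open>halt_state M\<close>. The tape symbols are \<open>0, \<dots>, symbols M - 1\<close>, where \<open>0\<close> is the blank and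
  \<open>1\<close>, \<open>2\<close> represent the two bits. The transition function maps the current state and the
  scanned symbols to the new state and, for each tape, the symbol to write and the head move.\<close>

record tm =
  tapes :: nat
  symbols :: nat
  halt_state :: nat
  transition :: "nat \<Rightarrow> nat list \<Rightarrow> nat \<times> (nat \<times> direction) list"

definition turing_machine :: "tm \<Rightarrow> bool" where
  "turing_machine M \<longleftrightarrow> 1 \<le> tapes M \<and> 3 \<le> symbols M \<and>
     (\<forall>q ss. q < halt_state M \<and> length ss = tapes M \<and> set ss \<subseteq> {..<symbols M} \<longrightarrow>
        fst (transition M q ss) \<le> halt_state M \<and>
        length (snd (transition M q ss)) = tapes M \<and>
        fst ` set (snd (transition M q ss)) \<subseteq> {..<symbols M})"

text \<open>A tape is a two-way infinite sequence of cells together with the position of its head.\<close>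

type_synonym tape = "(int \<Rightarrow> nat) \<times> int"
type_synonym config = "nat \<times> tape list"

fun scanned :: "tape \<Rightarrow> nat" where
  "scanned (t, h) = t h"

fun shift :: "direction \<Rightarrow> int" where
  "shift MoveLeft = - 1"
| "shift Stay = 0"
| "shift MoveRight = 1"

fun act :: "nat \<times> direction \<Rightarrow> tape \<Rightarrow> tape" where
  "act (s, d) (t, h) = (t(h := s), h + shift d)"

fun tm_step :: "tm \<Rightarrow> config \<Rightarrow> config" where
  "tm_step M (q, ts) =
     (if q = halt_state M then (q, ts)
      else let (q', as) = transition M q (map scanned ts) in (q', map2 act as ts))"

definition bit_symbol :: "bool \<Rightarrow> nat" where
  "bit_symbol b = (if b then 2 else 1)"

definition word_cells :: "bool list \<Rightarrow> int \<Rightarrow> nat" where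
  "word_cells w i = (if 0 \<le> i \<and> i < int (length w) then bit_symbol (w ! nat i) else 0)"

definition init_config :: "tm \<Rightarrow> bool list \<Rightarrow> config" where
  "init_config M w = (0, (word_cells w, 0) # replicate (tapes M - 1) (word_cells [], 0))"

text \<open>The input is on the first tape, the output on the last one.\<close>

definition halts_with :: "tm \<Rightarrow> config \<Rightarrow> bool list \<Rightarrow> bool" where
  "halts_with M C w \<longleftrightarrow> fst C = halt_state M \<and> fst (last (snd C)) = word_cells w"

definition poly_time :: "(bool list \<Rightarrow> bool list) \<Rightarrow> bool" where
  "poly_time f \<longleftrightarrow>
     (\<exists>M (p :: nat poly). turing_machine M \<and>
        (\<forall>w. \<exists>t\<le>poly p (length w). halts_with M ((tm_step M ^^ t) (init_config M w)) (f w)))"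


section \<open>NP-completeness\<close>

type_synonym language = "bool list set"

definition class_P :: "language set" where
  "class_P = {A. poly_time (\<lambda>w. [w \<in> A])}"

text \<open>The bits of the first word are doubled, so that the factor \<open>01\<close> marks its end.\<close>

definition word_pair :: "bool list \<Rightarrow> bool list \<Rightarrow> bool list" where
  "word_pair x y = concat (map (\<lambda>b. [b, b]) x) @ [False, True] @ y"

definition class_NP :: "language set" where
  "class_NP = {A. \<exists>R\<in>class_P. \<exists>p :: nat poly. \<forall>x.
      x \<in> A \<longleftrightarrow> (\<exists>y. length y \<le> poly p (length x) \<and> word_pair x y \<in> R)}"

text \<open>A problem \<open>Q\<close> is NP-complete for a class \<open>D\<close> of instances if it is in NP and every problem
  in NP has a polynomial-time many-one reduction to \<open>Q\<close> that only produces instances in \<open>D\<close>.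
  For \<open>D = UNIV\<close> this is ordinary NP-completeness. Inputs are promised to be in \<open>D\<close>: recognising
  \<open>D\<close> is not part of the restricted problem.\<close>

definition NP_complete_for :: "language \<Rightarrow> language \<Rightarrow> bool" where
  "NP_complete_for Q D \<longleftrightarrow> Q \<in> class_NP \<and>
     (\<forall>A\<in>class_NP. \<exists>f. poly_time f \<and> (\<forall>x. f x \<in> D \<and> (x \<in> A \<longleftrightarrow> f x \<in> Q)))"


section \<open>3-List Colouring\<close>

definition list_colouring_instance ::
    "nat \<Rightarrow> nat \<Rightarrow> nat set set \<Rightarrow> (nat \<Rightarrow> nat set) \<Rightarrow> bool" where
  "list_colouring_instance k n E L \<longleftrightarrow> simple_graph {..<n} E \<and>
     (\<forall>u<n. L u \<subseteq> {1..} \<and> finite (L u) \<and> card (L u) \<le> k)"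

text \<open>Encoding of a graph on \<open>{..<n}\<close> with lists \<open>L\<close>: the number \<open>n\<close> in unary, the adjacency
  matrix row by row, and for each vertex its colours in increasing order and in unary, followed
  by a terminating \<open>False\<close>; this is unambiguous because colours are positive.\<close>

definition encode_unary :: "nat \<Rightarrow> bool list" where
  "encode_unary m = replicate m True @ [False]"

definition encode_list :: "nat set \<Rightarrow> bool list" where
  "encode_list S = concat (map encode_unary (sorted_list_of_set S)) @ [False]"

definition encode_instance :: "nat \<Rightarrow> nat set set \<Rightarrow> (nat \<Rightarrow> nat set) \<Rightarrow> bool list" where
  "encode_instance n E L =
     encode_unary n @
     concat (map (\<lambda>u. map (\<lambda>v. {u, v} \<in> E) [0..<n]) [0..<n]) @
     concat (map (\<lambda>u. encode_list (L u)) [0..<n])"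

lemma encode_unary_append_eq:
  "encode_unary a @ x = encode_unary b @ y \<longleftrightarrow> a = b \<and> x = y"
proof (induction a arbitrary: b)
  case 0
  then show ?case by (cases b) (auto simp: encode_unary_def)
next
  case (Suc a)
  then show ?case by (cases b) (auto simp: encode_unary_def)
qed

lemma encode_colours_append_eq:
  assumes "0 \<notin> set cs" "0 \<notin> set ds"
    and "concat (map encode_unary cs) @ False # x = concat (map encode_unary ds) @ False # y"
  shows "cs = ds \<and> x = y"
  using assms
proof (induction cs arbitrary: ds)
  case Nil
  show ?case
  proof (cases ds)
    case Nil
    with Nil.prems show ?thesis by simp
  next
    case (Cons d ds')
    with Nil.prems show ?thesis by (cases d) (auto simp: encode_unary_def)
  qed
next
  case (Cons c cs)
  show ?case
  proof (cases ds)
    case Nil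
    with Cons.prems show ?thesis by (cases c) (auto simp: encode_unary_def)
  next
    case (Cons d ds')
    with Cons.prems Cons.IH[of ds'] show ?thesis
      by (simp add: encode_unary_append_eq)
  qed
qed

lemma encode_list_append_eq:
  assumes "finite S" "finite T" "S \<subseteq> {1..}" "T \<subseteq> {1..}"
    and "encode_list S @ x = encode_list T @ y"
  shows "S = T \<and> x = y"
proof -
  have "0 \<notin> set (sorted_list_of_set S)" "0 \<notin> set (sorted_list_of_set T)"
    using assms(1-4) by auto
  then have "sorted_list_of_set S = sorted_list_of_set T \<and> x = y"
    using assms(5) by (intro encode_colours_append_eq) (simp_all add: encode_list_def)
  then show ?thesis
    using assms(1,2) by (metis set_sorted_list_of_set)
qed

lemma encode_lists_eq:
  assumes "\<forall>u\<in>set us. finite (L u) \<and> L u \<subseteq> {1..}"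
    and "\<forall>u\<in>set us. finite (L' u) \<and> L' u \<subseteq> {1..}"
    and "concat (map (\<lambda>u. encode_list (L u)) us) = concat (map (\<lambda>u. encode_list (L' u)) us)"
  shows "\<forall>u\<in>set us. L u = L' u"
  using assms
proof (induction us)
  case Nil
  then show ?case by simp
next
  case (Cons u us)
  from Cons.prems have "L u = L' u \<and>
      concat (map (\<lambda>u. encode_list (L u)) us) = concat (map (\<lambda>u. encode_list (L' u)) us)"
    by (intro encode_list_append_eq) auto
  with Cons show ?case by simp
qed

lemma adjacency_rows_eq:
  assumes "concat (map (\<lambda>u. map (f u) vs) us) = concat (map (\<lambda>u. map (g u) vs) us)"
  shows "\<forall>u\<in>set us. \<forall>v\<in>set vs. f u v = g u v"
  using assms by (induction us) auto

lemma simple_graph_edges_eq: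
  assumes "simple_graph V E" "simple_graph V E'"
    and "\<forall>u\<in>V. \<forall>v\<in>V. {u, v} \<in> E \<longleftrightarrow> {u, v} \<in> E'"
  shows "E = E'"
proof -
  have "e \<in> E \<longleftrightarrow> e \<in> E'" for e
  proof (cases "e \<subseteq> V \<and> card e = 2")
    case True
    then obtain u v where "e = {u, v}" "u \<in> V" "v \<in> V"
      by (auto simp: card_2_iff)
    with assms(3) show ?thesis by blast
  next
    case False
    with assms(1,2) show ?thesis by (auto simp: simple_graph_def)
  qed
  then show ?thesis by blast
qed

lemma encode_instance_inject:
  assumes I: "list_colouring_instance k n E L" and I': "list_colouring_instance k' n' E' L'"
    and eq: "encode_instance n E L = encode_instance n' E' L'"
  shows "n = n' \<and> E = E' \<and> (\<forall>u<n. L u = L' u)"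
proof -
  let ?A = "\<lambda>E. concat (map (\<lambda>u. map (\<lambda>v. {u, v} \<in> E) [0..<n]) [0..<n])"
  let ?C = "\<lambda>L. concat (map (\<lambda>u. encode_list (L u)) [0..<n])"
  have n: "n = n'"
    using eq by (simp add: encode_instance_def encode_unary_append_eq)
  have "?A E @ ?C L = ?A E' @ ?C L'"
    using eq unfolding n by (simp add: encode_instance_def encode_unary_append_eq)
  moreover have "length (?A E) = length (?A E')"
    by (simp add: length_concat comp_def)
  ultimately have A: "?A E = ?A E'" and C: "?C L = ?C L'"
    by simp_all
  have "\<forall>u\<in>{..<n}. \<forall>v\<in>{..<n}. {u, v} \<in> E \<longleftrightarrow> {u, v} \<in> E'"
    using adjacency_rows_eq[OF A] by auto
  then have "E = E'"
    using I I' n by (intro simple_graph_edges_eq[of "{..<n}"])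
      (auto simp: list_colouring_instance_def)
  moreover have "\<forall>u\<in>set [0..<n]. L u = L' u"
    using I I' n C by (intro encode_lists_eq) (auto simp: list_colouring_instance_def)
  ultimately show ?thesis
    using n by simp
qed

definition three_list_colouring :: language where
  "three_list_colouring =
     {encode_instance n E L | n E L. list_colouring_instance 3 n E L \<and>
        (\<exists>c. colouring {..<n} E c \<and> respects_lists {..<n} c L)}"

definition planar_girth_instances :: "nat \<Rightarrow> language" where
  "planar_girth_instances p =
     {encode_instance n E L | n E L. list_colouring_instance 3 n E L \<and>
        planar {..<n} E \<and> enat p \<le> girth E \<and>
        (\<forall>u<n. L u \<in> {{1, 2}, {1, 3}, {2, 3}, {1, 2, 3}})}"

end

(* Membership in NP is shown with a certificate that spells out the lists and marks a colour of each
   vertex.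

   For hardness, the computations of a verifier are described by clauses over the facts "state",
   "head position", "cell content" and "scanned symbol". Apart from the guessed certificate these
   clauses are Horn, so it suffices that true facts are made true and uniqueness need not be enforced.
   The clauses are drawn as a rectangular array of tiles, with a horizontal wire for each variable
   and a vertical signal for each clause. With lists of size two, a wire alternates between its two
   colours, and it may be arbitrarily long without changing its meaning. So all gadgets can be
   stretched by an odd factor D >= p on the integer grid, which makes planarity immediate and the
   girth at least D, because the lexicographically extreme vertices of a cycle are corners of the
   coarse grid.

   Polynomial time is obtained from arithmetic expressions with bounded sums over the positions of
   the input. Programs with unary counters evaluate them, a counter being a head position. Length
   and letters of the constructed instance are given by such expressions. *)

theory Submission
  imports Defs
begin

text \<open>The obstacle is that every clause signal has to cross every variable wire, in the plane
  and with three colours. Wires use the colours 1 and 2, signals 1 and 3. A crossing consists of two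
  halves, each of which is sure to conduct the signal only while the wire has colour 1. The wire
  changes its colour between the halves, so one of them always conducts, and two side branches lead
  the signal to both.

  The length of a stretched edge is odd because lists of size two make the colours of its inner
  vertices alternate: with odd length the two ends are forced apart like the ends of a single edge,
  with even length they would be forced together.

  All points of the fine grid are kept as vertices, also those that meet no edge. Vertex numbers are
  then plain coordinates, and adjacency and lists depend only on quotients and remainders of these
  coordinates and on the occurrence of one variable in one clause. This makes each letter of the
  instance computable on its own, without storing any part of the graph.\<close>

section \<open>Polynomially bounded functions\<close>

text \<open>The base \<open>n + 2\<close> is at least 2, so constants, sums and products are
  absorbed by a larger exponent. The bound is monotone even if \<open>f\<close> is not, which is
  what composition needs.\<close>

definition poly_bounded :: "(nat \<Rightarrow> nat) \<Rightarrow> bool" where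
  "poly_bounded f \<longleftrightarrow> (\<exists>c. \<forall>n. f n \<le> (n + 2) ^ c)"

lemma poly_bounded_mono:
  assumes "poly_bounded g" "\<And>n. f n \<le> g n"
  shows "poly_bounded f"
  using assms unfolding poly_bounded_def by (meson le_trans)

lemma poly_bounded_const: "poly_bounded (\<lambda>_. k)"
proof -
  have "k \<le> (n + 2) ^ k" for n
    using power_mono[of 2 "n + 2" k] less_exp[of k] by simp
  then show ?thesis unfolding poly_bounded_def by blast
qed

lemma poly_bounded_id: "poly_bounded (\<lambda>n. n)"
  unfolding poly_bounded_def by (rule exI[of _ 1]) simp

lemma poly_bounded_add:
  assumes "poly_bounded f" "poly_bounded g"
  shows "poly_bounded (\<lambda>n. f n + g n)"
proof -
  from assms obtain c d where c: "\<And>n. f n \<le> (n + 2) ^ c" and d: "\<And>n. g n \<le> (n + 2) ^ d"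
    unfolding poly_bounded_def by blast
  have "f n + g n \<le> (n + 2) ^ (c + d + 1)" for n
  proof -
    have "(n + 2) ^ c \<le> (n + 2) ^ (c + d)" "(n + 2) ^ d \<le> (n + 2) ^ (c + d)"
      by (intro power_increasing; simp)+
    then have "f n + g n \<le> 2 * (n + 2) ^ (c + d)"
      using c[of n] d[of n] by linarith
    also have "\<dots> \<le> (n + 2) ^ (c + d + 1)" by simp
    finally show ?thesis .
  qed
  then show ?thesis unfolding poly_bounded_def by blast
qed

lemma poly_bounded_mult:
  assumes "poly_bounded f" "poly_bounded g"
  shows "poly_bounded (\<lambda>n. f n * g n)"
proof -
  from assms obtain c d where c: "\<And>n. f n \<le> (n + 2) ^ c" and d: "\<And>n. g n \<le> (n + 2) ^ d"
    unfolding poly_bounded_def by blast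
  have "f n * g n \<le> (n + 2) ^ (c + d)" for n
    using mult_mono[OF c[of n] d[of n]] by (simp add: power_add)
  then show ?thesis unfolding poly_bounded_def by blast
qed

lemma poly_bounded_Suc: "poly_bounded f \<Longrightarrow> poly_bounded (\<lambda>n. Suc (f n))"
  using poly_bounded_add[OF _ poly_bounded_const[of 1], of f] by simp

lemma poly_bounded_compose:
  assumes "poly_bounded f" "poly_bounded g"
  shows "poly_bounded (\<lambda>n. f (g n))"
proof -
  from assms(1) obtain c where c: "\<And>n. f n \<le> (n + 2) ^ c"
    unfolding poly_bounded_def by blast
  have "poly_bounded (\<lambda>n. (g n + 2) ^ c)"
  proof (induction c)
    case (Suc c)
    have "poly_bounded (\<lambda>n. g n + 2)"
      by (intro poly_bounded_add assms(2) poly_bounded_const)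
    from poly_bounded_mult[OF this Suc] show ?case by simp
  qed (simp add: poly_bounded_const)
  then show ?thesis by (rule poly_bounded_mono) (rule c)
qed

lemma poly_bounded_le_poly:
  assumes "poly_bounded f"
  obtains p :: "nat poly" where "\<And>n. f n \<le> poly p n"
proof -
  from assms obtain c where "\<And>n. f n \<le> (n + 2) ^ c"
    unfolding poly_bounded_def by blast
  then have "f n \<le> poly ([:2, 1:] ^ c) n" for n
    by (simp add: add.commute)
  then show ?thesis by (rule that)
qed

section \<open>Counter programs\<close>

text \<open>Register \<open>0\<close> is the position of the head on the input, and \<open>Read s r\<close> increments \<open>r\<close> if
  the scanned input symbol is \<open>s\<close>.\<close>

datatype op = Inc nat | Dec nat | Read nat nat | Out nat

datatype instr = Op op | Jz nat nat | Jmp nat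

type_synonym store = "(nat \<Rightarrow> nat) \<times> bool list"

fun exec_op :: "bool list \<Rightarrow> op \<Rightarrow> store \<Rightarrow> store" where
  "exec_op w (Inc r) (\<sigma>, out) = (\<sigma>(r := Suc (\<sigma> r)), out)"
| "exec_op w (Dec r) (\<sigma>, out) = (\<sigma>(r := \<sigma> r - 1), out)"
| "exec_op w (Read s r) (\<sigma>, out) =
    ((if word_cells w (int (\<sigma> 0)) = s then \<sigma>(r := Suc (\<sigma> r)) else \<sigma>), out)"
| "exec_op w (Out r) (\<sigma>, out) = (\<sigma>, out @ [\<sigma> r \<noteq> 0])"

fun exec_instr :: "bool list \<Rightarrow> instr \<Rightarrow> nat \<times> store \<Rightarrow> nat \<times> store" where
  "exec_instr w (Op x) (pc, s) = (Suc pc, exec_op w x s)"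
| "exec_instr w (Jz r a) (pc, s) = (if fst s r = 0 then a else Suc pc, s)"
| "exec_instr w (Jmp a) (pc, s) = (a, s)"

definition prog_step :: "bool list \<Rightarrow> instr list \<Rightarrow> nat \<times> store \<Rightarrow> nat \<times> store" where
  "prog_step w P c = (if fst c < length P then exec_instr w (P ! fst c) c else c)"

fun op_below :: "nat \<Rightarrow> op \<Rightarrow> bool" where
  "op_below R (Inc r) \<longleftrightarrow> r < R"
| "op_below R (Dec r) \<longleftrightarrow> r < R"
| "op_below R (Read s r) \<longleftrightarrow> r < R"
| "op_below R (Out r) \<longleftrightarrow> r < R"

fun instr_ok :: "nat \<Rightarrow> nat \<Rightarrow> instr \<Rightarrow> bool" where
  "instr_ok R n (Op x) \<longleftrightarrow> op_below R x"
| "instr_ok R n (Jz r a) \<longleftrightarrow> r < R \<and> a \<le> n"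
| "instr_ok R n (Jmp a) \<longleftrightarrow> a \<le> n"

subsection \<open>Simulation by a Turing machine\<close>

text \<open>Tape \<open>r < R\<close> stores register \<open>r\<close> as its head position; cell \<open>0\<close> of each of these tapes is
  marked by adding \<open>3\<close> to its symbol, so that \<open>0\<close> can be recognised. Tape \<open>R\<close> is the output.\<close>

fun op_actions :: "nat \<Rightarrow> op \<Rightarrow> nat list \<Rightarrow> (nat \<times> direction) list" where
  "op_actions R (Inc r) ss = (map (\<lambda>s. (s, Stay)) ss)[r := (ss ! r, MoveRight)]"
| "op_actions R (Dec r) ss =
    (map (\<lambda>s. (s, Stay)) ss)[r := (ss ! r, if 3 \<le> ss ! r then Stay else MoveLeft)]"
| "op_actions R (Read s r) ss =
    (map (\<lambda>s. (s, Stay)) ss)[r := (ss ! r, if ss ! 0 mod 3 = s then MoveRight else Stay)]"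
| "op_actions R (Out r) ss =
    (map (\<lambda>s. (s, Stay)) ss)[R := (bit_symbol (ss ! r < 3), MoveRight)]"

text \<open>State \<open>0\<close> only puts the marks on the register tapes. State
  \<open>Suc pc\<close> stands for program position \<open>pc\<close>, so leaving the program at its
  end is the halting state.\<close>

fun prog_transition ::
    "nat \<Rightarrow> instr list \<Rightarrow> nat \<Rightarrow> nat list \<Rightarrow> nat \<times> (nat \<times> direction) list" where
  "prog_transition R P 0 ss = (1, (map (\<lambda>s. (s mod 3 + 3, Stay)) ss)[R := (ss ! R, Stay)])"
| "prog_transition R P (Suc pc) ss = (case P ! pc of
      Op x \<Rightarrow> (Suc (Suc pc), op_actions R x ss)
    | Jz r a \<Rightarrow> (if 3 \<le> ss ! r then Suc a else Suc (Suc pc), map (\<lambda>s. (s, Stay)) ss)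
    | Jmp a \<Rightarrow> (Suc a, map (\<lambda>s. (s, Stay)) ss))"

definition prog_tm :: "nat \<Rightarrow> instr list \<Rightarrow> tm" where
  "prog_tm R P = \<lparr>tapes = Suc R, symbols = 6, halt_state = Suc (length P),
     transition = prog_transition R P\<rparr>"

lemma length_op_actions [simp]: "length (op_actions R x ss) = length ss"
  by (cases x) auto

lemma op_actions_symbols:
  assumes "op_below R x" "length ss = Suc R" "set ss \<subseteq> {..<6}"
  shows "fst ` set (op_actions R x ss) \<subseteq> {..<6}"
proof -
  have ss: "ss ! r < 6" if "r \<le> R" for r
    using assms that by (metis lessThan_iff less_Suc_eq_le nth_mem subsetD)
  have upd: "fst ` set ((map (\<lambda>s. (s, Stay)) ss)[r := a]) \<subseteq> {..<6}" if "fst a < 6" for r a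
  proof -
    have "set ((map (\<lambda>s. (s, Stay)) ss)[r := a]) \<subseteq> insert a ((\<lambda>s. (s, Stay)) ` set ss)"
      using set_update_subset_insert by fastforce
    then show ?thesis using assms(3) that by fastforce
  qed
  show ?thesis
    using assms(1) ss by (cases x) (simp_all only: op_actions.simps op_below.simps, (intro upd; simp add: bit_symbol_def)+)
qed

lemma turing_machine_prog_tm:
  assumes "0 < R" "\<forall>i\<in>set P. instr_ok R (length P) i"
  shows "turing_machine (prog_tm R P)"
proof -
  have "fst (prog_transition R P q ss) \<le> Suc (length P) \<and>
        length (snd (prog_transition R P q ss)) = Suc R \<and>
        fst ` set (snd (prog_transition R P q ss)) \<subseteq> {..<6}"
    if q: "q < Suc (length P)" and ss: "length ss = Suc R" "set ss \<subseteq> {..<6}" for q ss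
  proof (cases q)
    case 0
    have "set ((map (\<lambda>s. (s mod 3 + 3, Stay)) ss)[R := (ss ! R, Stay)])
        \<subseteq> insert (ss ! R, Stay) ((\<lambda>s. (s mod 3 + 3, Stay)) ` set ss)"
      using set_update_subset_insert by fastforce
    moreover have "ss ! R < 6"
      using ss by (metis lessI lessThan_iff nth_mem subsetD)
    moreover have "s mod 3 + 3 < 6" for s :: nat
      using mod_less_divisor[of 3 s] by linarith
    ultimately have "fst ` set ((map (\<lambda>s. (s mod 3 + 3, Stay)) ss)[R := (ss ! R, Stay)]) \<subseteq> {..<6}"
      by fastforce
    then show ?thesis using 0 ss by simp
  next
    case (Suc pc)
    then have "instr_ok R (length P) (P ! pc)" "pc < length P"
      using q assms(2) by auto
    then show ?thesis
      using Suc ss op_actions_symbols[OF _ ss] by (cases "P ! pc") (auto simp: image_image)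
  qed
  then show ?thesis
    unfolding turing_machine_def prog_tm_def by auto
qed

definition reg_tape :: "bool list \<Rightarrow> nat \<Rightarrow> nat \<Rightarrow> tape" where
  "reg_tape w r v =
     (\<lambda>i. word_cells (if r = 0 then w else []) i + (if i = 0 then 3 else 0), int v)"

definition prog_config :: "nat \<Rightarrow> bool list \<Rightarrow> nat \<times> store \<Rightarrow> config" where
  "prog_config R w c = (case c of (pc, \<sigma>, out) \<Rightarrow>
     (Suc pc, map (\<lambda>r. reg_tape w r (\<sigma> r)) [0..<R] @ [(word_cells out, int (length out))]))"

lemma act_Stay [simp]: "act (scanned t, Stay) t = t"
  by (cases t) simp

lemma map2_act_Stay: "map2 act (map (\<lambda>s. (s, Stay)) (map scanned ts)) ts = ts"
  by (induction ts) auto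

lemma map2_act_update:
  assumes "r < length ts"
  shows "map2 act ((map (\<lambda>s. (s, Stay)) (map scanned ts))[r := a]) ts = ts[r := act a (ts ! r)]"
proof (rule nth_equalityI)
  fix i assume "i < length (map2 act ((map (\<lambda>s. (s, Stay)) (map scanned ts))[r := a]) ts)"
  then show "map2 act ((map (\<lambda>s. (s, Stay)) (map scanned ts))[r := a]) ts ! i = ts[r := act a (ts ! r)] ! i"
    using assms by (cases "i = r") auto
qed simp

lemma word_cells_less: "word_cells w i < 3"
  by (simp add: word_cells_def bit_symbol_def)

lemma scanned_reg_tape: "scanned (reg_tape w r v) \<ge> 3 \<longleftrightarrow> v = 0"
  using word_cells_less[of "if r = 0 then w else []" "int v"] by (auto simp: reg_tape_def not_le)

lemma scanned_reg_tape_mod: "scanned (reg_tape w 0 v) mod 3 = word_cells w (int v)"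
  using word_cells_less[of w "int v"] by (auto simp: reg_tape_def)

lemma act_reg_tape:
  "act (scanned (reg_tape w r v), MoveRight) (reg_tape w r v) = reg_tape w r (Suc v)"
  "v \<noteq> 0 \<Longrightarrow> act (scanned (reg_tape w r v), MoveLeft) (reg_tape w r v) = reg_tape w r (v - 1)"
  by (auto simp: reg_tape_def)

lemma word_cells_snoc: "(word_cells out)(int (length out) := bit_symbol b) = word_cells (out @ [b])"
  by (rule ext) (auto simp: word_cells_def nth_append)

lemma act_output:
  "act (bit_symbol b, MoveRight) (word_cells out, int (length out)) =
     (word_cells (out @ [b]), int (length (out @ [b])))"
  by (simp only: act.simps shift.simps word_cells_snoc) simp

lemma update_reg_tapes:
  assumes "r < R"
  shows "(map f [0..<R] @ [x])[r := y] = map (f(r := y)) [0..<R] @ [x]"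
  by (rule nth_equalityI) (use assms in \<open>auto simp: nth_list_update nth_append\<close>)

lemma nth_reg_tapes: "r < R \<Longrightarrow> (map f [0..<R] @ [x]) ! r = f r"
  by (simp add: nth_append)

lemma prog_config_step:
  assumes "0 < R" "\<forall>i\<in>set P. instr_ok R (length P) i" "fst c < length P"
  shows "tm_step (prog_tm R P) (prog_config R w c) = prog_config R w (prog_step w P c)"
proof -
  obtain pc \<sigma> out where c: "c = (pc, \<sigma>, out)" by (cases c)
  define ts where "ts = map (\<lambda>r. reg_tape w r (\<sigma> r)) [0..<R] @ [(word_cells out, int (length out))]"
  have len: "length ts = Suc R" by (simp add: ts_def)
  have nth: "ts ! r = reg_tape w r (\<sigma> r)" if "r < R" for r
    using that unfolding ts_def by (rule nth_reg_tapes)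
  have out: "ts ! R = (word_cells out, int (length out))" by (simp add: ts_def nth_append)
  have scan: "map scanned ts ! r = scanned (reg_tape w r (\<sigma> r))" if "r < R" for r
    using that len nth by simp
  have upd: "ts[r := reg_tape w r v] =
      map (\<lambda>q. reg_tape w q ((\<sigma>(r := v)) q)) [0..<R] @ [(word_cells out, int (length out))]"
    if "r < R" for r v
    unfolding ts_def using that by (subst update_reg_tapes) (auto simp: fun_upd_def)
  have ok: "instr_ok R (length P) (P ! pc)"
    using assms(2,3) c by simp
  have step: "tm_step (prog_tm R P) (prog_config R w c) =
     (fst (prog_transition R P (Suc pc) (map scanned ts)),
      map2 act (snd (prog_transition R P (Suc pc) (map scanned ts))) ts)"
    using assms(3) by (simp add: c prog_config_def prog_tm_def ts_def case_prod_beta)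
  show ?thesis
  proof (cases "P ! pc")
    case (Op x)
    have "map2 act (op_actions R x (map scanned ts)) ts =
       snd (prog_config R w (Suc pc, exec_op w x (\<sigma>, out)))"
    proof (cases x)
      case (Inc r)
      then have r: "r < R" using ok Op by simp
      then show ?thesis using Inc len
        by (simp add: map2_act_update scan nth act_reg_tape upd prog_config_def del: map_map nth_map)
    next
      case (Dec r)
      then have r: "r < R" using ok Op by simp
      then show ?thesis using Dec len upd[OF r, of "\<sigma> r"]
        by (cases "\<sigma> r = 0") (simp_all add: map2_act_update scan nth scanned_reg_tape act_reg_tape upd
            prog_config_def fun_upd_idem del: map_map nth_map)
    next
      case (Read s r)
      then have r: "r < R" using ok Op by simp
      have "map scanned ts ! 0 mod 3 = word_cells w (int (\<sigma> 0))"
        using scan[OF assms(1)] scanned_reg_tape_mod by simp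
      then show ?thesis using Read r len upd[OF r, of "\<sigma> r"]
        by (cases "word_cells w (int (\<sigma> 0)) = s") (simp_all add: map2_act_update scan nth act_reg_tape upd
            prog_config_def fun_upd_idem del: map_map nth_map)
    next
      case (Out r)
      then have r: "r < R" using ok Op by simp
      have "scanned (reg_tape w r (\<sigma> r)) < 3 \<longleftrightarrow> \<sigma> r \<noteq> 0"
        using scanned_reg_tape[of w r "\<sigma> r"] by linarith
      moreover have "ts[R := z] = map (\<lambda>r. reg_tape w r (\<sigma> r)) [0..<R] @ [z]" for z
        unfolding ts_def by (simp add: list_update_append)
      ultimately show ?thesis using Out r len
        by (simp add: map2_act_update scan out act_output prog_config_def
            del: map_map nth_map act.simps)
    qed
    then show ?thesis
      using Op assms(3) unfolding step by (cases "exec_op w x (\<sigma>, out)") (simp add: c prog_step_def prog_config_def)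
  next
    case (Jz r a)
    then have "r < R" using ok by simp
    then show ?thesis
      using Jz assms(3) unfolding step
      by (simp add: c prog_step_def prog_config_def scan scanned_reg_tape map2_act_Stay ts_def[symmetric]
          del: map_map nth_map)
  next
    case (Jmp a)
    then show ?thesis
      using assms(3) unfolding step
      by (simp add: c prog_step_def prog_config_def map2_act_Stay ts_def[symmetric] del: map_map nth_map)
  qed
qed

lemma prog_config_init:
  assumes "0 < R"
  shows "tm_step (prog_tm R P) (init_config (prog_tm R P) w) = prog_config R w (0, \<lambda>_. 0, [])"
proof -
  define ts where "ts = (word_cells w, 0 :: int) # replicate R (word_cells [], 0)"
  have len: "length ts = Suc R" by (simp add: ts_def)
  have "map2 act ((map (\<lambda>s. (s mod 3 + 3, Stay)) (map scanned ts))[R := (map scanned ts ! R, Stay)]) ts =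
     map (\<lambda>r. reg_tape w r 0) [0..<R] @ [(word_cells [], 0)]" (is "?l = ?r")
  proof (rule nth_equalityI)
    fix i assume "i < length ?l"
    then have i: "i < Suc R" using len by simp
    then consider "i = 0" | "0 < i" "i < R" | "i = R" by linarith
    then show "?l ! i = ?r ! i"
    proof cases
      case 1
      moreover have "ts ! 0 = (word_cells w, 0)" by (simp add: ts_def)
      ultimately show ?thesis using len assms word_cells_less[of w 0]
        by (auto simp: nth_append reg_tape_def)
    next
      case 2
      then have "ts ! i = (word_cells [], 0)" by (cases i) (auto simp: ts_def)
      then show ?thesis using len 2 by (auto simp: nth_append reg_tape_def word_cells_def)
    next
      case 3
      then have "ts ! i = (word_cells [], 0)" using assms by (cases i) (auto simp: ts_def)
      then show ?thesis using len 3 by (simp add: nth_append)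
    qed
  qed (simp add: len)
  then show ?thesis
    by (simp add: init_config_def prog_config_def prog_tm_def ts_def del: map_map)
qed

lemma poly_time_prog:
  assumes "0 < R" "\<forall>i\<in>set P. instr_ok R (length P) i" "poly_bounded T"
    and "\<And>w. \<exists>t\<le>T (length w). \<exists>\<sigma>. (prog_step w P ^^ t) (0, \<lambda>_. 0, []) = (length P, \<sigma>, f w)"
  shows "poly_time f"
proof -
  let ?M = "prog_tm R P"
  obtain p where p: "\<And>n. Suc (T n) \<le> poly p n"
    using poly_bounded_le_poly[OF poly_bounded_Suc[OF assms(3)]] by blast
  \<comment> \<open>A program that has left its code idles while \<open>t\<close> still counts,
    hence only some \<open>s \<le> t\<close> machine steps are claimed.\<close>
  have sim: "\<exists>s\<le>t. (tm_step ?M ^^ s) (prog_config R w c) = prog_config R w ((prog_step w P ^^ t) c)" for t w c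
  proof (induction t arbitrary: c)
    case (Suc t)
    show ?case
    proof (cases "fst c < length P")
      case True
      from Suc obtain s where "s \<le> t"
        "(tm_step ?M ^^ s) (prog_config R w (prog_step w P c)) = prog_config R w ((prog_step w P ^^ t) (prog_step w P c))"
        by blast
      then show ?thesis
        using prog_config_step[OF assms(1,2) True, of w]
        by (intro exI[of _ "Suc s"]) (simp add: funpow_Suc_right del: funpow.simps)
    next
      case False
      then have "(prog_step w P ^^ Suc t) c = (prog_step w P ^^ t) c"
        by (simp add: funpow_Suc_right prog_step_def del: funpow.simps)
      then show ?thesis using Suc by (metis le_SucI)
    qed
  qed auto
  have "\<exists>t\<le>poly p (length w). halts_with ?M ((tm_step ?M ^^ t) (init_config ?M w)) (f w)" for w
  proof -
    obtain t \<sigma> where t: "t \<le> T (length w)" "(prog_step w P ^^ t) (0, \<lambda>_. 0, []) = (length P, \<sigma>, f w)"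
      using assms(4) by blast
    obtain s where s: "s \<le> t"
      "(tm_step ?M ^^ s) (prog_config R w (0, \<lambda>_. 0, [])) = prog_config R w (length P, \<sigma>, f w)"
      using sim t(2) by metis
    have "halts_with ?M (prog_config R w (length P, \<sigma>, f w)) (f w)"
      by (simp add: halts_with_def prog_config_def prog_tm_def)
    \<comment> \<open>The additional step is the one that marks cell 0.\<close>
    then have "halts_with ?M ((tm_step ?M ^^ Suc s) (init_config ?M w)) (f w)"
      using s(2) prog_config_init[OF assms(1), of P w] by (simp add: funpow_Suc_right del: funpow.simps)
    moreover have "Suc s \<le> poly p (length w)" using s t p[of "length w"] by linarith
    ultimately show ?thesis by blast
  qed
  then show ?thesis
    using turing_machine_prog_tm[OF assms(1,2)] unfolding poly_time_def by blast
qed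

subsection \<open>Structured programs\<close>

datatype com = Basic op | Skip | Seq com com | While nat com

fun com_size :: "com \<Rightarrow> nat" where
  "com_size (Basic x) = 1"
| "com_size Skip = 0"
| "com_size (Seq c d) = com_size c + com_size d"
| "com_size (While r c) = com_size c + 2"

fun compile :: "nat \<Rightarrow> com \<Rightarrow> instr list" where
  "compile a (Basic x) = [Op x]"
| "compile a Skip = []"
| "compile a (Seq c d) = compile a c @ compile (a + com_size c) d"
| "compile a (While r c) = Jz r (a + com_size c + 2) # compile (Suc a) c @ [Jmp a]"

fun regs_bound :: "com \<Rightarrow> nat" where
  "regs_bound (Basic (Inc r)) = Suc r"
| "regs_bound (Basic (Dec r)) = Suc r"
| "regs_bound (Basic (Read s r)) = Suc r"
| "regs_bound (Basic (Out r)) = Suc r"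
| "regs_bound Skip = 0"
| "regs_bound (Seq c d) = max (regs_bound c) (regs_bound d)"
| "regs_bound (While r c) = max (Suc r) (regs_bound c)"

text \<open>The cost counts compiled instructions: the two extra steps of a loop round are the test
  and the jump back, the single step at the exit is the failing test.\<close>

inductive run :: "bool list \<Rightarrow> com \<Rightarrow> store \<Rightarrow> nat \<Rightarrow> store \<Rightarrow> bool" for w where
  run_Basic: "run w (Basic x) s 1 (exec_op w x s)"
| run_Skip: "run w Skip s 0 s"
| run_Seq: "run w c s t s' \<Longrightarrow> run w d s' t' s'' \<Longrightarrow> run w (Seq c d) s (t + t') s''"
| run_While_exit: "fst s r = 0 \<Longrightarrow> run w (While r c) s 1 s"
| run_While_loop: "fst s r \<noteq> 0 \<Longrightarrow> run w c s t s' \<Longrightarrow> run w (While r c) s' t' s'' \<Longrightarrow>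
    run w (While r c) s (t + t' + 2) s''"

lemma length_compile [simp]: "length (compile a c) = com_size c"
  by (induction c arbitrary: a) auto

lemma compile_ok:
  assumes "i \<in> set (compile a c)" "regs_bound c \<le> R" "a + com_size c \<le> n"
  shows "instr_ok R n i"
  using assms
proof (induction c arbitrary: a)
  case (Basic x)
  then show ?case by (cases x) auto
next
  case (Seq c d)
  from Seq.prems(1) consider "i \<in> set (compile a c)" | "i \<in> set (compile (a + com_size c) d)"
    by auto
  then show ?case
    using Seq.prems by cases (auto intro: Seq.IH)
next
  case (While r c)
  from While.prems(1) consider "i \<in> set (compile (Suc a) c)"
    | "i = Jz r (a + com_size c + 2)" | "i = Jmp a"
    by auto
  then show ?case
    using While.prems by cases (auto intro: While.IH)
qed auto

lemma run_compile:
  assumes "run w c s t s'" "P = xs @ compile (length xs) c @ ys"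
  shows "(prog_step w P ^^ t) (length xs, s) = (length xs + com_size c, s')"
  using assms
proof (induction arbitrary: xs ys rule: run.induct)
  case (run_Basic x s)
  then show ?case by (cases s) (simp add: prog_step_def)
next
  case (run_Seq c s t s' d t' s'')
  have "(prog_step w P ^^ t) (length xs, s) = (length xs + com_size c, s')"
    by (rule run_Seq.IH(1)) (use run_Seq.prems in simp)
  moreover have "(prog_step w P ^^ t') (length (xs @ compile (length xs) c), s') =
      (length (xs @ compile (length xs) c) + com_size d, s'')"
    by (rule run_Seq.IH(2)) (use run_Seq.prems in simp)
  ultimately show ?case
    by (simp add: add.commute[of t] funpow_add add.assoc)
next
  case (run_While_exit s r c)
  then show ?case by (cases s) (simp add: prog_step_def nth_append)
next
  case (run_While_loop s r c t s' t' s'')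
  have 1: "prog_step w P (length xs, s) = (Suc (length xs), s)"
    using run_While_loop by (cases s) (simp add: prog_step_def nth_append)
  have 2: "(prog_step w P ^^ t) (length (xs @ [Jz r (length xs + com_size c + 2)]), s) =
      (length (xs @ [Jz r (length xs + com_size c + 2)]) + com_size c, s')"
    by (rule run_While_loop.IH(1)) (use run_While_loop.prems in simp)
  have 3: "prog_step w P (Suc (length xs) + com_size c, s') = (length xs, s')"
    using run_While_loop.prems by (cases s') (simp add: prog_step_def nth_append nth_Cons')
  have 4: "(prog_step w P ^^ t') (length xs, s') = (length xs + com_size (While r c), s'')"
    by (rule run_While_loop.IH(2)) (use run_While_loop.prems in simp)
  have "t + t' + 2 = t' + (1 + (t + 1))" by simp
  then have "(prog_step w P ^^ (t + t' + 2)) (length xs, s) =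
      (prog_step w P ^^ t') ((prog_step w P ^^ 1) ((prog_step w P ^^ t) ((prog_step w P ^^ 1) (length xs, s))))"
    by (simp only: funpow_add comp_apply)
  then show ?case using 1 2 3 4 by simp
qed simp

definition runs :: "bool list \<Rightarrow> com \<Rightarrow> store \<Rightarrow> store \<Rightarrow> nat \<Rightarrow> bool" where
  "runs w c s s' T \<longleftrightarrow> (\<exists>t\<le>T. run w c s t s')"

lemma runs_Basic: "exec_op w x s = s' \<Longrightarrow> runs w (Basic x) s s' 1"
  unfolding runs_def using run_Basic by blast

lemma runs_Skip: "runs w Skip s s 0"
  unfolding runs_def using run_Skip by blast

lemma runs_Seq: "runs w c s s' T \<Longrightarrow> runs w d s' s'' T' \<Longrightarrow> runs w (Seq c d) s s'' (T + T')"
  unfolding runs_def by (meson add_mono run_Seq)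

lemma runs_mono: "runs w c s s' T \<Longrightarrow> T \<le> T' \<Longrightarrow> runs w c s s' T'"
  unfolding runs_def by (meson le_trans)

text \<open>\<open>S i\<close> is the store with \<open>i\<close> rounds still to go, so the index
  can usually be the loop counter itself.\<close>

lemma runs_While:
  assumes "\<And>i. i < n \<Longrightarrow> runs w c (S (Suc i)) (S i) T"
    and "\<And>i. i < n \<Longrightarrow> fst (S (Suc i)) r \<noteq> 0" and "fst (S 0) r = 0"
  shows "runs w (While r c) (S n) (S 0) (n * (T + 2) + 1)"
  using assms
proof (induction n)
  case 0
  then show ?case unfolding runs_def by (metis mult_0 add_0 le_refl run_While_exit)
next
  case (Suc n)
  then have "runs w (While r c) (S n) (S 0) (n * (T + 2) + 1)" by simp
  then obtain t' where t': "t' \<le> n * (T + 2) + 1" "run w (While r c) (S n) t' (S 0)"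
    unfolding runs_def by blast
  obtain t where t: "t \<le> T" "run w c (S (Suc n)) t (S n)"
    using Suc.prems(1)[of n] unfolding runs_def by blast
  have "run w (While r c) (S (Suc n)) (t + t' + 2) (S 0)"
    using Suc.prems(2) t t' by (intro run_While_loop) auto
  moreover have "t + t' + 2 \<le> Suc n * (T + 2) + 1" using t t' by simp
  ultimately show ?case unfolding runs_def by blast
qed

lemma poly_time_runs:
  assumes "poly_bounded T"
    and "\<And>w. \<exists>\<sigma>. runs w c (\<lambda>_. 0, []) (\<sigma>, f w) (T (length w))"
  shows "poly_time f"
proof (rule poly_time_prog)
  show "0 < Suc (regs_bound c)" by simp
  show "\<forall>i\<in>set (compile 0 c). instr_ok (Suc (regs_bound c)) (length (compile 0 c)) i"
    using compile_ok[of _ 0 c] by auto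
  show "poly_bounded T" by fact
  fix w
  obtain \<sigma> t where t: "t \<le> T (length w)" "run w c (\<lambda>_. 0, []) t (\<sigma>, f w)"
    using assms(2) unfolding runs_def by blast
  have "(prog_step w (compile 0 c) ^^ t) (length ([] :: instr list), \<lambda>_. 0, []) =
      (length ([] :: instr list) + com_size c, \<sigma>, f w)"
    by (rule run_compile[OF t(2)]) simp
  then show "\<exists>t\<le>T (length w). \<exists>\<sigma>. (prog_step w (compile 0 c) ^^ t) (0, \<lambda>_. 0, []) =
      (length (compile 0 c), \<sigma>, f w)"
    using t(1) by auto
qed

subsection \<open>Register transfer\<close>

definition move :: "nat \<Rightarrow> nat \<Rightarrow> com" where
  "move a b = While a (Seq (Basic (Dec a)) (Basic (Inc b)))"

lemma runs_move:
  assumes "a \<noteq> b"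
  shows "runs w (move a b) (\<sigma>, out) (\<sigma>(a := 0, b := \<sigma> b + \<sigma> a), out) (\<sigma> a * 4 + 1)"
proof -
  define S where "S i = (\<sigma>(a := i, b := \<sigma> b + (\<sigma> a - i)), out)" for i
  have "runs w (Seq (Basic (Dec a)) (Basic (Inc b))) (S (Suc i)) (S i) 2" if "i < \<sigma> a" for i
    unfolding one_add_one[symmetric]
    by (intro runs_Seq runs_Basic refl) (use that assms in \<open>auto simp: S_def fun_eq_iff\<close>)
  then have "runs w (move a b) (S (\<sigma> a)) (S 0) (\<sigma> a * (2 + 2) + 1)"
    unfolding move_def by (rule runs_While) (use assms in \<open>auto simp: S_def\<close>)
  moreover have "S (\<sigma> a) = (\<sigma>, out)" by (simp add: S_def)
  ultimately show ?thesis by (simp add: S_def)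
qed

text \<open>A counter is read by emptying it. Copying therefore fills two targets, one of which is
  moved back afterwards.\<close>

definition move2 :: "nat \<Rightarrow> nat \<Rightarrow> nat \<Rightarrow> com" where
  "move2 a b c = While a (Seq (Basic (Dec a)) (Seq (Basic (Inc b)) (Basic (Inc c))))"

lemma runs_move2:
  assumes "a \<noteq> b" "a \<noteq> c" "b \<noteq> c"
  shows "runs w (move2 a b c) (\<sigma>, out)
    (\<sigma>(a := 0, b := \<sigma> b + \<sigma> a, c := \<sigma> c + \<sigma> a), out) (\<sigma> a * 5 + 1)"
proof -
  define S where "S i = (\<sigma>(a := i, b := \<sigma> b + (\<sigma> a - i), c := \<sigma> c + (\<sigma> a - i)), out)" for i
  have "runs w (Seq (Basic (Dec a)) (Seq (Basic (Inc b)) (Basic (Inc c)))) (S (Suc i)) (S i) (1 + (1 + 1))"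
    if "i < \<sigma> a" for i
    by (intro runs_Seq runs_Basic refl) (use that assms in \<open>auto simp: S_def fun_eq_iff\<close>)
  then have "runs w (Seq (Basic (Dec a)) (Seq (Basic (Inc b)) (Basic (Inc c)))) (S (Suc i)) (S i) 3"
    if "i < \<sigma> a" for i
    using that by (simp add: numeral_3_eq_3)
  then have "runs w (move2 a b c) (S (\<sigma> a)) (S 0) (\<sigma> a * (3 + 2) + 1)"
    unfolding move2_def by (rule runs_While) (use assms in \<open>auto simp: S_def\<close>)
  moreover have "S (\<sigma> a) = (\<sigma>, out)" by (simp add: S_def)
  ultimately show ?thesis by (simp add: S_def)
qed

definition reset :: "nat \<Rightarrow> com" where
  "reset a = While a (Basic (Dec a))"

lemma runs_reset: "runs w (reset a) (\<sigma>, out) (\<sigma>(a := 0), out) (\<sigma> a * 3 + 1)"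
proof -
  define S where "S i = (\<sigma>(a := i), out)" for i
  have "runs w (Basic (Dec a)) (S (Suc i)) (S i) 1" for i
    by (intro runs_Basic) (auto simp: S_def)
  then have "runs w (reset a) (S (\<sigma> a)) (S 0) (\<sigma> a * (1 + 2) + 1)"
    unfolding reset_def by (rule runs_While) (auto simp: S_def)
  moreover have "1 + 2 = (3 :: nat)" by simp
  ultimately show ?thesis by (simp only: S_def fun_upd_triv)
qed

fun increments :: "nat \<Rightarrow> nat \<Rightarrow> com" where
  "increments a 0 = Skip"
| "increments a (Suc n) = Seq (Basic (Inc a)) (increments a n)"

lemma runs_increments: "runs w (increments a n) (\<sigma>, out) (\<sigma>(a := \<sigma> a + n), out) n"
proof (induction n arbitrary: \<sigma>)
  case (Suc n)
  have "runs w (Basic (Inc a)) (\<sigma>, out) (\<sigma>(a := Suc (\<sigma> a)), out) 1"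
    by (rule runs_Basic) simp
  moreover have "(\<sigma>(a := Suc (\<sigma> a)))(a := (\<sigma>(a := Suc (\<sigma> a))) a + n) = \<sigma>(a := \<sigma> a + Suc n)"
    by (simp add: fun_eq_iff)
  ultimately show ?case
    using runs_Seq Suc[of "\<sigma>(a := Suc (\<sigma> a))"] by (metis increments.simps(2) plus_1_eq_Suc)
qed (simp add: runs_Skip)

section \<open>Arithmetic expressions over an input word\<close>

text \<open>Variables are de Bruijn indices; \<open>Sum n b\<close> is \<open>\<Sum>i<n. b\<close> and binds one variable.\<close>

datatype exp = Const nat | Var nat | Len | Sym exp | Add exp exp | Sub exp exp | Sum exp exp

fun eval :: "bool list \<Rightarrow> exp \<Rightarrow> (nat \<Rightarrow> nat) \<Rightarrow> nat" where
  "eval w (Const n) \<rho> = n"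
| "eval w (Var k) \<rho> = \<rho> k"
| "eval w Len \<rho> = length w"
| "eval w (Sym e) \<rho> = word_cells w (int (eval w e \<rho>))"
| "eval w (Add a b) \<rho> = eval w a \<rho> + eval w b \<rho>"
| "eval w (Sub a b) \<rho> = eval w a \<rho> - eval w b \<rho>"
| "eval w (Sum n b) \<rho> = (\<Sum>i<eval w n \<rho>. eval w b (case_nat i \<rho>))"

text \<open>\<open>code e v m\<close> adds the value of \<open>e\<close> to register \<open>m\<close>, where variable \<open>k\<close> is stored in register
  \<open>v k\<close>, register \<open>1\<close> holds the length of the input, and the registers from \<open>m\<close> on are free.\<close>

fun code :: "exp \<Rightarrow> (nat \<Rightarrow> nat) \<Rightarrow> nat \<Rightarrow> com" where
  "code (Const n) v m = increments m n"
| "code (Var k) v m = Seq (move2 (v k) m (Suc m)) (move (Suc m) (v k))"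
| "code Len v m = Seq (move2 1 m (Suc m)) (move (Suc m) 1)"
| "code (Sym e) v m = Seq (code e v m) (Seq (move2 m (Suc m) 0)
     (Seq (Basic (Read 1 m)) (Seq (Basic (Read 2 m)) (Seq (Basic (Read 2 m))
       (While (Suc m) (Seq (Basic (Dec (Suc m))) (Basic (Dec 0))))))))"
| "code (Add a b) v m = Seq (code a v m) (Seq (code b v (Suc m)) (move (Suc m) m))"
| "code (Sub a b) v m = Seq (code a v m) (Seq (code b v (Suc m))
     (While (Suc m) (Seq (Basic (Dec (Suc m))) (Basic (Dec m)))))"
| "code (Sum n b) v m = Seq (code n v m)
     (Seq (While m (Seq (Basic (Dec m))
       (Seq (code b (case_nat m v) (Suc (Suc m))) (move (Suc (Suc m)) (Suc m)))))
     (move (Suc m) m))"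

section \<open>Correctness and cost of evaluating expressions\<close>

definition ready :: "bool list \<Rightarrow> (nat \<Rightarrow> nat) \<Rightarrow> nat \<Rightarrow> (nat \<Rightarrow> nat) \<Rightarrow> bool" where
  "ready w v m \<sigma> \<longleftrightarrow> 2 \<le> m \<and> \<sigma> 0 = 0 \<and> \<sigma> 1 = length w \<and> (\<forall>r\<ge>m. \<sigma> r = 0) \<and> (\<forall>k. 0 < v k \<and> v k < m)"

text \<open>One function bounds both the value and the running time, because values become loop
  counts in the code of surrounding expressions. \<open>B\<close> bounds the input length and all
  variables together.\<close>

definition computes_within :: "exp \<Rightarrow> (nat \<Rightarrow> nat) \<Rightarrow> bool" where
  "computes_within e g \<longleftrightarrow> (\<forall>w v m \<sigma> out B. ready w v m \<sigma> \<and> length w \<le> B \<and> (\<forall>k. \<sigma> (v k) \<le> B) \<longrightarrow>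
     eval w e (\<lambda>k. \<sigma> (v k)) \<le> g B \<and>
     runs w (code e v m) (\<sigma>, out) (\<sigma>(m := eval w e (\<lambda>k. \<sigma> (v k))), out) (g B))"

lemma computes_withinD:
  assumes "computes_within e g" "ready w v m \<sigma>" "length w \<le> B" "\<And>k. \<sigma> (v k) \<le> B"
  shows "eval w e (\<lambda>k. \<sigma> (v k)) \<le> g B"
    and "runs w (code e v m) (\<sigma>, out) (\<sigma>(m := eval w e (\<lambda>k. \<sigma> (v k))), out) (g B)"
  using assms unfolding computes_within_def by blast+

lemma ready_Suc:
  assumes "ready w v m \<sigma>"
  shows "ready w v (Suc m) (\<sigma>(m := x))"
  using assms unfolding ready_def by (auto simp: less_Suc_eq)

lemma upd_var: "ready w v m \<sigma> \<Longrightarrow> (\<sigma>(m := x)) (v k) = \<sigma> (v k)"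
  unfolding ready_def by (metis fun_upd_other less_irrefl)

lemma word_cells_cases: "word_cells w i = 0 \<or> word_cells w i = 1 \<or> word_cells w i = 2"
  by (simp add: word_cells_def bit_symbol_def)

lemmas poly_bounded_intros = poly_bounded_const poly_bounded_id poly_bounded_add poly_bounded_mult
  poly_bounded_Suc

lemma computes_within_Sym:
  assumes "computes_within e g"
  shows "computes_within (Sym e) (\<lambda>B. g B * 9 + g B + 8)"
  unfolding computes_within_def
proof (intro allI impI)
  fix w v m \<sigma> out B
  assume A: "ready w v m \<sigma> \<and> length w \<le> B \<and> (\<forall>k. \<sigma> (v k) \<le> B)"
  define x where "x = eval w e (\<lambda>k. \<sigma> (v k))"
  have x: "x \<le> g B" and r: "runs w (code e v m) (\<sigma>, out) (\<sigma>(m := x), out) (g B)"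
    using computes_withinD[OF assms] A unfolding x_def by auto
  have m: "2 \<le> m" "\<sigma> 0 = 0" "\<sigma> m = 0" "\<sigma> (Suc m) = 0" using A unfolding ready_def by auto
  let ?s = "word_cells w (int x)"
  define S where "S i = (\<sigma>(m := ?s, Suc m := i, 0 := i), out)" for i
  have r2: "runs w (move2 m (Suc m) 0) (\<sigma>(m := x), out) (\<sigma>(Suc m := x, 0 := x), out) (x * 5 + 1)"
  proof -
    have "(\<sigma>(m := x))(m := 0, Suc m := (\<sigma>(m := x)) (Suc m) + (\<sigma>(m := x)) m,
        0 := (\<sigma>(m := x)) 0 + (\<sigma>(m := x)) m) = \<sigma>(Suc m := x, 0 := x)"
      using m by (auto simp: fun_eq_iff)
    then show ?thesis
      using runs_move2[of m "Suc m" 0 w "\<sigma>(m := x)" out] m by simp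
  qed
  \<comment> \<open>Testing once for symbol 1 and twice for symbol 2 adds exactly the scanned symbol
    to register \<open>m\<close>, which the preceding move has emptied.\<close>
  have reads: "exec_op w (Read 2 m) (exec_op w (Read 2 m) (exec_op w (Read 1 m) (\<sigma>(Suc m := x, 0 := x), out))) = S x"
    using m word_cells_cases[of w "int x"] by (elim disjE) (simp_all add: S_def fun_eq_iff)
  have r3: "runs w (Seq (Basic (Read 1 m)) (Seq (Basic (Read 2 m)) (Seq (Basic (Read 2 m)) c)))
      (\<sigma>(Suc m := x, 0 := x), out) s' (1 + (1 + (1 + T)))" if "runs w c (S x) s' T" for c s' T
  proof -
    have "runs w c (exec_op w (Read 2 m) (exec_op w (Read 2 m)
        (exec_op w (Read 1 m) (\<sigma>(Suc m := x, 0 := x), out)))) s' T"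
      using that reads by (simp only:)
    then show ?thesis
      by (rule runs_Seq[OF runs_Basic[OF refl] runs_Seq[OF runs_Basic[OF refl] runs_Seq[OF runs_Basic[OF refl]]]])
  qed
  have "runs w (Seq (Basic (Dec (Suc m))) (Basic (Dec 0))) (S (Suc i)) (S i) (1 + 1)" for i
    by (intro runs_Seq runs_Basic refl) (use m in \<open>auto simp: S_def fun_eq_iff\<close>)
  then have r4: "runs w (While (Suc m) (Seq (Basic (Dec (Suc m))) (Basic (Dec 0)))) (S x) (S 0) (x * ((1 + 1) + 2) + 1)"
    by (rule runs_While) (use m in \<open>auto simp: S_def\<close>)
  have "S 0 = (\<sigma>(m := ?s), out)"
    using m by (auto simp: S_def fun_eq_iff)
  moreover have "runs w (code (Sym e) v m) (\<sigma>, out) (S 0)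
      (g B + ((x * 5 + 1) + (1 + (1 + (1 + (x * ((1 + 1) + 2) + 1))))))"
    unfolding code.simps by (intro runs_Seq[OF r] runs_Seq[OF r2] r3 r4)
  ultimately show "eval w (Sym e) (\<lambda>k. \<sigma> (v k)) \<le> g B * 9 + g B + 8 \<and>
     runs w (code (Sym e) v m) (\<sigma>, out) (\<sigma>(m := eval w (Sym e) (\<lambda>k. \<sigma> (v k))), out) (g B * 9 + g B + 8)"
    using word_cells_less[of w "int x"] x by (auto simp: x_def[symmetric] elim!: runs_mono)
qed

lemma computes_within_copy:
  assumes "\<And>v m. code e v m = Seq (move2 (r v) m (Suc m)) (move (Suc m) (r v))"
    and "\<And>w v m \<sigma>. ready w v m \<sigma> \<Longrightarrow> eval w e (\<lambda>k. \<sigma> (v k)) = \<sigma> (r v) \<and> 0 < r v \<and> r v < m"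
    and "\<And>w v m \<sigma> B. ready w v m \<sigma> \<Longrightarrow> length w \<le> B \<Longrightarrow> \<forall>k. \<sigma> (v k) \<le> B \<Longrightarrow> \<sigma> (r v) \<le> B"
  shows "computes_within e (\<lambda>B. B * 9 + 2)"
  unfolding computes_within_def
proof (intro allI impI)
  fix w v m \<sigma> out B
  assume A: "ready w v m \<sigma> \<and> length w \<le> B \<and> (\<forall>k. \<sigma> (v k) \<le> B)"
  have e: "eval w e (\<lambda>k. \<sigma> (v k)) = \<sigma> (r v)" "0 < r v" "r v < m" "\<sigma> (r v) \<le> B"
    using assms(2,3) A by blast+
  have m: "\<sigma> m = 0" "\<sigma> (Suc m) = 0" using A unfolding ready_def by auto
  let ?\<sigma> = "\<sigma>(r v := 0, m := \<sigma> m + \<sigma> (r v), Suc m := \<sigma> (Suc m) + \<sigma> (r v))"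
  have "runs w (move2 (r v) m (Suc m)) (\<sigma>, out) (?\<sigma>, out) (\<sigma> (r v) * 5 + 1)"
    using e by (intro runs_move2) auto
  moreover have "runs w (move (Suc m) (r v)) (?\<sigma>, out)
      (?\<sigma>(Suc m := 0, r v := ?\<sigma> (r v) + ?\<sigma> (Suc m)), out) (?\<sigma> (Suc m) * 4 + 1)"
    using e by (intro runs_move) auto
  moreover have "?\<sigma>(Suc m := 0, r v := ?\<sigma> (r v) + ?\<sigma> (Suc m)) = \<sigma>(m := \<sigma> (r v))"
    using e m by (auto simp: fun_eq_iff)
  ultimately have "runs w (code e v m) (\<sigma>, out) (\<sigma>(m := \<sigma> (r v)), out) (\<sigma> (r v) * 5 + 1 + (?\<sigma> (Suc m) * 4 + 1))"
    unfolding assms(1) by (intro runs_Seq) auto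
  then show "eval w e (\<lambda>k. \<sigma> (v k)) \<le> B * 9 + 2 \<and>
     runs w (code e v m) (\<sigma>, out) (\<sigma>(m := eval w e (\<lambda>k. \<sigma> (v k))), out) (B * 9 + 2)"
    using e m by (auto elim!: runs_mono)
qed

lemma computes_within_Add:
  assumes "computes_within a g" "computes_within b h"
  shows "computes_within (Add a b) (\<lambda>B. g B + h B * 5 + 1)"
  unfolding computes_within_def
proof (intro allI impI)
  fix w v m \<sigma> out B
  assume A: "ready w v m \<sigma> \<and> length w \<le> B \<and> (\<forall>k. \<sigma> (v k) \<le> B)"
  define x where "x = eval w a (\<lambda>k. \<sigma> (v k))"
  define y where "y = eval w b (\<lambda>k. \<sigma> (v k))"
  have x: "x \<le> g B" and 1: "runs w (code a v m) (\<sigma>, out) (\<sigma>(m := x), out) (g B)"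
    using computes_withinD[OF assms(1)] A unfolding x_def by auto
  have v: "(\<sigma>(m := x)) (v k) = \<sigma> (v k)" for k using A by (blast intro: upd_var)
  have y: "y \<le> h B" and 2: "runs w (code b v (Suc m)) (\<sigma>(m := x), out) (\<sigma>(m := x, Suc m := y), out) (h B)"
    using computes_withinD[OF assms(2) ready_Suc, of w v m \<sigma> B x] A unfolding y_def v by auto
  have "runs w (move (Suc m) m) (\<sigma>(m := x, Suc m := y), out) (\<sigma>(m := x + y), out) (y * 4 + 1)"
  proof -
    have "\<sigma>(m := x, Suc m := 0) = \<sigma>(m := x)" using A by (auto simp: ready_def fun_eq_iff)
    then show ?thesis
      using runs_move[of "Suc m" m w "\<sigma>(m := x, Suc m := y)" out]
      by (simp add: fun_upd_twist[of m "Suc m"])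
  qed
  then have "runs w (code (Add a b) v m) (\<sigma>, out) (\<sigma>(m := x + y), out) (g B + (h B + (y * 4 + 1)))"
    unfolding code.simps by (intro runs_Seq[OF 1] runs_Seq[OF 2])
  then show "eval w (Add a b) (\<lambda>k. \<sigma> (v k)) \<le> g B + h B * 5 + 1 \<and>
     runs w (code (Add a b) v m) (\<sigma>, out) (\<sigma>(m := eval w (Add a b) (\<lambda>k. \<sigma> (v k))), out) (g B + h B * 5 + 1)"
    using x y by (auto simp: x_def[symmetric] y_def[symmetric] elim!: runs_mono)
qed

lemma computes_within_Sub:
  assumes "computes_within a g" "computes_within b h"
  shows "computes_within (Sub a b) (\<lambda>B. g B + h B * 5 + 1)"
  unfolding computes_within_def
proof (intro allI impI)
  fix w v m \<sigma> out B
  assume A: "ready w v m \<sigma> \<and> length w \<le> B \<and> (\<forall>k. \<sigma> (v k) \<le> B)"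
  define x where "x = eval w a (\<lambda>k. \<sigma> (v k))"
  define y where "y = eval w b (\<lambda>k. \<sigma> (v k))"
  have x: "x \<le> g B" and 1: "runs w (code a v m) (\<sigma>, out) (\<sigma>(m := x), out) (g B)"
    using computes_withinD[OF assms(1)] A unfolding x_def by auto
  have v: "(\<sigma>(m := x)) (v k) = \<sigma> (v k)" for k using A by (blast intro: upd_var)
  have y: "y \<le> h B" and 2: "runs w (code b v (Suc m)) (\<sigma>(m := x), out) (\<sigma>(m := x, Suc m := y), out) (h B)"
    using computes_withinD[OF assms(2) ready_Suc, of w v m \<sigma> B x] A unfolding y_def v by auto
  define S where "S i = (\<sigma>(m := x - (y - i), Suc m := i), out)" for i
  have "runs w (Seq (Basic (Dec (Suc m))) (Basic (Dec m))) (S (Suc i)) (S i) 2" if "i < y" for i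
    unfolding one_add_one[symmetric] by (intro runs_Seq runs_Basic refl) (use that in \<open>auto simp: S_def fun_eq_iff\<close>)
  then have "runs w (While (Suc m) (Seq (Basic (Dec (Suc m))) (Basic (Dec m)))) (S y) (S 0) (y * (2 + 2) + 1)"
    by (rule runs_While) (auto simp: S_def)
  moreover have "S y = (\<sigma>(m := x, Suc m := y), out)" by (simp add: S_def)
  moreover have "S 0 = (\<sigma>(m := x - y), out)" using A by (auto simp: S_def ready_def fun_eq_iff)
  ultimately have "runs w (While (Suc m) (Seq (Basic (Dec (Suc m))) (Basic (Dec m))))
      (\<sigma>(m := x, Suc m := y), out) (\<sigma>(m := x - y), out) (y * 4 + 1)" by simp
  then have "runs w (code (Sub a b) v m) (\<sigma>, out) (\<sigma>(m := x - y), out) (g B + (h B + (y * 4 + 1)))"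
    unfolding code.simps by (intro runs_Seq[OF 1] runs_Seq[OF 2])
  then show "eval w (Sub a b) (\<lambda>k. \<sigma> (v k)) \<le> g B + h B * 5 + 1 \<and>
     runs w (code (Sub a b) v m) (\<sigma>, out) (\<sigma>(m := eval w (Sub a b) (\<lambda>k. \<sigma> (v k))), out) (g B + h B * 5 + 1)"
    using x y by (auto simp: x_def[symmetric] y_def[symmetric] elim!: runs_mono)
qed

text \<open>Register \<open>m\<close> is both the loop counter and the bound variable: it is
  decremented before the body, hence runs through all indices downwards to 0. An index may exceed
  \<open>B\<close> but not \<open>g B\<close>, so the body is bounded at
  \<open>B + g B\<close>.\<close>

lemma computes_within_Sum:
  assumes "computes_within n g" "computes_within b h"
  shows "computes_within (Sum n b)
    (\<lambda>B. g B + g B * (h (B + g B) * 5 + 4) + 1 + g B * h (B + g B) * 4 + 1)"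
  unfolding computes_within_def
proof (intro allI impI)
  fix w v m \<sigma> out B
  assume A: "ready w v m \<sigma> \<and> length w \<le> B \<and> (\<forall>k. \<sigma> (v k) \<le> B)"
  let ?B = "B + g B"
  define N where "N = eval w n (\<lambda>k. \<sigma> (v k))"
  define f where "f i = eval w b (case_nat i (\<lambda>k. \<sigma> (v k)))" for i
  have N: "N \<le> g B" and 1: "runs w (code n v m) (\<sigma>, out) (\<sigma>(m := N), out) (g B)"
    using computes_withinD[OF assms(1)] A unfolding N_def by auto
  \<comment> \<open>\<open>\<tau> i\<close> is the store between two rounds, with the terms from
    \<open>i\<close> on already summed. \<open>\<tau>' i\<close> is the store inside the round for
    index \<open>i\<close>, whose term is not yet added.\<close>
  define \<tau> where "\<tau> i = \<sigma>(m := i, Suc m := \<Sum>j\<in>{i..<N}. f j)" for i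
  define \<tau>' where "\<tau>' i = \<sigma>(m := i, Suc m := \<Sum>j\<in>{Suc i..<N}. f j)" for i
  define S where "S i = (\<tau> i, out)" for i
  have body: "f i \<le> h ?B \<and> runs w (code b (case_nat m v) (Suc (Suc m))) (\<tau>' i, out)
      ((\<tau>' i)(Suc (Suc m) := f i), out) (h ?B)" if "i < N" for i
  proof -
    have v: "\<tau>' i (case_nat m v k) = case_nat i (\<lambda>k. \<sigma> (v k)) k" for k
      using A by (cases k) (auto simp: \<tau>'_def ready_def intro: gr0I dest: spec[of _ "k - 1"])
    have "ready w (case_nat m v) (Suc (Suc m)) (\<tau>' i)"
      using A by (auto simp: ready_def \<tau>'_def less_Suc_eq split: nat.split)
    moreover have "\<tau>' i (case_nat m v k) \<le> ?B" for k
      unfolding v using A N that by (cases k) (auto intro: trans_le_add1)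
    ultimately show ?thesis
      using computes_withinD[OF assms(2), of w "case_nat m v" "Suc (Suc m)" "\<tau>' i" ?B] A
      unfolding v f_def by auto
  qed
  have loop: "runs w (Seq (Basic (Dec m)) (Seq (code b (case_nat m v) (Suc (Suc m))) (move (Suc (Suc m)) (Suc m))))
      (S (Suc i)) (S i) (1 + (h ?B + (h ?B * 4 + 1)))" if "i < N" for i
  proof (intro runs_Seq)
    show "runs w (Basic (Dec m)) (S (Suc i)) (\<tau>' i, out) 1"
      by (rule runs_Basic) (auto simp: S_def \<tau>_def \<tau>'_def fun_eq_iff)
    show "runs w (code b (case_nat m v) (Suc (Suc m))) (\<tau>' i, out) ((\<tau>' i)(Suc (Suc m) := f i), out) (h ?B)"
      using body that by blast
    have "(\<Sum>j\<in>{i..<N}. f j) = f i + (\<Sum>j\<in>{Suc i..<N}. f j)"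
      using that by (rule sum.atLeast_Suc_lessThan)
    then have "(\<tau>' i)(Suc (Suc m) := 0, Suc m := \<tau>' i (Suc m) + f i) = \<tau> i"
      using A by (auto simp: \<tau>_def \<tau>'_def fun_eq_iff ready_def)
    then have "runs w (move (Suc (Suc m)) (Suc m)) ((\<tau>' i)(Suc (Suc m) := f i), out) (S i) (f i * 4 + 1)"
      using runs_move[of "Suc (Suc m)" "Suc m" w "(\<tau>' i)(Suc (Suc m) := f i)" out] by (simp add: S_def)
    then show "runs w (move (Suc (Suc m)) (Suc m)) ((\<tau>' i)(Suc (Suc m) := f i), out) (S i) (h ?B * 4 + 1)"
      using body[OF that] by (auto elim!: runs_mono)
  qed
  have 2: "runs w (While m (Seq (Basic (Dec m)) (Seq (code b (case_nat m v) (Suc (Suc m))) (move (Suc (Suc m)) (Suc m)))))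
      (\<sigma>(m := N), out) (S 0) (N * ((1 + (h ?B + (h ?B * 4 + 1))) + 2) + 1)"
  proof -
    have "S N = (\<sigma>(m := N), out)" using A by (auto simp: S_def \<tau>_def fun_eq_iff ready_def)
    moreover have "runs w (While m (Seq (Basic (Dec m)) (Seq (code b (case_nat m v) (Suc (Suc m))) (move (Suc (Suc m)) (Suc m)))))
        (S N) (S 0) (N * ((1 + (h ?B + (h ?B * 4 + 1))) + 2) + 1)"
      by (rule runs_While[where S = S, OF loop]) (auto simp: S_def \<tau>_def)
    ultimately show ?thesis by (simp only:)
  qed
  have sum_le: "(\<Sum>j<N. f j) \<le> g B * h ?B"
  proof -
    have "(\<Sum>j<N. f j) \<le> (\<Sum>j<N. h ?B)" using body by (intro sum_mono) auto
    also have "\<dots> \<le> g B * h ?B" using N by simp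
    finally show ?thesis .
  qed
  have "(\<tau> 0)(Suc m := 0, m := \<tau> 0 m + \<tau> 0 (Suc m)) = \<sigma>(m := \<Sum>j<N. f j)"
    using A by (auto simp: \<tau>_def fun_eq_iff ready_def atLeast0LessThan)
  moreover have "runs w (move (Suc m) m) (\<tau> 0, out)
      ((\<tau> 0)(Suc m := 0, m := \<tau> 0 m + \<tau> 0 (Suc m)), out) (\<tau> 0 (Suc m) * 4 + 1)"
    by (rule runs_move) simp
  ultimately have 3: "runs w (move (Suc m) m) (S 0) (\<sigma>(m := \<Sum>j<N. f j), out) ((\<Sum>j<N. f j) * 4 + 1)"
    by (simp add: S_def \<tau>_def atLeast0LessThan)
  have "runs w (code (Sum n b) v m) (\<sigma>, out) (\<sigma>(m := \<Sum>j<N. f j), out)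
     (g B + ((N * ((1 + (h ?B + (h ?B * 4 + 1))) + 2) + 1) + ((\<Sum>j<N. f j) * 4 + 1)))"
    unfolding code.simps by (intro runs_Seq[OF 1] runs_Seq[OF 2] 3)
  moreover have "N * ((1 + (h ?B + (h ?B * 4 + 1))) + 2) \<le> g B * (h ?B * 5 + 4)"
    using N by (intro mult_mono) auto
  ultimately have "runs w (code (Sum n b) v m) (\<sigma>, out) (\<sigma>(m := \<Sum>j<N. f j), out)
     (g B + g B * (h ?B * 5 + 4) + 1 + g B * h ?B * 4 + 1)"
    using sum_le by (elim runs_mono) linarith
  then show "eval w (Sum n b) (\<lambda>k. \<sigma> (v k)) \<le> g B + g B * (h ?B * 5 + 4) + 1 + g B * h ?B * 4 + 1 \<and>
     runs w (code (Sum n b) v m) (\<sigma>, out) (\<sigma>(m := eval w (Sum n b) (\<lambda>k. \<sigma> (v k))), out)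
       (g B + g B * (h ?B * 5 + 4) + 1 + g B * h ?B * 4 + 1)"
    using sum_le by (simp add: N_def[symmetric] f_def[symmetric])
qed

lemma computes_within_poly: "\<exists>g. poly_bounded g \<and> computes_within e g"
proof (induction e)
  case (Const n)
  have "computes_within (Const n) (\<lambda>_. n)"
    unfolding computes_within_def
  proof (intro allI impI)
    fix w v m \<sigma> out B
    assume "ready w v m \<sigma> \<and> length w \<le> B \<and> (\<forall>k. \<sigma> (v k) \<le> B)"
    then have "\<sigma> m = 0" by (auto simp: ready_def)
    then show "eval w (Const n) (\<lambda>k. \<sigma> (v k)) \<le> n \<and>
        runs w (code (Const n) v m) (\<sigma>, out) (\<sigma>(m := eval w (Const n) (\<lambda>k. \<sigma> (v k))), out) n"
      using runs_increments[of w m n \<sigma> out] by simp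
  qed
  then show ?case using poly_bounded_const by blast
next
  case (Var k)
  have "computes_within (Var k) (\<lambda>B. B * 9 + 2)"
    by (rule computes_within_copy[where r = "\<lambda>v. v k"]) (auto simp: ready_def)
  moreover have "poly_bounded (\<lambda>B. B * 9 + 2)" by (intro poly_bounded_intros)
  ultimately show ?case by blast
next
  case Len
  have "computes_within Len (\<lambda>B. B * 9 + 2)"
    by (rule computes_within_copy[where r = "\<lambda>v. 1"]) (auto simp: ready_def)
  moreover have "poly_bounded (\<lambda>B. B * 9 + 2)" by (intro poly_bounded_intros)
  ultimately show ?case by blast
next
  case (Sym e)
  then obtain g where g: "poly_bounded g" "computes_within e g" by blast
  have "poly_bounded (\<lambda>B. g B * 9 + g B + 8)" by (intro poly_bounded_intros g)
  then show ?case using computes_within_Sym[OF g(2)] by blast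
next
  case (Add a b)
  then obtain g h where g: "poly_bounded g" "computes_within a g" "poly_bounded h" "computes_within b h"
    by blast
  have "poly_bounded (\<lambda>B. g B + h B * 5 + 1)" by (intro poly_bounded_intros g)
  then show ?case using computes_within_Add[OF g(2,4)] by blast
next
  case (Sub a b)
  then obtain g h where g: "poly_bounded g" "computes_within a g" "poly_bounded h" "computes_within b h"
    by blast
  have "poly_bounded (\<lambda>B. g B + h B * 5 + 1)" by (intro poly_bounded_intros g)
  then show ?case using computes_within_Sub[OF g(2,4)] by blast
next
  case (Sum n b)
  then obtain g h where g: "poly_bounded g" "computes_within n g" "poly_bounded h" "computes_within b h"
    by blast
  have "poly_bounded (\<lambda>B. h (B + g B))"
    by (rule poly_bounded_compose[OF g(3)]) (intro poly_bounded_intros g(1))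
  then have "poly_bounded (\<lambda>B. g B + g B * (h (B + g B) * 5 + 4) + 1 + g B * h (B + g B) * 4 + 1)"
    by (intro poly_bounded_intros g)
  then show ?case using computes_within_Sum[OF g(2,4)] by blast
qed

subsection \<open>Words with computable letters\<close>

text \<open>Register 2 is a flag that is cleared in each round and set again if the scanned cell is
  not blank; register 1 counts these cells. The blank takes one more round, so the head ends at
  \<open>Suc (length w)\<close> and has to be reset.\<close>

definition input_length :: com where
  "input_length = Seq (Basic (Inc 2)) (Seq (While 2 (Seq (Basic (Dec 2)) (Seq (Basic (Read 1 2))
     (Seq (Basic (Read 2 2)) (Seq (Basic (Read 1 1)) (Seq (Basic (Read 2 1)) (Basic (Inc 0))))))))
     (reset 0))"

lemma runs_input_length:
  "runs w input_length (\<lambda>_. 0, []) ((\<lambda>_. 0)(1 := length w), []) (length w * 11 + 14)"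
proof -
  define L where "L = length w"
  define S where "S i = ((\<lambda>_ :: nat. 0)(0 := Suc L - i, 1 := min L (Suc L - i), 2 := if i = 0 then 0 else 1 :: nat), [] :: bool list)" for i
  have cell: "word_cells w (int i) = 1 \<or> word_cells w (int i) = 2" if "i < L" for i
    using that by (auto simp: word_cells_def bit_symbol_def L_def)
  have blank: "word_cells w (int L) = 0" by (simp add: word_cells_def L_def)
  have "exec_op w (Inc 0) (exec_op w (Read 2 1) (exec_op w (Read 1 1) (exec_op w (Read 2 2)
     (exec_op w (Read 1 2) (exec_op w (Dec 2) (S (Suc i))))))) = S i" if "i < Suc L" for i
  proof (cases i)
    case 0
    then show ?thesis using blank by (auto simp: S_def fun_eq_iff)
  next
    case (Suc j)
    then have "L - i < L" using that by simp
    from cell[OF this] show ?thesis using Suc that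
      by (elim disjE) (auto simp: S_def fun_eq_iff Suc_diff_le)
  qed
  then have "runs w (Seq (Basic (Dec 2)) (Seq (Basic (Read 1 2)) (Seq (Basic (Read 2 2))
      (Seq (Basic (Read 1 1)) (Seq (Basic (Read 2 1)) (Basic (Inc 0))))))) (S (Suc i)) (S i)
      (1 + (1 + (1 + (1 + (1 + 1)))))" if "i < Suc L" for i
    using that by (intro runs_Seq[OF runs_Basic[OF refl]] runs_Basic) simp
  then have 2: "runs w (While 2 (Seq (Basic (Dec 2)) (Seq (Basic (Read 1 2))
     (Seq (Basic (Read 2 2)) (Seq (Basic (Read 1 1)) (Seq (Basic (Read 2 1)) (Basic (Inc 0))))))))
     (S (Suc L)) (S 0) (Suc L * ((1 + (1 + (1 + (1 + (1 + 1))))) + 2) + 1)"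
    by (rule runs_While) (auto simp: S_def)
  have 1: "runs w (Basic (Inc 2)) (\<lambda>_. 0, []) (S (Suc L)) 1"
    by (rule runs_Basic) (auto simp: S_def fun_eq_iff)
  have "(fst (S 0))(0 := 0) = (\<lambda>_. 0)(1 := L)" by (auto simp: S_def fun_eq_iff)
  moreover have "snd (S 0) = []" "fst (S 0) 0 = Suc L" by (simp_all add: S_def)
  ultimately have 3: "runs w (reset 0) (S 0) ((\<lambda>_. 0)(1 := L), []) (Suc L * 3 + 1)"
    using runs_reset[of w 0 "fst (S 0)" "snd (S 0)"] by (cases "S 0") simp
  show ?thesis
    unfolding input_length_def L_def[symmetric]
    by (rule runs_mono[OF runs_Seq[OF 1 runs_Seq[OF 2 3]]]) simp
qed

text \<open>Every letter is computed afresh. Register 3 holds the number of letters left, 4 the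
  current position, and those from 5 on are scratch; register 2 stays 0 and serves as the value of
  all other variables.\<close>

theorem poly_time_expressions:
  assumes "\<And>w. f w = map (\<lambda>i. eval w b (case_nat i (\<lambda>_. 0)) \<noteq> 0) [0..<eval w n (\<lambda>_. 0)]"
  shows "poly_time f"
proof -
  obtain g h where g: "poly_bounded g" "computes_within n g" and h: "poly_bounded h" "computes_within b h"
    using computes_within_poly by blast
  define body where "body = Seq (Basic (Dec 3)) (Seq (code b (case_nat 4 (\<lambda>_. 2)) 5)
    (Seq (Basic (Out 5)) (Seq (reset 5) (Basic (Inc 4)))))"
  define prog where "prog = Seq input_length (Seq (code n (\<lambda>_. 2) 3) (While 3 body))"
  define T where "T B = (B * 11 + 14) + (g B + (g B * (h (B + g B) * 4 + 6) + 1))" for B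
  have "runs w prog (\<lambda>_. 0, []) ((\<lambda>_. 0)(1 := length w, 4 := eval w n (\<lambda>_. 0)), f w) (T (length w))" for w
  proof -
    define L where "L = length w"
    define N where "N = eval w n (\<lambda>_. 0)"
    define v where "v i = eval w b (case_nat i (\<lambda>_. 0))" for i
    define \<sigma> where "\<sigma> = (\<lambda>_ :: nat. 0)(1 := L)"
    let ?B = "L + g L"
    have "ready w (\<lambda>_. 2) 3 \<sigma>" by (auto simp: ready_def \<sigma>_def L_def)
    moreover have \<sigma>2: "\<sigma> 2 = 0" by (simp add: \<sigma>_def)
    ultimately have N: "N \<le> g L" and 1: "runs w (code n (\<lambda>_. 2) 3) (\<sigma>, []) (\<sigma>(3 := N), []) (g L)"
      using computes_withinD[OF g(2), of w "\<lambda>_. 2" 3 \<sigma> L] by (auto simp: N_def L_def)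
    define S where "S i = (\<sigma>(3 := i, 4 := N - i), map (\<lambda>j. v j \<noteq> 0) [0..<N - i])" for i
    have loop: "runs w body (S (Suc i)) (S i) (h ?B * 4 + 4)" if i: "i < N" for i
    proof -
      define j where "j = N - Suc i"
      define \<tau> where "\<tau> = \<sigma>(3 := i, 4 := j)"
      define out where "out = map (\<lambda>j. v j \<noteq> 0) [0..<j]"
      have j: "N - i = Suc j" "N - Suc i = j" using i by (auto simp: j_def)
      have r1: "runs w (Basic (Dec 3)) (S (Suc i)) (\<tau>, out) 1"
        by (rule runs_Basic) (auto simp: S_def \<tau>_def out_def j fun_eq_iff)
      have "ready w (case_nat 4 (\<lambda>_. 2)) 5 \<tau>"
        by (auto simp: ready_def \<tau>_def \<sigma>_def L_def split: nat.split)
      moreover have env: "\<tau> (case_nat 4 (\<lambda>_. 2) k) = case_nat j (\<lambda>_. 0) k" for k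
        by (cases k) (auto simp: \<tau>_def \<sigma>2)
      moreover have "case_nat j (\<lambda>_. 0) k \<le> ?B" for k
        using N by (cases k) (auto simp: j_def)
      ultimately have vj: "v j \<le> h ?B"
        and r2: "runs w (code b (case_nat 4 (\<lambda>_. 2)) 5) (\<tau>, out) (\<tau>(5 := v j), out) (h ?B)"
        using computes_withinD[OF h(2), of w "case_nat 4 (\<lambda>_. 2)" 5 \<tau> ?B]
        unfolding env v_def by (auto simp: L_def)
      have r3: "runs w (Basic (Out 5)) (\<tau>(5 := v j), out) (\<tau>(5 := v j), out @ [v j \<noteq> 0]) 1"
        by (rule runs_Basic) simp
      have r4: "runs w (reset 5) (\<tau>(5 := v j), out @ [v j \<noteq> 0]) (\<tau>, out @ [v j \<noteq> 0]) (v j * 3 + 1)"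
      proof -
        have "\<tau>(5 := 0) = \<tau>" by (auto simp: \<tau>_def \<sigma>_def fun_eq_iff)
        then show ?thesis using runs_reset[of w 5 "\<tau>(5 := v j)"] by simp
      qed
      have r5: "runs w (Basic (Inc 4)) (\<tau>, out @ [v j \<noteq> 0]) (S i) 1"
        by (rule runs_Basic) (auto simp: S_def \<tau>_def out_def j fun_eq_iff)
      show ?thesis
        unfolding body_def
        by (rule runs_mono[OF runs_Seq[OF r1 runs_Seq[OF r2 runs_Seq[OF r3 runs_Seq[OF r4 r5]]]]])
          (use vj in simp)
    qed
    have 2: "runs w (While 3 body) (S N) (S 0) (N * ((h ?B * 4 + 4) + 2) + 1)"
      by (rule runs_While[where S = S, OF loop]) (auto simp: S_def)
    have "S N = (\<sigma>(3 := N), [])" "S 0 = (\<sigma>(4 := N), f w)"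
      by (auto simp: S_def \<sigma>_def fun_eq_iff assms v_def N_def)
    then have "runs w prog (\<lambda>_. 0, []) (\<sigma>(4 := N), f w)
        ((L * 11 + 14) + (g L + (N * ((h ?B * 4 + 4) + 2) + 1)))"
      using runs_input_length[of w] 1 2 unfolding prog_def \<sigma>_def L_def
      by (intro runs_Seq) auto
    moreover have "N * ((h ?B * 4 + 4) + 2) \<le> g L * (h ?B * 4 + 6)"
      using N by (intro mult_mono) auto
    ultimately show ?thesis
      unfolding T_def \<sigma>_def L_def N_def by (elim runs_mono) linarith
  qed
  moreover have "poly_bounded (\<lambda>B. h (B + g B))"
    by (rule poly_bounded_compose[OF h(1)]) (intro poly_bounded_intros g(1))
  then have "poly_bounded T"
    unfolding T_def by (intro poly_bounded_intros g)
  ultimately show ?thesis using poly_time_runs by blast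
qed

section \<open>Definable functions, predicates and words\<close>

text \<open>A notion about meanings instead of syntax, so that definability can be derived along the
  shape of a HOL term. Under a binder, \<open>\<rho> 0\<close> is the bound variable and
  \<open>\<lambda>k. \<rho> (Suc k)\<close> the outer environment, which explains the form of the
  premises below.\<close>

definition definable :: "(bool list \<Rightarrow> (nat \<Rightarrow> nat) \<Rightarrow> nat) \<Rightarrow> bool" where
  "definable f \<longleftrightarrow> (\<exists>e. \<forall>w \<rho>. f w \<rho> = eval w e \<rho>)"

definition definable_pred :: "(bool list \<Rightarrow> (nat \<Rightarrow> nat) \<Rightarrow> bool) \<Rightarrow> bool" where
  "definable_pred P \<longleftrightarrow> definable (\<lambda>w \<rho>. of_bool (P w \<rho>))"

fun rename :: "(nat \<Rightarrow> nat) \<Rightarrow> exp \<Rightarrow> exp" where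
  "rename f (Const n) = Const n"
| "rename f (Var k) = Var (f k)"
| "rename f Len = Len"
| "rename f (Sym e) = Sym (rename f e)"
| "rename f (Add a b) = Add (rename f a) (rename f b)"
| "rename f (Sub a b) = Sub (rename f a) (rename f b)"
| "rename f (Sum n b) = Sum (rename f n) (rename (case_nat 0 (\<lambda>k. Suc (f k))) b)"

lemma eval_rename: "eval w (rename f e) \<rho> = eval w e (\<lambda>k. \<rho> (f k))"
proof (induction e arbitrary: f \<rho>)
  case (Sum n b)
  have "(\<lambda>k. case_nat i \<rho> (case_nat 0 (\<lambda>k. Suc (f k)) k)) = case_nat i (\<lambda>k. \<rho> (f k))" for i
    by (auto simp: fun_eq_iff split: nat.split)
  then show ?case by (simp add: Sum)
qed auto

lemma definable_rename: "definable f \<Longrightarrow> definable (\<lambda>w \<rho>. f w (\<lambda>k. \<rho> (g k)))"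
  unfolding definable_def by (metis eval_rename)

lemma definable_const: "definable (\<lambda>w \<rho>. n)"
  unfolding definable_def by (rule exI[of _ "Const n"]) simp

lemma definable_var: "definable (\<lambda>w \<rho>. \<rho> k)"
  unfolding definable_def by (rule exI[of _ "Var k"]) simp

lemma definable_length: "definable (\<lambda>w \<rho>. length w)"
  unfolding definable_def by (rule exI[of _ Len]) simp

lemma definable_symbol: "definable f \<Longrightarrow> definable (\<lambda>w \<rho>. word_cells w (int (f w \<rho>)))"
  unfolding definable_def by (metis eval.simps(4))

lemma definable_add: "definable f \<Longrightarrow> definable g \<Longrightarrow> definable (\<lambda>w \<rho>. f w \<rho> + g w \<rho>)"
  unfolding definable_def by (metis eval.simps(5))

lemma definable_diff: "definable f \<Longrightarrow> definable g \<Longrightarrow> definable (\<lambda>w \<rho>. f w \<rho> - g w \<rho>)"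
  unfolding definable_def by (metis eval.simps(6))

lemma definable_sum:
  assumes "definable f" "definable (\<lambda>w \<rho>. g w (\<lambda>k. \<rho> (Suc k)) (\<rho> 0))"
  shows "definable (\<lambda>w \<rho>. \<Sum>i<f w \<rho>. g w \<rho> i)"
proof -
  from assms obtain n b where "\<And>w \<rho>. f w \<rho> = eval w n \<rho>"
    and b: "\<And>w \<rho>. g w (\<lambda>k. \<rho> (Suc k)) (\<rho> 0) = eval w b \<rho>"
    unfolding definable_def by blast
  moreover have "g w \<rho> i = eval w b (case_nat i \<rho>)" for w \<rho> i
    using b[of w "case_nat i \<rho>"] by simp
  ultimately show ?thesis
    unfolding definable_def by (intro exI[of _ "Sum n b"]) simp
qed

lemma definable_mult:
  assumes "definable f" "definable g"
  shows "definable (\<lambda>w \<rho>. f w \<rho> * g w \<rho>)"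
proof -
  have "definable (\<lambda>w \<rho>. \<Sum>i<f w \<rho>. g w \<rho>)"
    by (intro definable_sum assms definable_rename[OF assms(2)])
  then show ?thesis by simp
qed

lemma definable_Suc: "definable f \<Longrightarrow> definable (\<lambda>w \<rho>. Suc (f w \<rho>))"
  using definable_add[OF _ definable_const[of 1], of f] by simp

lemma definable_pred_rename: "definable_pred P \<Longrightarrow> definable_pred (\<lambda>w \<rho>. P w (\<lambda>k. \<rho> (g k)))"
  unfolding definable_pred_def by (rule definable_rename)

lemma definable_pred_le:
  assumes "definable f" "definable g"
  shows "definable_pred (\<lambda>w \<rho>. f w \<rho> \<le> g w \<rho>)"
proof -
  have "definable (\<lambda>w \<rho>. 1 - (f w \<rho> - g w \<rho>))"
    by (intro definable_diff definable_const assms)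
  moreover have "1 - (a - b) = of_bool (a \<le> b)" for a b :: nat by auto
  ultimately show ?thesis unfolding definable_pred_def by simp
qed

lemma definable_pred_conj:
  assumes "definable_pred P" "definable_pred Q"
  shows "definable_pred (\<lambda>w \<rho>. P w \<rho> \<and> Q w \<rho>)"
  using definable_mult[OF assms[unfolded definable_pred_def]]
  unfolding definable_pred_def by (simp add: of_bool_conj)

lemma definable_pred_not:
  assumes "definable_pred P"
  shows "definable_pred (\<lambda>w \<rho>. \<not> P w \<rho>)"
proof -
  have "definable (\<lambda>w \<rho>. 1 - of_bool (P w \<rho>))"
    using assms unfolding definable_pred_def by (intro definable_diff definable_const)
  moreover have "(\<lambda>w \<rho>. 1 - of_bool (P w \<rho>)) = (\<lambda>w \<rho>. of_bool (\<not> P w \<rho>) :: nat)"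
    by (auto simp: fun_eq_iff)
  ultimately show ?thesis unfolding definable_pred_def by (simp only:)
qed

lemma definable_pred_const: "definable_pred (\<lambda>w \<rho>. b)"
  unfolding definable_pred_def by (rule definable_const)

lemma definable_pred_disj:
  assumes "definable_pred P" "definable_pred Q"
  shows "definable_pred (\<lambda>w \<rho>. P w \<rho> \<or> Q w \<rho>)"
proof -
  have "definable_pred (\<lambda>w \<rho>. \<not> (\<not> P w \<rho> \<and> \<not> Q w \<rho>))"
    by (intro definable_pred_not definable_pred_conj assms)
  then show ?thesis by simp
qed

lemma definable_pred_imp:
  assumes "definable_pred P" "definable_pred Q"
  shows "definable_pred (\<lambda>w \<rho>. P w \<rho> \<longrightarrow> Q w \<rho>)"
  unfolding imp_conv_disj by (intro definable_pred_disj definable_pred_not assms)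

lemma definable_pred_iff:
  assumes "definable_pred P" "definable_pred Q"
  shows "definable_pred (\<lambda>w \<rho>. P w \<rho> \<longleftrightarrow> Q w \<rho>)"
  unfolding iff_conv_conj_imp by (intro definable_pred_conj definable_pred_imp assms)

lemma definable_pred_less:
  assumes "definable f" "definable g"
  shows "definable_pred (\<lambda>w \<rho>. f w \<rho> < g w \<rho>)"
  unfolding not_le[symmetric] by (intro definable_pred_not definable_pred_le assms)

lemma definable_pred_eq:
  assumes "definable f" "definable g"
  shows "definable_pred (\<lambda>w \<rho>. f w \<rho> = g w \<rho>)"
  unfolding order.eq_iff by (intro definable_pred_conj definable_pred_le assms)

lemma definable_pred_ex:
  assumes "definable f" "definable_pred (\<lambda>w \<rho>. P w (\<lambda>k. \<rho> (Suc k)) (\<rho> 0))"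
  shows "definable_pred (\<lambda>w \<rho>. \<exists>i<f w \<rho>. P w \<rho> i)"
proof -
  note P = assms(2)[unfolded definable_pred_def]
  have "definable_pred (\<lambda>w \<rho>. 0 < (\<Sum>i<f w \<rho>. of_bool (P w \<rho> i) :: nat))"
    by (intro P definable_pred_less definable_const definable_sum assms(1))
  moreover have "0 < (\<Sum>i<n. of_bool (Q i) :: nat) \<longleftrightarrow> (\<exists>i<n. Q i)" for n :: nat and Q
    by (auto simp: zero_less_iff_neq_zero)
  ultimately show ?thesis by (simp only:)
qed

lemma definable_pred_all:
  assumes "definable f" "definable_pred (\<lambda>w \<rho>. P w (\<lambda>k. \<rho> (Suc k)) (\<rho> 0))"
  shows "definable_pred (\<lambda>w \<rho>. \<forall>i<f w \<rho>. P w \<rho> i)"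
proof -
  have "definable_pred (\<lambda>w \<rho>. \<not> (\<exists>i<f w \<rho>. \<not> P w \<rho> i))"
    by (intro definable_pred_not definable_pred_ex assms)
  then show ?thesis by simp
qed

lemma definable_if:
  assumes "definable_pred P" "definable f" "definable g"
  shows "definable (\<lambda>w \<rho>. if P w \<rho> then f w \<rho> else g w \<rho>)"
proof -
  have "definable (\<lambda>w \<rho>. of_bool (P w \<rho>) * f w \<rho> + of_bool (\<not> P w \<rho>) * g w \<rho>)"
    using assms definable_pred_not[OF assms(1)] unfolding definable_pred_def
    by (intro definable_add definable_mult)
  moreover have "(\<lambda>w \<rho>. of_bool (P w \<rho>) * f w \<rho> + of_bool (\<not> P w \<rho>) * g w \<rho>) =
      (\<lambda>w \<rho>. if P w \<rho> then f w \<rho> else g w \<rho>)"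
    by (auto simp: fun_eq_iff)
  ultimately show ?thesis by (simp only:)
qed

lemma definable_pred_if:
  assumes "definable_pred P" "definable_pred Q" "definable_pred R"
  shows "definable_pred (\<lambda>w \<rho>. if P w \<rho> then Q w \<rho> else R w \<rho>)"
  unfolding if_bool_eq_conj
  by (intro definable_pred_conj definable_pred_imp definable_pred_not assms)

lemma definable_div:
  assumes "definable f" "definable g"
  shows "definable (\<lambda>w \<rho>. f w \<rho> div g w \<rho>)"
proof -
  \<comment> \<open>The quotient is the number of positive multiples of \<open>b\<close> up to
    \<open>a\<close>. The guard \<open>0 < b\<close> yields the HOL value 0 for division by
    0.\<close>
  have "(\<Sum>i<a. of_bool (0 < b \<and> Suc i * b \<le> a)) = a div b" for a b :: nat
  proof (cases "b = 0")
    case False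
    have "(\<Sum>i<a. of_bool (0 < b \<and> Suc i * b \<le> a)) = card {i \<in> {..<a}. Suc i \<le> a div b}"
      using False by (simp add: less_eq_div_iff_mult_less_eq Collect_conj_eq lessThan_def del: mult_Suc)
    also have "{i \<in> {..<a}. Suc i \<le> a div b} = {..<a div b}"
      using div_le_dividend[of a b] by (auto simp: less_eq_Suc_le simp del: div_le_dividend)
    finally show ?thesis by simp
  qed simp
  moreover have "definable_pred (\<lambda>w \<rho>. 0 < g w (\<lambda>k. \<rho> (Suc k)) \<and>
      Suc (\<rho> 0) * g w (\<lambda>k. \<rho> (Suc k)) \<le> f w (\<lambda>k. \<rho> (Suc k)))"
    by (intro definable_pred_conj definable_pred_less definable_pred_le definable_mult definable_Suc
        definable_const definable_var assms[THEN definable_rename])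
  then have "definable (\<lambda>w \<rho>. \<Sum>i<f w \<rho>. of_bool (0 < g w \<rho> \<and> Suc i * g w \<rho> \<le> f w \<rho>))"
    unfolding definable_pred_def by (intro definable_sum assms(1))
  ultimately show ?thesis by simp
qed

lemma definable_mod:
  assumes "definable f" "definable g"
  shows "definable (\<lambda>w \<rho>. f w \<rho> mod g w \<rho>)"
proof -
  have "definable (\<lambda>w \<rho>. f w \<rho> - f w \<rho> div g w \<rho> * g w \<rho>)"
    by (intro definable_diff definable_mult definable_div assms)
  then show ?thesis by (simp add: minus_div_mult_eq_mod)
qed

text \<open>A total form of list access: the built-in range check lets letters of concatenations be
  described by disjunctions over the blocks.\<close>

definition letter :: "bool list \<Rightarrow> nat \<Rightarrow> bool" where
  "letter w i \<longleftrightarrow> i < length w \<and> w ! i"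

lemma definable_pred_letter:
  assumes "definable f"
  shows "definable_pred (\<lambda>w \<rho>. letter w (f w \<rho>))"
proof -
  have "definable_pred (\<lambda>w \<rho>. word_cells w (int (f w \<rho>)) = 2)"
    by (intro definable_pred_eq definable_symbol definable_const assms)
  moreover have "word_cells w (int i) = 2 \<longleftrightarrow> letter w i" for w i
    by (auto simp: word_cells_def bit_symbol_def letter_def)
  ultimately show ?thesis by simp
qed

lemma definable_pred_ex_finite:
  assumes "finite A" "\<And>x. x \<in> A \<Longrightarrow> definable_pred (P x)"
  shows "definable_pred (\<lambda>w \<rho>. \<exists>x\<in>A. P x w \<rho>)"
  using assms by (induction A) (auto intro: definable_pred_const definable_pred_disj)

lemma definable_table:
  assumes "definable f" "\<And>n. n < K \<Longrightarrow> definable (g n)"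
  shows "definable (\<lambda>w \<rho>. if f w \<rho> < K then g (f w \<rho>) w \<rho> else 0)"
  using assms
proof (induction K)
  case (Suc K)
  have "definable (\<lambda>w \<rho>. if f w \<rho> = K then g K w \<rho> else if f w \<rho> < K then g (f w \<rho>) w \<rho> else 0)"
    by (intro definable_if definable_pred_eq definable_const Suc) auto
  moreover have "(if a = K then g K w \<rho> else if a < K then g a w \<rho> else 0) =
      (if a < Suc K then g a w \<rho> else 0)" for a w \<rho> by auto
  ultimately show ?case by simp
qed (simp add: definable_const)

lemma definable_poly: "definable f \<Longrightarrow> definable (\<lambda>w \<rho>. poly p (f w \<rho>))"
  by (induction p) (auto intro: definable_const definable_add definable_mult)

lemmas definable_intros = definable_const definable_var definable_length definable_add
  definable_diff definable_mult definable_Suc definable_sum definable_if definable_div definable_mod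
  definable_poly
  definable_pred_const definable_pred_le definable_pred_less definable_pred_eq definable_pred_conj
  definable_pred_disj definable_pred_not definable_pred_imp definable_pred_iff definable_pred_ex
  definable_pred_all definable_pred_if definable_pred_letter

subsection \<open>Words\<close>

text \<open>In the second condition the position is variable 0; these are the two ingredients from
  which \<open>poly_time_expressions\<close> prints a word.\<close>

definition definable_word :: "(bool list \<Rightarrow> (nat \<Rightarrow> nat) \<Rightarrow> bool list) \<Rightarrow> bool" where
  "definable_word f \<longleftrightarrow> definable (\<lambda>w \<rho>. length (f w \<rho>)) \<and>
     definable_pred (\<lambda>w \<rho>. letter (f w (\<lambda>k. \<rho> (Suc k))) (\<rho> 0))"

lemma definable_word_length: "definable_word f \<Longrightarrow> definable (\<lambda>w \<rho>. length (f w \<rho>))"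
  unfolding definable_word_def by blast

text \<open>Substitution by arithmetic: in a sum over all \<open>i\<close> up to the value of
  \<open>g\<close>, only the term with \<open>i\<close> equal to that value survives, and the binder
  supplies it as variable 0.\<close>

lemma definable_subst:
  assumes "definable f" "definable g"
  shows "definable (\<lambda>w \<rho>. f w (case_nat (g w \<rho>) \<rho>))"
proof -
  have case_eta: "case_nat (\<rho> 0) (\<lambda>k. \<rho> (Suc k)) = \<rho>" for \<rho> :: "nat \<Rightarrow> nat"
    by (auto simp: fun_eq_iff split: nat.split)
  have "definable (\<lambda>w \<rho>. \<Sum>i<Suc (g w \<rho>). if i = g w \<rho> then f w (case_nat i \<rho>) else 0)"
    by (intro definable_intros assms definable_rename[OF assms(2)]) (simp add: case_eta assms)
  then show ?thesis by simp
qed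

lemma definable_word_letter:
  assumes "definable_word f" "definable g"
  shows "definable_pred (\<lambda>w \<rho>. letter (f w \<rho>) (g w \<rho>))"
  using definable_subst[OF conjunct2[OF assms(1)[unfolded definable_word_def definable_pred_def]] assms(2)]
  unfolding definable_pred_def by simp

lemma definable_word_map:
  assumes "definable n" "definable_pred (\<lambda>w \<rho>. P w (\<lambda>k. \<rho> (Suc k)) (\<rho> 0))"
  shows "definable_word (\<lambda>w \<rho>. map (P w \<rho>) [0..<n w \<rho>])"
proof -
  have "definable_pred (\<lambda>w \<rho>. \<rho> 0 < n w (\<lambda>k. \<rho> (Suc k)) \<and> P w (\<lambda>k. \<rho> (Suc k)) (\<rho> 0))"
    by (intro definable_intros assms definable_rename[OF assms(1)])
  moreover have "letter (map P [0..<n]) i \<longleftrightarrow> i < n \<and> P i" for i n and P :: "nat \<Rightarrow> bool"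
    by (auto simp: letter_def)
  ultimately show ?thesis
    using assms(1) unfolding definable_word_def by simp
qed

lemma definable_word_rename:
  assumes "definable_word f"
  shows "definable_word (\<lambda>w \<rho>. f w (\<lambda>k. \<rho> (g k)))"
  unfolding definable_word_def
proof
  show "definable (\<lambda>w \<rho>. length (f w (\<lambda>k. \<rho> (g k))))"
    by (rule definable_rename[OF definable_word_length[OF assms]])
  have "definable_pred (\<lambda>w \<rho>. letter (f w (\<lambda>k. \<rho> (case_nat 0 (\<lambda>k. Suc (g k)) (Suc k)))) (\<rho> (case_nat 0 (\<lambda>k. Suc (g k)) 0)))"
    by (rule definable_pred_rename[of "\<lambda>w \<rho>. letter (f w (\<lambda>k. \<rho> (Suc k))) (\<rho> 0)"])
      (use assms in \<open>simp add: definable_word_def\<close>)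
  then show "definable_pred (\<lambda>w \<rho>. letter (f w (\<lambda>k. \<rho> (Suc (g k)))) (\<rho> 0))"
    by simp
qed

lemma definable_word_append:
  assumes "definable_word f" "definable_word g"
  shows "definable_word (\<lambda>w \<rho>. f w \<rho> @ g w \<rho>)"
proof -
  note len = assms[THEN definable_word_length]
  note ren = assms[THEN definable_word_rename[where g = Suc]]
  have "definable_pred (\<lambda>w \<rho>. letter (f w (\<lambda>k. \<rho> (Suc k))) (\<rho> 0) \<or>
     (length (f w (\<lambda>k. \<rho> (Suc k))) \<le> \<rho> 0 \<and>
      letter (g w (\<lambda>k. \<rho> (Suc k))) (\<rho> 0 - length (f w (\<lambda>k. \<rho> (Suc k))))))"
    by (intro definable_intros definable_word_letter ren len[THEN definable_rename])
  moreover have "letter a i \<or> (length a \<le> i \<and> letter b (i - length a)) \<longleftrightarrow> letter (a @ b) i"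
    for i and a b :: "bool list"
    by (auto simp: nth_append letter_def)
  ultimately show ?thesis
    using definable_add[OF len] unfolding definable_word_def by simp
qed

text \<open>The sum of the lengths of the earlier blocks is the start of block \<open>u\<close>, and
  the range check in \<open>letter\<close> guarantees that the position does not lie beyond the
  block.\<close>

lemma letter_concat_map:
  "letter (concat (map f [0..<n])) i \<longleftrightarrow> (\<exists>u<n. (\<Sum>v<u. length (f v)) \<le> i \<and>
     letter (f u) (i - (\<Sum>v<u. length (f v))))"
proof (induction n)
  case (Suc n)
  have len: "length (concat (map f [0..<n])) = (\<Sum>v<n. length (f v))"
    by (simp add: length_concat comp_def atLeast0LessThan interv_sum_list_conv_sum_set_nat)
  have "letter (concat (map f [0..<Suc n])) i \<longleftrightarrow> letter (concat (map f [0..<n])) i \<or>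
     (length (concat (map f [0..<n])) \<le> i \<and> letter (f n) (i - length (concat (map f [0..<n]))))"
    by (auto simp: nth_append letter_def)
  then show ?case
    unfolding Suc len by (auto simp: less_Suc_eq)
qed (simp add: letter_def)

lemma definable_word_concat_map:
  assumes "definable n" "definable_word (\<lambda>w \<rho>. f w (\<lambda>k. \<rho> (Suc k)) (\<rho> 0))"
  shows "definable_word (\<lambda>w \<rho>. concat (map (f w \<rho>) [0..<n w \<rho>]))"
proof -
  have len: "length (concat (map f [0..<n])) = (\<Sum>v<n. length (f v))" for f :: "nat \<Rightarrow> bool list" and n
    by (simp add: length_concat comp_def atLeast0LessThan interv_sum_list_conv_sum_set_nat)
  have f: "definable_word (\<lambda>w \<rho>. f w (\<lambda>k. \<rho> (g k)) (\<rho> j))" for g :: "nat \<Rightarrow> nat" and j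
    using definable_word_rename[OF assms(2), of "case_nat j g"] by simp
  have "definable_pred (\<lambda>w \<rho>. \<exists>u<n w (\<lambda>k. \<rho> (Suc k)).
      (\<Sum>v<u. length (f w (\<lambda>k. \<rho> (Suc k)) v)) \<le> \<rho> 0 \<and>
      letter (f w (\<lambda>k. \<rho> (Suc k)) u) (\<rho> 0 - (\<Sum>v<u. length (f w (\<lambda>k. \<rho> (Suc k)) v))))"
    by (intro definable_intros definable_word_letter definable_rename[OF assms(1)]
        definable_word_length f)
  moreover have "definable (\<lambda>w \<rho>. \<Sum>v<n w \<rho>. length (f w \<rho> v))"
    by (intro definable_intros definable_word_length f assms(1))
  ultimately show ?thesis
    unfolding definable_word_def len letter_concat_map by simp
qed

lemma definable_word_if:
  assumes "definable_pred P" "definable_word f" "definable_word g"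
  shows "definable_word (\<lambda>w \<rho>. if P w \<rho> then f w \<rho> else g w \<rho>)"
proof -
  note len = assms(2,3)[THEN definable_word_length]
  note ren = assms(2,3)[THEN definable_word_rename[where g = Suc]]
  have "definable_pred (\<lambda>w \<rho>. if P w (\<lambda>k. \<rho> (Suc k))
     then letter (f w (\<lambda>k. \<rho> (Suc k))) (\<rho> 0) else letter (g w (\<lambda>k. \<rho> (Suc k))) (\<rho> 0))"
    by (intro definable_pred_if definable_word_letter ren definable_var definable_pred_rename[OF assms(1)])
  moreover have "definable (\<lambda>w \<rho>. if P w \<rho> then length (f w \<rho>) else length (g w \<rho>))"
    by (intro definable_if assms(1) len)
  ultimately show ?thesis
    unfolding definable_word_def if_distrib[of length] if_distrib[of letter] if_distribR by blast
qed

lemma definable_word_single: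
  assumes "definable_pred P"
  shows "definable_word (\<lambda>w \<rho>. [P w \<rho>])"
  using definable_word_map[OF definable_const[of 1], of "\<lambda>w \<rho> i. P w \<rho>"]
    definable_pred_rename[OF assms] by simp

lemma definable_word_const: "definable_word (\<lambda>w \<rho>. xs)"
proof (induction xs)
  case Nil
  then show ?case
    using definable_word_map[OF definable_const[of 0], of "\<lambda>w \<rho> i. False"] definable_pred_const by simp
next
  case (Cons x xs)
  show ?case
    using definable_word_append[OF definable_word_single[OF definable_pred_const] Cons, of x] by simp
qed

lemma definable_word_replicate:
  assumes "definable n"
  shows "definable_word (\<lambda>w \<rho>. replicate (n w \<rho>) b)"
  using definable_word_map[OF assms, of "\<lambda>w \<rho> i. b"] definable_pred_const by (simp add: map_replicate_const)

lemma definable_pred_word_eq: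
  assumes "definable_word f" "definable_word g"
  shows "definable_pred (\<lambda>w \<rho>. f w \<rho> = g w \<rho>)"
proof -
  note len = assms[THEN definable_word_length]
  note ren = assms[THEN definable_word_rename[where g = Suc]]
  have "definable_pred (\<lambda>w \<rho>. length (f w \<rho>) = length (g w \<rho>) \<and>
     (\<forall>i<length (f w \<rho>). letter (f w \<rho>) i \<longleftrightarrow> letter (g w \<rho>) i))"
    by (intro definable_intros definable_word_letter ren len)
  moreover have "length a = length b \<and>
     (\<forall>i<length a. letter a i \<longleftrightarrow> letter b i) \<longleftrightarrow> a = b" for a b
    by (auto simp: list_eq_iff_nth_eq letter_def)
  ultimately show ?thesis by simp
qed

lemmas definable_word_intros = definable_word_map definable_word_append definable_word_concat_map
  definable_word_if definable_word_single definable_word_const definable_word_replicate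

theorem poly_time_definable:
  assumes "definable_word (\<lambda>w \<rho>. f w)"
  shows "poly_time f"
proof -
  obtain n where n: "\<And>w \<rho>. length (f w) = eval w n \<rho>"
    using assms unfolding definable_word_def definable_def by blast
  obtain b where b: "\<And>w \<rho>. of_bool (letter (f w) (\<rho> 0)) = eval w b \<rho>"
    using assms unfolding definable_word_def definable_pred_def definable_def by blast
  have "f w = map (\<lambda>i. eval w b (case_nat i (\<lambda>_. 0)) \<noteq> 0) [0..<eval w n (\<lambda>_. 0)]" for w
    by (rule nth_equalityI) (simp_all add: n[symmetric] b[symmetric] letter_def)
  then show ?thesis by (rule poly_time_expressions)
qed

corollary class_P_definable:
  assumes "definable_pred (\<lambda>w \<rho>. w \<in> A)"
  shows "A \<in> class_P"
  unfolding class_P_def using poly_time_definable[OF definable_word_single[OF assms]] by simp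

subsection \<open>Encodings of list colouring instances\<close>

lemma definable_word_encode_unary:
  "definable f \<Longrightarrow> definable_word (\<lambda>w \<rho>. encode_unary (f w \<rho>))"
  unfolding encode_unary_def by (intro definable_word_intros)

text \<open>Sorting has no arithmetic expression. With a bound \<open>K\<close> on the colours, they
  can be enumerated in increasing order instead, where a missing colour contributes the empty
  word.\<close>

lemma encode_list_bounded:
  assumes "S \<subseteq> {..K}"
  shows "encode_list S =
    concat (map (\<lambda>c. if c \<in> S then encode_unary c else []) [0..<Suc K]) @ [False]"
proof -
  have "sorted_list_of_set S = filter (\<lambda>c. c \<in> S) [0..<Suc K]"
    by (rule sorted_distinct_set_unique)
      (use assms finite_subset[OF assms] in \<open>auto simp: sorted_wrt_filter less_Suc_eq_le simp del: upt_Suc\<close>)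
  moreover have "concat (map f (filter P xs)) = concat (map (\<lambda>c. if P c then f c else []) xs)"
    for f :: "nat \<Rightarrow> bool list" and P xs by (induction xs) auto
  ultimately show ?thesis unfolding encode_list_def by simp
qed

lemma definable_word_encode_list:
  assumes "\<And>w \<rho>. S w \<rho> \<subseteq> {..K w \<rho>}" "definable K" "definable_pred (\<lambda>w \<rho>. \<rho> 0 \<in> S w (\<lambda>k. \<rho> (Suc k)))"
  shows "definable_word (\<lambda>w \<rho>. encode_list (S w \<rho>))"
proof -
  have "definable_word (\<lambda>w \<rho>. concat (map (\<lambda>c. if c \<in> S w \<rho> then encode_unary c else []) [0..<Suc (K w \<rho>)]) @ [False])"
    by (intro definable_word_intros definable_word_encode_unary definable_intros assms)
  then show ?thesis by (simp only: encode_list_bounded[OF assms(1)])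
qed

lemma definable_word_encode_instance:
  assumes "definable n"
    and "definable_pred (\<lambda>w \<rho>. {\<rho> 1, \<rho> 0} \<in> E w (\<lambda>k. \<rho> (Suc (Suc k))))"
    and "\<And>w \<rho> u. L w \<rho> u \<subseteq> {..K w \<rho>}" "definable K"
    and "definable_pred (\<lambda>w \<rho>. \<rho> 0 \<in> L w (\<lambda>k. \<rho> (Suc (Suc k))) (\<rho> 1))"
  shows "definable_word (\<lambda>w \<rho>. encode_instance (n w \<rho>) (E w \<rho>) (L w \<rho>))"
  unfolding encode_instance_def
  by (intro definable_word_intros definable_word_encode_unary definable_word_encode_list[where K = "\<lambda>w \<rho>. K w (\<lambda>k. \<rho> (Suc k))"]
      assms definable_rename[OF assms(1)] definable_rename[OF assms(4)] assms(2,5)[unfolded One_nat_def])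

section \<open>Membership in NP\<close>

lemma letter_append: "letter (a @ b) i \<longleftrightarrow> (if i < length a then letter a i else letter b (i - length a))"
  by (auto simp: letter_def nth_append)

lemma letter_Cons: "letter (a # b) i \<longleftrightarrow> (case i of 0 \<Rightarrow> a | Suc j \<Rightarrow> letter b j)"
  by (cases i) (auto simp: letter_def)

lemma letter_map: "letter (map P [0..<n]) i \<longleftrightarrow> i < n \<and> P i"
  by (auto simp: letter_def)

lemma length_doubled [simp]: "length (concat (map (\<lambda>b. [b, b]) x)) = 2 * length x"
  by (induction x) auto

lemma letter_doubled: "letter (concat (map (\<lambda>b. [b, b]) x)) i \<longleftrightarrow> letter x (i div 2)"
proof (induction x arbitrary: i)
  case (Cons b x)
  show ?case
  proof (cases "i < 2")
    case True
    then show ?thesis by (auto simp: letter_Cons less_2_cases_iff)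
  next
    case False
    then obtain j where "i = Suc (Suc j)" by (metis less_2_cases_iff not0_implies_Suc One_nat_def)
    then show ?thesis using Cons[of j] by (simp add: letter_Cons)
  qed
qed (simp add: letter_def)

lemma letter_word_pair:
  "letter (word_pair x y) i \<longleftrightarrow>
     (if i < 2 * length x then letter x (i div 2) else i = 2 * length x + 1 \<or>
       (2 * length x + 2 \<le> i \<and> letter y (i - (2 * length x + 2))))"
proof -
  have "letter ([False, True] @ y) k \<longleftrightarrow> k = 1 \<or> (2 \<le> k \<and> letter y (k - 2))" for k
    by (auto simp: letter_Cons split: nat.split)
  from this[of "i - 2 * length x"] show ?thesis
    unfolding word_pair_def letter_append[of "concat (map (\<lambda>b. [b, b]) x)"] letter_doubled length_doubled
    by auto
qed

lemma length_word_pair: "length (word_pair x y) = 2 * length x + 2 + length y"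
  by (simp add: word_pair_def)

lemma letter_row:
  assumes "u < n" "v < n" "\<And>u. length (f u) = n"
  shows "letter (concat (map f [0..<n])) (u * n + v) \<longleftrightarrow> letter (f u) v"
proof -
  have "u' = u" if "u' * n \<le> u * n + v" "letter (f u') (u * n + v - u' * n)" for u'
  proof -
    have "u * n + v - u' * n < n" using that(2) assms(3)[of u'] by (auto simp: letter_def)
    then have "u * n + v < Suc u' * n" using that(1) by simp
    then have "u < Suc u'" by (metis add_lessD1 mult_less_cancel2)
    moreover have "u' * n < Suc u * n" using that(1) assms(2) by simp
    then have "u' < Suc u" by (metis mult_less_cancel2)
    ultimately show ?thesis by simp
  qed
  then have "(u' * n \<le> u * n + v \<and> letter (f u') (u * n + v - u' * n)) \<longleftrightarrow> u' = u \<and> letter (f u) v" for u'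
    by fastforce
  then show ?thesis
    unfolding letter_concat_map using assms by simp
qed

lemma letter_encode_instance:
  assumes "u < n" "v < n"
  shows "letter (encode_instance n E L) (n + 1 + (u * n + v)) \<longleftrightarrow> {u, v} \<in> E"
proof -
  let ?rows = "concat (map (\<lambda>u. map (\<lambda>v. {u, v} \<in> E) [0..<n]) [0..<n])"
  have "letter (encode_instance n E L) (n + 1 + (u * n + v)) \<longleftrightarrow>
      letter (?rows @ concat (map (\<lambda>u. encode_list (L u)) [0..<n])) (u * n + v)"
    unfolding encode_instance_def letter_append[of "encode_unary n"] by (simp add: encode_unary_def)
  also have "\<dots> \<longleftrightarrow> letter ?rows (u * n + v)"
  proof -
    have "u * n + v < Suc u * n" using assms by simp
    also have "\<dots> \<le> n * n" using assms by (intro mult_le_mono) auto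
    finally show ?thesis
      by (simp add: letter_append length_concat comp_def sum_list_triv)
  qed
  also have "\<dots> \<longleftrightarrow> {u, v} \<in> E"
    using assms by (subst letter_row) (auto simp: letter_map)
  finally show ?thesis .
qed

text \<open>This is where the unary coding matters: it keeps the bit tables of the certificate
  polynomial in the input length.\<close>

lemma length_encode_instance_ge:
  shows "n < length (encode_instance n E L)"
    and "u < n \<Longrightarrow> finite (L u) \<Longrightarrow> c \<in> L u \<Longrightarrow> c \<le> length (encode_instance n E L)"
proof -
  show "n < length (encode_instance n E L)" by (simp add: encode_instance_def encode_unary_def)
  assume u: "u < n" "finite (L u)" "c \<in> L u"
  have le: "length x \<le> length (concat xs)" if "x \<in> set xs" for x :: "bool list" and xs
    using that by (induction xs) auto
  have "c \<le> length (encode_unary c)" by (simp add: encode_unary_def)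
  also have "\<dots> \<le> length (encode_list (L u))"
  proof -
    have "encode_unary c \<in> set (map encode_unary (sorted_list_of_set (L u)))" using u by simp
    from le[OF this] show ?thesis by (simp add: encode_list_def)
  qed
  also have "\<dots> \<le> length (concat (map (\<lambda>u. encode_list (L u)) [0..<n]))"
    using u by (intro le) auto
  finally show "c \<le> length (encode_instance n E L)" by (simp add: encode_instance_def)
qed

text \<open>In the following, \<open>w\<close> is a pair of an instance of length \<open>m\<close> with \<open>n\<close> vertices and a
  certificate, which consists of two bit tables with \<open>n\<close> rows of length \<open>m + 1\<close> each: the lists,
  and a marked colour for each vertex.\<close>

definition input_edges :: "bool list \<Rightarrow> nat \<Rightarrow> nat set set" where
  "input_edges w n = {{u, v} | u v. u < n \<and> v < n \<and> u \<noteq> v \<and> letter w (2 * (n + 1 + (u * n + v)))}"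

definition cert_list :: "bool list \<Rightarrow> nat \<Rightarrow> nat \<Rightarrow> nat set" where
  "cert_list w m u = {c. 1 \<le> c \<and> c \<le> m \<and> letter w (2 * m + 2 + (u * (m + 1) + c))}"

definition cert_colour :: "bool list \<Rightarrow> nat \<Rightarrow> nat \<Rightarrow> nat \<Rightarrow> nat \<Rightarrow> bool" where
  "cert_colour w m n u c \<longleftrightarrow> c \<in> cert_list w m u \<and> letter w (2 * m + 2 + ((n + u) * (m + 1) + c))"

text \<open>The lists are not parsed. The instance is encoded anew from the guessed lists and
  compared with the input, which also rejects malformed inputs. A vertex may have several marked
  colours; since adjacent vertices share none, any choice among them gives a colouring.\<close>

definition certified :: "bool list \<Rightarrow> nat \<Rightarrow> nat \<Rightarrow> bool" where
  "certified w m n \<longleftrightarrow>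
     map (\<lambda>j. letter w (2 * j)) [0..<m] = encode_instance n (input_edges w n) (cert_list w m) \<and>
     (\<forall>u<n. (\<Sum>c<m + 1. of_bool (c \<in> cert_list w m u)) \<le> (3 :: nat)) \<and>
     (\<forall>u<n. \<exists>c<m + 1. cert_colour w m n u c) \<and>
     (\<forall>u<n. \<forall>v<n. {u, v} \<in> input_edges w n \<longrightarrow>
        (\<forall>c<m + 1. \<not> (cert_colour w m n u c \<and> cert_colour w m n v c)))"

text \<open>The separator is the first pair of unequal letters that starts at an even position, so
  \<open>m\<close> is determined by the word.\<close>

definition certificate_language :: language where
  "certificate_language = {w. \<exists>m<length w. 2 * m + 1 < length w \<and>
     (\<forall>j<m. letter w (2 * j) \<longleftrightarrow> letter w (2 * j + 1)) \<and>
     \<not> letter w (2 * m) \<and> letter w (2 * m + 1) \<and> (\<exists>n<m + 1. certified w m n)}"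

lemma input_edges_iff:
  "{u, v} \<in> input_edges w n \<longleftrightarrow> u < n \<and> v < n \<and> u \<noteq> v \<and>
     (letter w (2 * (n + 1 + (u * n + v))) \<or> letter w (2 * (n + 1 + (v * n + u))))"
  by (auto simp: input_edges_def doubleton_eq_iff)

lemma cert_list_iff:
  "c \<in> cert_list w m u \<longleftrightarrow> 1 \<le> c \<and> c \<le> m \<and> letter w (2 * m + 2 + (u * (m + 1) + c))"
  by (simp add: cert_list_def)

lemma cert_list_bounded: "cert_list w m u \<subseteq> {..m}"
  by (auto simp: cert_list_def)

lemma certificate_language_P: "certificate_language \<in> class_P"
proof (rule class_P_definable)
  have L: "definable_pred (\<lambda>w \<rho>. c w \<rho> \<in> cert_list w (m w \<rho>) (u w \<rho>))"
    if "definable c" "definable m" "definable u" for c m u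
    unfolding cert_list_iff by (intro definable_intros that)
  have E: "definable_pred (\<lambda>w \<rho>. {u w \<rho>, v w \<rho>} \<in> input_edges w (n w \<rho>))"
    if "definable u" "definable v" "definable n" for u v n
    unfolding input_edges_iff by (intro definable_intros that)
  have C: "definable_pred (\<lambda>w \<rho>. cert_colour w (m w \<rho>) (n w \<rho>) (u w \<rho>) (c w \<rho>))"
    if "definable c" "definable m" "definable u" "definable n" for c m u n
    unfolding cert_colour_def by (intro definable_intros L that)
  have "definable_pred (\<lambda>w \<rho>. certified w (\<rho> 1) (\<rho> 0))"
    unfolding certified_def
    by (intro definable_intros definable_pred_word_eq definable_word_map
        definable_word_encode_instance[where K = "\<lambda>w \<rho>. \<rho> 1"] cert_list_bounded
        L[unfolded definable_pred_def] L E C)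
  from definable_pred_rename[OF this, of id]
  show "definable_pred (\<lambda>w \<rho>. w \<in> certificate_language)"
    unfolding certificate_language_def mem_Collect_eq
    by (intro definable_intros) simp
qed

lemma certificate_language_word_pair:
  "word_pair x y \<in> certificate_language \<longleftrightarrow>
     (\<exists>n<length x + 1. certified (word_pair x y) (length x) n)"
proof -
  let ?w = "word_pair x y"
  let ?split = "\<lambda>m. m < length ?w \<and> 2 * m + 1 < length ?w \<and>
     (\<forall>j<m. letter ?w (2 * j) \<longleftrightarrow> letter ?w (2 * j + 1)) \<and> \<not> letter ?w (2 * m) \<and> letter ?w (2 * m + 1)"
  have "m = length x" if "?split m" for m
  proof -
    have "letter ?w (2 * m) \<longleftrightarrow> letter ?w (2 * m + 1)" if "m < length x"
      using that by (simp add: letter_word_pair)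
    moreover have "\<not> letter ?w (2 * length x)" "letter ?w (2 * length x + 1)"
      by (simp_all add: letter_word_pair)
    ultimately show ?thesis using that by (meson linorder_neqE_nat)
  qed
  moreover have "?split (length x)"
    by (simp add: letter_word_pair length_word_pair)
  ultimately show ?thesis
    unfolding certificate_language_def by blast
qed

lemma map_letters: "map (\<lambda>j. letter (word_pair x y) (2 * j)) [0..<length x] = x"
  by (rule nth_equalityI) (simp_all add: letter_word_pair, simp add: letter_def)

lemma certified_sound:
  assumes "certified (word_pair x y) (length x) n"
  shows "x \<in> three_list_colouring"
proof -
  let ?w = "word_pair x y"
  let ?E = "input_edges ?w n" and ?L = "cert_list ?w (length x)"
  have "map (\<lambda>j. letter ?w (2 * j)) [0..<length x] = x"
    by (rule map_letters)
  then have x: "x = encode_instance n ?E ?L" using assms by (simp add: certified_def)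
  have fin: "finite (?L u)" for u
    using cert_list_bounded by (rule finite_subset) simp
  have "card (?L u) \<le> 3" if "u < n" for u
  proof -
    have "{..<length x + 1} \<inter> {c. c \<in> ?L u} = ?L u"
      using cert_list_bounded[of ?w "length x" u] by auto
    then have "card (?L u) = (\<Sum>c<length x + 1. of_bool (c \<in> ?L u))"
      by (simp only: sum_of_bool_eq finite_lessThan of_nat_id)
    then show ?thesis using assms that unfolding certified_def by metis
  qed
  moreover have "simple_graph {..<n} ?E"
    by (auto simp: simple_graph_def input_edges_def card_insert_if)
  ultimately have inst: "list_colouring_instance 3 n ?E ?L"
    using fin by (auto simp: list_colouring_instance_def cert_list_def)
  have "\<forall>u<n. \<exists>c. cert_colour ?w (length x) n u c"
    using assms by (auto simp: certified_def)
  then obtain c where c: "\<And>u. u < n \<Longrightarrow> cert_colour ?w (length x) n u (c u)"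
    by metis
  have "c u \<noteq> c v" if "{u, v} \<in> ?E" for u v
  proof -
    have "u < n" "v < n" using that by (auto simp: input_edges_iff)
    moreover have "c u < length x + 1"
      using c[OF \<open>u < n\<close>] cert_list_bounded by (fastforce simp: cert_colour_def)
    ultimately show ?thesis using assms that c unfolding certified_def by metis
  qed
  then have "colouring {..<n} ?E c" "respects_lists {..<n} c ?L"
    using c by (auto simp: colouring_def respects_lists_def cert_colour_def cert_list_def)
  then show ?thesis
    using x inst unfolding three_list_colouring_def by blast
qed

lemma certified_complete:
  assumes "x \<in> three_list_colouring"
  shows "\<exists>y n. length y \<le> 2 * length x * (length x + 1) \<and> n < length x + 1 \<and>
    certified (word_pair x y) (length x) n"
proof -
  obtain n E L c where x: "x = encode_instance n E L" and inst: "list_colouring_instance 3 n E L"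
    and c: "colouring {..<n} E c" "respects_lists {..<n} c L"
    using assms by (auto simp: three_list_colouring_def)
  define m where "m = length x"
  have nm: "n < m" unfolding m_def x by (rule length_encode_instance_ge)
  have Lm: "1 \<le> k \<and> k \<le> m" if "u < n" "k \<in> L u" for u k
    unfolding m_def x using inst that length_encode_instance_ge(2)[of u n L k E]
    by (auto simp: list_colouring_instance_def)
  define y where "y = map (\<lambda>j. if j div (m + 1) < n then j mod (m + 1) \<in> L (j div (m + 1))
     else j mod (m + 1) = c (j div (m + 1) - n)) [0..<2 * n * (m + 1)]"
  let ?w = "word_pair x y"
  have idx: "u * (m + 1) + k < 2 * n * (m + 1)" if "u < 2 * n" "k \<le> m" for u k
  proof -
    have "u * (m + 1) + k < Suc u * (m + 1)" using that by simp
    also have "\<dots> \<le> 2 * n * (m + 1)" using that by (intro mult_le_mono) auto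
    finally show ?thesis .
  qed
  have dm: "(u * (m + 1) + k) div (m + 1) = u \<and> (u * (m + 1) + k) mod (m + 1) = k" if "k \<le> m" for u k
  proof -
    have "(u * b + k) div b = u \<and> (u * b + k) mod b = k" if "k < b" for b
      using that by simp
    from this[of "m + 1"] that show ?thesis by linarith
  qed
  have w: "letter ?w (2 * m + 2 + j) \<longleftrightarrow> letter y j" for j
    by (simp add: letter_word_pair m_def)
  have L: "cert_list ?w m u = L u" if "u < n" for u
  proof -
    have "letter y (u * (m + 1) + k) \<longleftrightarrow> k \<in> L u" if "k \<le> m" for k
      unfolding y_def letter_map using \<open>u < n\<close> idx[of u k] dm[OF that, of u] that by simp
    then show ?thesis using Lm[OF that] unfolding cert_list_def w by auto
  qed
  have C: "cert_colour ?w m n u k \<longleftrightarrow> k = c u" if "u < n" for u k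
  proof -
    have "letter y ((n + u) * (m + 1) + k) \<longleftrightarrow> k = c u" if "k \<le> m" for k
      unfolding y_def letter_map using \<open>u < n\<close> idx[of "n + u" k] dm[OF that, of "n + u"] that by simp
    moreover have "c u \<in> L u" using c(2) that by (auto simp: respects_lists_def)
    ultimately show ?thesis
      using Lm[OF that] unfolding cert_colour_def w L[OF that] by auto
  qed
  have E: "input_edges ?w n = E"
  proof -
    have "{u, v} \<in> input_edges ?w n \<longleftrightarrow> {u, v} \<in> E" if "u < n" "v < n" for u v
    proof -
      have lt: "letter ?w (2 * i) \<longleftrightarrow> letter x i" if "letter x i \<or> i < m" for i
        using that unfolding letter_word_pair by (auto simp: letter_def m_def)
      have adj: "letter ?w (2 * (n + 1 + (u * n + v))) \<longleftrightarrow> {u, v} \<in> E" if "u < n" "v < n" for u v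
      proof -
        have "n + 1 + (u * n + v) < m"
        proof -
          have "u * n + v < Suc u * n" using that by simp
          also have "\<dots> \<le> n * n" using that by (intro mult_le_mono) auto
          finally have "u * n + v < n * n" .
          moreover have "n + 1 + n * n \<le> m"
            unfolding m_def x
            by (simp add: encode_instance_def encode_unary_def length_concat comp_def sum_list_triv)
          ultimately show ?thesis by linarith
        qed
        then show ?thesis
          using lt letter_encode_instance[OF that, of E L] unfolding x by blast
      qed
      have "u \<noteq> v" if "{u, v} \<in> E"
        using inst that by (auto simp: list_colouring_instance_def simple_graph_def)
      then show ?thesis
        using adj[OF that] adj[OF that(2,1)] that by (auto simp: input_edges_iff insert_commute)
    qed
    moreover have "simple_graph {..<n} (input_edges ?w n)"
      by (auto simp: simple_graph_def input_edges_def card_insert_if)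
    ultimately show ?thesis
      using inst by (intro simple_graph_edges_eq[of "{..<n}"]) (auto simp: list_colouring_instance_def)
  qed
  have "map (\<lambda>j. letter ?w (2 * j)) [0..<m] = x"
    unfolding m_def by (rule map_letters)
  also have "x = encode_instance n E (cert_list ?w m)"
  proof -
    have "encode_instance n E (cert_list ?w m) = encode_instance n E L"
    proof -
      have "map (\<lambda>u. encode_list (cert_list ?w m u)) [0..<n] = map (\<lambda>u. encode_list (L u)) [0..<n]"
        using L by simp
      then show ?thesis unfolding encode_instance_def by (simp only:)
    qed
    then show ?thesis by (rule trans[OF x sym])
  qed
  finally have "map (\<lambda>j. letter ?w (2 * j)) [0..<m] = encode_instance n (input_edges ?w n) (cert_list ?w m)"
    unfolding E .
  moreover have "(\<Sum>k<m + 1. of_bool (k \<in> cert_list ?w m u)) \<le> (3 :: nat)" if "u < n" for u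
  proof -
    have "{..<m + 1} \<inter> {k. k \<in> L u} = L u" using Lm[OF that] by fastforce
    then have "(\<Sum>k<m + 1. of_bool (k \<in> L u)) = card (L u)"
      by (simp only: sum_of_bool_eq finite_lessThan of_nat_id)
    then show ?thesis
      using inst that L[OF that] by (simp only: list_colouring_instance_def)
  qed
  moreover have "c u < m + 1" if "u < n" for u
    using c(2) Lm that by (fastforce simp: respects_lists_def)
  moreover have "c u \<noteq> c v" if "{u, v} \<in> E" for u v
    using c(1) that by (auto simp: colouring_def)
  ultimately have "certified ?w m n"
    unfolding certified_def E using C by metis
  moreover have "length y \<le> 2 * m * (m + 1)"
    unfolding y_def length_map length_upt diff_zero using nm by (intro mult_le_mono) auto
  moreover have "n < m + 1" using nm by simp
  ultimately show ?thesis unfolding m_def by blast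
qed

theorem three_list_colouring_NP: "three_list_colouring \<in> class_NP"
proof -
  \<comment> \<open>The polynomial is \<open>2 * k * (k + 1)\<close>: two tables with at most
    \<open>k\<close> rows of \<open>k + 1\<close> bits.\<close>
  have "x \<in> three_list_colouring \<longleftrightarrow>
     (\<exists>y. length y \<le> poly [:0, 2, 2:] (length x) \<and> word_pair x y \<in> certificate_language)" for x
  proof -
    have "poly [:0, 2, 2:] k = 2 * k * (k + 1)" for k :: nat by (simp add: algebra_simps)
    then show ?thesis
      unfolding certificate_language_word_pair
      using certified_sound certified_complete by metis
  qed
  then show ?thesis
    unfolding class_NP_def using certificate_language_P by blast
qed

section \<open>Computations as satisfiable clauses\<close>

datatype fact = FState nat | FHead nat | FCell nat nat | FScan nat nat

instance fact :: countable
  by countable_datatype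

text \<open>\<open>IMid\<close> is the cell on which all heads start. \<open>IZero\<close> is a
  dummy for facts that have no place on the tape, such as the state.\<close>

datatype index = IZero | IMid | IFst | ISnd | ISucc | IPred

fun index_val :: "nat \<Rightarrow> nat \<Rightarrow> nat \<Rightarrow> index \<Rightarrow> nat" where
  "index_val \<tau> i i' IZero = 0"
| "index_val \<tau> i i' IMid = \<tau>"
| "index_val \<tau> i i' IFst = i"
| "index_val \<tau> i i' ISnd = i'"
| "index_val \<tau> i i' ISucc = i + 1"
| "index_val \<tau> i i' IPred = i - 1"

text \<open>A literal \<open>(s, f, d, x)\<close> states that the fact \<open>f\<close> has truth value \<open>s\<close> at time \<open>t + d\<close> and at
  the tape index given by \<open>x\<close>; a template is a guarded clause, to be instantiated with all \<open>t\<close>,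
  \<open>i\<close>, \<open>i'\<close>. Tape index \<open>i\<close> stands for cell \<open>i - \<tau>\<close>.\<close>

type_synonym lit = "bool \<times> fact \<times> nat \<times> index"
type_synonym template = "(bool list \<Rightarrow> nat \<Rightarrow> nat \<Rightarrow> nat \<Rightarrow> bool) \<times> lit set"

fun lit_true :: "(fact \<Rightarrow> nat \<Rightarrow> nat \<Rightarrow> bool) \<Rightarrow> nat \<Rightarrow> nat \<Rightarrow> nat \<Rightarrow> nat \<Rightarrow> lit \<Rightarrow> bool" where
  "lit_true \<alpha> \<tau> t i i' (s, f, d, x) \<longleftrightarrow> \<alpha> f (t + d) (index_val \<tau> i i' x) = s"

fun shift_index :: "direction \<Rightarrow> index" where
  "shift_index MoveLeft = IPred"
| "shift_index Stay = IFst"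
| "shift_index MoveRight = ISucc"

definition definable_guard :: "(bool list \<Rightarrow> nat \<Rightarrow> nat \<Rightarrow> nat \<Rightarrow> bool) \<Rightarrow> bool" where
  "definable_guard G \<longleftrightarrow> (\<forall>t i i'. definable t \<longrightarrow> definable i \<longrightarrow> definable i' \<longrightarrow>
     definable_pred (\<lambda>w \<rho>. G w (t w \<rho>) (i w \<rho>) (i' w \<rho>)))"

section \<open>Runs of a polynomial-time verifier\<close>

locale verifier =
  fixes M :: tm and R :: language and q p :: "nat poly"
  assumes tm: "turing_machine M"
    and decides: "\<And>w. \<exists>t\<le>poly q (length w). halts_with M ((tm_step M ^^ t) (init_config M w)) [w \<in> R]"
begin

definition cfg :: "bool list \<Rightarrow> nat \<Rightarrow> config" where
  "cfg w t = (tm_step M ^^ t) (init_config M w)"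

text \<open>The halting state gets an idle action, so the same clauses describe all steps up to one
  fixed time, whenever the machine halts.\<close>

definition next_action :: "nat \<Rightarrow> nat list \<Rightarrow> nat \<times> (nat \<times> direction) list" where
  "next_action s ss = (if s = halt_state M then (s, map (\<lambda>a. (a, Stay)) ss) else transition M s ss)"

lemma tm_step_next_action:
  "tm_step M C = (fst (next_action (fst C) (map scanned (snd C))),
     map2 act (snd (next_action (fst C) (map scanned (snd C)))) (snd C))"
  by (cases C) (simp add: next_action_def map2_act_Stay case_prod_beta del: map_map)

lemma next_action_bounds:
  assumes "s \<le> halt_state M" "length ss = tapes M" "set ss \<subseteq> {..<symbols M}"
  shows "fst (next_action s ss) \<le> halt_state M" "length (snd (next_action s ss)) = tapes M"
    "fst ` set (snd (next_action s ss)) \<subseteq> {..<symbols M}"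
proof -
  have "fst (next_action s ss) \<le> halt_state M \<and> length (snd (next_action s ss)) = tapes M \<and>
    fst ` set (snd (next_action s ss)) \<subseteq> {..<symbols M}"
  proof (cases "s = halt_state M")
    case True
    then show ?thesis using assms by (simp add: next_action_def image_image)
  next
    case False
    then have "s < halt_state M" using assms(1) by simp
    then show ?thesis
      using tm assms(2,3) False unfolding turing_machine_def next_action_def by simp
  qed
  then show "fst (next_action s ss) \<le> halt_state M" "length (snd (next_action s ss)) = tapes M"
    "fst ` set (snd (next_action s ss)) \<subseteq> {..<symbols M}" by blast+
qed

lemma tapes_pos: "0 < tapes M"
  using tm by (simp add: turing_machine_def)

text \<open>In \<open>t\<close> steps a head moves at most \<open>t\<close> cells, so a window of
  fixed size contains all cells visited up to the horizon.\<close>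

definition wf_config :: "nat \<Rightarrow> config \<Rightarrow> bool" where
  "wf_config t C \<longleftrightarrow> fst C \<le> halt_state M \<and> length (snd C) = tapes M \<and>
     (\<forall>j<tapes M. (\<forall>z. fst (snd C ! j) z < symbols M) \<and> \<bar>snd (snd C ! j)\<bar> \<le> int t)"

lemma scanned_fst: "scanned T = fst T (snd T)"
  by (cases T) simp

lemma act_eq: "act (b, d) T = ((fst T)(snd T := b), snd T + shift d)"
  by (cases T) simp

lemma wf_config_scanned:
  assumes "wf_config t C"
  shows "length (map scanned (snd C)) = tapes M" "set (map scanned (snd C)) \<subseteq> {..<symbols M}"
proof -
  show len: "length (map scanned (snd C)) = tapes M"
    using assms by (simp add: wf_config_def)
  show "set (map scanned (snd C)) \<subseteq> {..<symbols M}"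
  proof
    fix a assume "a \<in> set (map scanned (snd C))"
    then obtain T where "T \<in> set (snd C)" and a: "a = scanned T" by (auto simp del: scanned.simps)
    then obtain j where "j < tapes M" "T = snd C ! j"
      using len unfolding in_set_conv_nth by auto
    with a show "a \<in> {..<symbols M}"
      using assms by (simp add: wf_config_def scanned_fst)
  qed
qed

lemma nth_tm_step:
  assumes "wf_config t C" "j < tapes M" "snd (next_action (fst C) (map scanned (snd C))) ! j = (b, d)"
  shows "snd (tm_step M C) ! j = ((fst (snd C ! j))(snd (snd C ! j) := b), snd (snd C ! j) + shift d)"
proof -
  have "fst C \<le> halt_state M" using assms(1) by (simp add: wf_config_def)
  from next_action_bounds(2)[OF this wf_config_scanned[OF assms(1)]] show ?thesis
    using assms by (simp add: tm_step_next_action act_eq wf_config_def del: map_map)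
qed

lemma wf_config_step:
  assumes "wf_config t C"
  shows "wf_config (Suc t) (tm_step M C)"
proof -
  let ?a = "next_action (fst C) (map scanned (snd C))"
  have "fst C \<le> halt_state M" using assms by (simp add: wf_config_def)
  note a = next_action_bounds[OF this wf_config_scanned[OF assms]]
  have "(\<forall>z. fst (snd (tm_step M C) ! j) z < symbols M) \<and> \<bar>snd (snd (tm_step M C) ! j)\<bar> \<le> int (Suc t)"
    if j: "j < tapes M" for j
  proof -
    obtain b d where bd: "snd ?a ! j = (b, d)" by (cases "snd ?a ! j")
    then have "(b, d) \<in> set (snd ?a)" using a(2) j by (metis nth_mem)
    then have "b < symbols M" using a(3) by force
    moreover have "\<bar>shift d\<bar> \<le> 1" by (cases d) auto
    moreover have "\<forall>z. fst (snd C ! j) z < symbols M" "\<bar>snd (snd C ! j)\<bar> \<le> int t"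
      using assms j by (auto simp: wf_config_def)
    ultimately show ?thesis
      unfolding nth_tm_step[OF assms j bd] by simp
  qed
  then show ?thesis
    using a assms unfolding wf_config_def by (simp add: tm_step_next_action del: map_map)
qed

lemma nth_init_config:
  assumes "j < tapes M"
  shows "snd (init_config M w) ! j = (word_cells (if j = 0 then w else []), 0)"
  using assms by (cases j) (auto simp: init_config_def)

lemma wf_cfg: "wf_config t (cfg w t)"
proof (induction t)
  case 0
  have "length (snd (init_config M w)) = tapes M"
    using tapes_pos by (simp add: init_config_def)
  moreover have "3 \<le> symbols M" using tm by (simp add: turing_machine_def)
  then have "word_cells v z < symbols M" for v z
    using word_cells_less[of v z] by simp
  ultimately show ?case
    by (auto simp: wf_config_def cfg_def nth_init_config) (simp add: init_config_def)
next
  case (Suc t)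
  then show ?case by (simp add: cfg_def wf_config_step)
qed

lemma cfg_Suc: "cfg w (Suc t) = tm_step M (cfg w t)"
  by (simp add: cfg_def)

text \<open>A halted configuration is frozen, so any sufficiently late time can be inspected. The
  output is one bit in cell 0, and symbol 1 there means rejection.\<close>

lemma accepts_iff:
  assumes "poly q (length w) \<le> t"
  shows "w \<in> R \<longleftrightarrow> fst (snd (cfg w t) ! (tapes M - 1)) 0 \<noteq> 1"
proof -
  obtain s where s: "s \<le> poly q (length w)" "halts_with M (cfg w s) [w \<in> R]"
    using decides unfolding cfg_def by blast
  have "cfg w (s + d) = cfg w s" for d
  proof (induction d)
    case (Suc d)
    then show ?case using s(2) by (cases "cfg w s") (simp add: cfg_Suc halts_with_def)
  qed simp
  then have "cfg w t = cfg w s"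
    using s(1) assms by (metis le_trans le_add_diff_inverse)
  moreover have "snd (cfg w s) \<noteq> []" "length (snd (cfg w s)) = tapes M"
    using wf_cfg[of s w] tapes_pos by (auto simp: wf_config_def)
  ultimately have "fst (snd (cfg w t) ! (tapes M - 1)) = word_cells [w \<in> R]"
    using s(2) by (simp add: halts_with_def last_conv_nth)
  then show ?thesis by (simp add: word_cells_def bit_symbol_def)
qed

section \<open>Clause templates of the computation\<close>

definition cert_start :: "bool list \<Rightarrow> nat" where
  "cert_start x = 2 * length x + 2"

text \<open>The time bound for the longest admissible pair, plus one more than the length of that
  pair, so that input and certificate also lie inside the window of tape indices up to twice the
  horizon.\<close>

definition horizon :: "bool list \<Rightarrow> nat" where
  "horizon x = poly q (2 * length x + 2 + poly p (length x)) + 2 * length x + 3 + poly p (length x)"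

text \<open>The negated premises of a transition. Scanned symbols have facts of their own because
  otherwise one clause would have to range over the head positions of all tapes at once.\<close>

definition situation_lits :: "nat \<Rightarrow> nat list \<Rightarrow> lit set" where
  "situation_lits s ss = insert (False, FState s, 0, IZero)
     ((\<lambda>j. (False, FScan j (ss ! j), 0, IZero)) ` {..<tapes M})"

definition cert_area :: "bool list \<Rightarrow> nat \<Rightarrow> bool" where
  "cert_area x i \<longleftrightarrow> horizon x + cert_start x \<le> i \<and> i < horizon x + cert_start x + poly p (length x)"

definition fixed_input :: "bool list \<Rightarrow> nat \<Rightarrow> nat \<Rightarrow> bool" where
  "fixed_input x i a \<longleftrightarrow> \<not> cert_area x i \<and>
     (if horizon x \<le> i \<and> i < horizon x + cert_start x
      then a = (if letter (word_pair x []) (i - horizon x) then 2 else 1) else a = 0)"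

definition situations :: "(nat \<times> nat list) set" where
  "situations = {..halt_state M} \<times> {ss. set ss \<subseteq> {..<symbols M} \<and> length ss = tapes M}"

definition start_state_template :: template where
  "start_state_template = (\<lambda>x t i i'. t = 0, {(True, FState 0, 0, IZero)})"

definition start_head_template :: "nat \<Rightarrow> template" where
  "start_head_template j = (\<lambda>x t i i'. t = 0, {(True, FHead j, 0, IMid)})"

definition start_blank_template :: "nat \<Rightarrow> template" where
  "start_blank_template j = (\<lambda>x t i i'. t = 0, {(True, FCell j 0, 0, IFst)})"

definition input_template :: "nat \<Rightarrow> template" where
  "input_template a = (\<lambda>x t i i'. t = 0 \<and> fixed_input x i a, {(True, FCell 0 a, 0, IFst)})"

definition guess_template :: template where
  "guess_template = (\<lambda>x t i i'. t = 0 \<and> cert_area x i,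
     {(True, FCell 0 0, 0, IFst), (True, FCell 0 1, 0, IFst), (True, FCell 0 2, 0, IFst)})"

text \<open>A blank forces the next cell to be blank, so the guessed cells spell a word followed by
  blanks, that is, a certificate of any length up to the bound.\<close>

definition guess_end_template :: template where
  "guess_end_template = (\<lambda>x t i i'. t = 0 \<and> cert_area x i,
     {(False, FCell 0 0, 0, IFst), (True, FCell 0 0, 0, ISucc)})"

text \<open>Forbidding the rejecting symbol is enough: the actual content of the output cell is
  among the derived facts, so a rejecting run contradicts this clause.\<close>

definition accept_template :: template where
  "accept_template = (\<lambda>x t i i'. t = horizon x, {(False, FCell (tapes M - 1) 1, 0, IMid)})"

definition scan_template :: "nat \<times> nat \<Rightarrow> template" where
  "scan_template = (\<lambda>(j, a). (\<lambda>x t i i'. True,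
     {(False, FHead j, 0, IFst), (False, FCell j a, 0, IFst), (True, FScan j a, 0, IZero)}))"

text \<open>The premise is that the head is at another place \<open>i'\<close>. The negation of the
  head being at \<open>i\<close> would make the clause non-Horn and could not be derived.\<close>

definition keep_template :: "nat \<times> nat \<Rightarrow> template" where
  "keep_template = (\<lambda>(j, a). (\<lambda>x t i i'. t < horizon x \<and> i \<noteq> i',
     {(False, FHead j, 0, ISnd), (False, FCell j a, 0, IFst), (True, FCell j a, 1, IFst)}))"

definition state_template :: "nat \<times> nat list \<Rightarrow> template" where
  "state_template = (\<lambda>(s, ss). (\<lambda>x t i i'. t < horizon x,
     insert (True, FState (fst (next_action s ss)), 1, IZero) (situation_lits s ss)))"

definition write_template :: "(nat \<times> nat list) \<times> nat \<Rightarrow> template" where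
  "write_template = (\<lambda>((s, ss), j). (\<lambda>x t i i'. t < horizon x,
     {(False, FHead j, 0, IFst), (True, FCell j (fst (snd (next_action s ss) ! j)), 1, IFst)} \<union>
     situation_lits s ss))"

text \<open>The guard \<open>0 < i\<close> avoids the truncation of \<open>IPred\<close> at the left
  end of the window.\<close>

definition move_template :: "(nat \<times> nat list) \<times> nat \<Rightarrow> template" where
  "move_template = (\<lambda>((s, ss), j). (\<lambda>x t i i'. t < horizon x \<and> 0 < i,
     {(False, FHead j, 0, IFst), (True, FHead j, 1, shift_index (snd (snd (next_action s ss) ! j)))} \<union>
     situation_lits s ss))"

lemmas template_defs = start_state_template_def start_head_template_def start_blank_template_def
  input_template_def guess_template_def guess_end_template_def accept_template_def
  scan_template_def keep_template_def state_template_def write_template_def move_template_def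

definition templates :: "template set" where
  "templates = {start_state_template, guess_template, guess_end_template, accept_template} \<union>
     start_head_template ` {..<tapes M} \<union> start_blank_template ` {1..<tapes M} \<union>
     input_template ` {..2} \<union> scan_template ` ({..<tapes M} \<times> {..<symbols M}) \<union>
     keep_template ` ({..<tapes M} \<times> {..<symbols M}) \<union> state_template ` situations \<union>
     write_template ` (situations \<times> {..<tapes M}) \<union> move_template ` (situations \<times> {..<tapes M})"

text \<open>Tape indices up to twice the horizon are the cells at distance at most the horizon from
  the start. The same bound serves for times; later times only get clauses that the actual run
  satisfies as well.\<close>

definition range_bound :: "bool list \<Rightarrow> nat" where
  "range_bound x = 2 * horizon x + 1"

definition satisfies :: "(fact \<Rightarrow> nat \<Rightarrow> nat \<Rightarrow> bool) \<Rightarrow> bool list \<Rightarrow> template \<Rightarrow> bool" where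
  "satisfies \<alpha> x T \<longleftrightarrow> (\<forall>t<range_bound x. \<forall>i<range_bound x. \<forall>i'<range_bound x.
     fst T x t i i' \<longrightarrow> (\<exists>l\<in>snd T. lit_true \<alpha> (horizon x) t i i' l))"

lemma situation_lits_true:
  "(\<exists>l\<in>situation_lits s ss. lit_true \<alpha> \<tau> t i i' l) \<longleftrightarrow>
     \<not> (\<alpha> (FState s) t 0 \<and> (\<forall>j<tapes M. \<alpha> (FScan j (ss ! j)) t 0))"
  by (auto simp: situation_lits_def)

lemma finite_templates: "finite templates"
  unfolding templates_def situations_def by (simp add: finite_lists_length_eq)

lemma finite_template: "T \<in> templates \<Longrightarrow> finite (snd T)"
  by (auto simp: templates_def template_defs situation_lits_def)

lemma template_time: "T \<in> templates \<Longrightarrow> (s, f, d, x) \<in> snd T \<Longrightarrow> d \<le> 1"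
  by (auto simp: templates_def template_defs situation_lits_def)

section \<open>Satisfying assignments and accepting certificates\<close>

definition fact_holds :: "nat \<Rightarrow> config \<Rightarrow> fact \<Rightarrow> nat \<Rightarrow> bool" where
  "fact_holds \<tau> C f i = (case f of
      FState s \<Rightarrow> fst C = s
    | FHead j \<Rightarrow> snd (snd C ! j) = int i - int \<tau>
    | FCell j a \<Rightarrow> fst (snd C ! j) (int i - int \<tau>) = a
    | FScan j a \<Rightarrow> scanned (snd C ! j) = a)"

lemma word_cells_word_pair:
  "word_cells (word_pair x y) z =
     (if z < 0 then 0 else if z < int (cert_start x) then (if letter (word_pair x []) (nat z) then 2 else 1)
      else word_cells y (z - int (cert_start x)))"
proof -
  have len: "length (word_pair x []) = cert_start x" by (simp add: length_word_pair cert_start_def)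
  have "word_pair x y = word_pair x [] @ y" by (simp add: word_pair_def)
  then have "word_cells (word_pair x y) z = word_cells (word_pair x [] @ y) z" by simp
  also have "\<dots> = (if z < 0 then 0 else if z < int (cert_start x)
      then (if letter (word_pair x []) (nat z) then 2 else 1) else word_cells y (z - int (cert_start x)))"
    unfolding word_cells_def by (auto simp: nth_append len letter_def bit_symbol_def nat_diff_distrib)
  finally show ?thesis .
qed

lemma horizon_ge:
  assumes "length y \<le> poly p (length x)"
  shows "poly q (length (word_pair x y)) \<le> horizon x"
proof -
  have mono: "poly r a \<le> poly r b" if "a \<le> b" for r :: "nat poly" and a b
    using that by (induction r) (auto intro!: add_mono mult_mono)
  have "poly q (length (word_pair x y)) \<le> poly q (2 * length x + 2 + poly p (length x))"
    using assms by (intro mono) (simp add: length_word_pair)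
  then show ?thesis by (simp add: horizon_def)
qed

lemma fixed_input_cell:
  assumes "length y \<le> poly p (length x)" "\<not> cert_area x i"
  shows "fixed_input x i (word_cells (word_pair x y) (int i - int (horizon x)))"
proof -
  have "word_cells y (int i - int (horizon x) - int (cert_start x)) = 0"
    if "\<not> i < horizon x + cert_start x"
    using that assms by (auto simp: cert_area_def word_cells_def)
  then show ?thesis
    using assms(2) unfolding word_cells_word_pair fixed_input_def
    by (auto simp: nat_diff_distrib nat_int split: if_splits simp flip: of_nat_diff)
qed

lemma word_cells_Nil: "word_cells [] z = 0"
  by (simp add: word_cells_def)

text \<open>The facts that hold in the actual run on the pair form the assignment. A transition
  clause holds since its premises determine the state and all scanned symbols, hence the
  action.\<close>

lemma satisfies_complete:
  assumes "length y \<le> poly p (length x)" "word_pair x y \<in> R" "T \<in> templates"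
  shows "satisfies (\<lambda>f t. fact_holds (horizon x) (cfg (word_pair x y) t) f) x T"
proof -
  let ?w = "word_pair x y" and ?\<tau> = "horizon x"
  have wf: "wf_config t (cfg ?w t)" for t by (rule wf_cfg)
  have init: "cfg ?w 0 = init_config M ?w" by (simp add: cfg_def)
  have cell0: "fst (snd (cfg ?w 0) ! 0) z = word_cells ?w z" for z
    using nth_init_config[OF tapes_pos] by (simp add: init)
  have y0: "word_cells y z = 0" if "int (poly p (length x)) \<le> z" for z
    using that assms(1) by (auto simp: word_cells_def)
  have step: "fst (cfg ?w (Suc t)) = fst (next_action s ss)"
      "j < tapes M \<Longrightarrow> snd (cfg ?w (Suc t)) ! j =
        ((fst (snd (cfg ?w t) ! j))(snd (snd (cfg ?w t) ! j) := fst (snd (next_action s ss) ! j)),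
         snd (snd (cfg ?w t) ! j) + shift (snd (snd (next_action s ss) ! j)))"
    if "fst (cfg ?w t) = s" "\<And>j. j < tapes M \<Longrightarrow> scanned (snd (cfg ?w t) ! j) = ss ! j"
      "length ss = tapes M" for s ss t j
  proof -
    have "map scanned (snd (cfg ?w t)) = ss"
      by (rule nth_equalityI) (use that wf[of t] in \<open>auto simp: wf_config_def\<close>)
    then show "fst (cfg ?w (Suc t)) = fst (next_action s ss)"
      "j < tapes M \<Longrightarrow> snd (cfg ?w (Suc t)) ! j =
        ((fst (snd (cfg ?w t) ! j))(snd (snd (cfg ?w t) ! j) := fst (snd (next_action s ss) ! j)),
         snd (snd (cfg ?w t) ! j) + shift (snd (snd (next_action s ss) ! j)))"
      using nth_tm_step[OF wf[of t], of j] that(1)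
      by (simp_all add: cfg_Suc tm_step_next_action del: map_map)
  qed
  consider "T = start_state_template" | "T = guess_template" | "T = guess_end_template"
    | "T = accept_template" | a where "T = input_template a"
    | j where "j < tapes M" "T = start_head_template j"
    | j where "1 \<le> j" "j < tapes M" "T = start_blank_template j"
    | j a where "j < tapes M" "T = scan_template (j, a)"
    | j a where "j < tapes M" "T = keep_template (j, a)"
    | s ss where "length ss = tapes M" "T = state_template (s, ss)"
    | s ss j where "length ss = tapes M" "j < tapes M" "T = write_template ((s, ss), j)"
    | s ss j where "length ss = tapes M" "j < tapes M" "T = move_template ((s, ss), j)"
    using assms(3) unfolding templates_def situations_def by auto
  then show ?thesis
  proof cases
    case 1
    then show ?thesis by (simp add: satisfies_def template_defs fact_holds_def init init_config_def)
  next
    case 2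
    then show ?thesis
      using word_cells_cases[of ?w] by (auto simp: satisfies_def template_defs fact_holds_def cell0)
  next
    case 3
    have blank: "word_cells ?w (int (i + 1) - int ?\<tau>) = 0"
      if "word_cells ?w (int i - int ?\<tau>) = 0" "cert_area x i" for i
      using that by (auto simp: cert_area_def word_cells_def bit_symbol_def split: if_splits)
    show ?thesis
      unfolding 3 satisfies_def guess_end_template_def fst_conv snd_conv
    proof (intro allI impI)
      fix t i i' :: nat assume "t = 0 \<and> cert_area x i"
      with blank[of i] show "\<exists>l\<in>{(False, FCell 0 0, 0, IFst), (True, FCell 0 0, 0, ISucc)}.
          lit_true (\<lambda>f t. fact_holds ?\<tau> (cfg ?w t) f) ?\<tau> t i i' l"
        by (cases "word_cells ?w (int i - int ?\<tau>) = 0") (simp_all add: fact_holds_def cell0)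
    qed
  next
    case 4
    then show ?thesis
      using horizon_ge[OF assms(1)] assms(2) accepts_iff by (auto simp: satisfies_def template_defs fact_holds_def)
  next
    case (5 a)
    have "word_cells ?w (int i - int ?\<tau>) = a" if "fixed_input x i a" for i
      using fixed_input_cell[OF assms(1), of i] that unfolding fixed_input_def by presburger
    then show ?thesis using 5 by (auto simp: satisfies_def template_defs fact_holds_def cell0)
  next
    case (6 j)
    then show ?thesis by (simp add: satisfies_def template_defs fact_holds_def init nth_init_config)
  next
    case (7 j)
    then show ?thesis by (simp add: satisfies_def template_defs fact_holds_def init nth_init_config word_cells_def)
  next
    case (8 j a)
    then show ?thesis by (auto simp: satisfies_def template_defs fact_holds_def scanned_fst)
  next
    case (9 j a)
    have "fst (snd (cfg ?w (Suc t)) ! j) z = fst (snd (cfg ?w t) ! j) z"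
      if "z \<noteq> snd (snd (cfg ?w t) ! j)" for t z
    proof -
      obtain b d where "snd (next_action (fst (cfg ?w t)) (map scanned (snd (cfg ?w t)))) ! j = (b, d)"
        by fastforce
      from nth_tm_step[OF wf 9(1) this] show ?thesis using that by (simp add: cfg_Suc)
    qed
    then show ?thesis using 9 by (auto simp: satisfies_def template_defs fact_holds_def)
  next
    case (10 s ss)
    then show ?thesis
      using step(1)[OF _ _ 10(1)] by (auto simp: satisfies_def template_defs situation_lits_true fact_holds_def bex_simps)
  next
    case (11 s ss j)
    have "fst (snd (cfg ?w (Suc t)) ! j) z = fst (snd (next_action s ss) ! j)"
      if "fst (cfg ?w t) = s" "\<And>j. j < tapes M \<Longrightarrow> scanned (snd (cfg ?w t) ! j) = ss ! j"
         "snd (snd (cfg ?w t) ! j) = z" for t z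
      using step(2)[OF that(1,2) 11(1,2)] that(3) by simp
    then show ?thesis
      using 11 by (auto simp: satisfies_def template_defs bex_Un situation_lits_true fact_holds_def)
  next
    case (12 s ss j)
    have "snd (snd (cfg ?w (Suc t)) ! j) = int (index_val ?\<tau> i i' (shift_index (snd (snd (next_action s ss) ! j)))) - int ?\<tau>"
      if "fst (cfg ?w t) = s" "\<And>j. j < tapes M \<Longrightarrow> scanned (snd (cfg ?w t) ! j) = ss ! j"
         "snd (snd (cfg ?w t) ! j) = int i - int ?\<tau>" "0 < i" for t i i'
      using step(2)[OF that(1,2) 12(1,2)] that(3,4)
      by (cases "snd (snd (next_action s ss) ! j)") auto
    then show ?thesis
      using 12 by (auto simp: satisfies_def template_defs bex_Un situation_lits_true fact_holds_def)
  qed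
qed

text \<open>A certificate is read off the guessed cells. Then induction on time shows that every
  fact of the run on this certificate is true under \<open>\<alpha>\<close>, whatever else is true,
  so the accept clause refers to the real output.\<close>

lemma satisfies_sound:
  assumes "\<And>T. T \<in> templates \<Longrightarrow> satisfies \<alpha> x T"
  shows "\<exists>y. length y \<le> poly p (length x) \<and> word_pair x y \<in> R"
proof -
  define \<tau> where "\<tau> = horizon x"
  define P where "P = poly p (length x)"
  define c where "c m = \<tau> + cert_start x + m" for m
  have sat: "\<exists>l\<in>snd T. lit_true \<alpha> \<tau> t i i' l"
    if "T \<in> templates" "fst T x t i i'" "t < 2 * \<tau> + 1" "i < 2 * \<tau> + 1" "i' < 2 * \<tau> + 1" for T t i i'
    using assms[OF that(1)] that(2-5) unfolding satisfies_def range_bound_def \<tau>_def by blast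
  have \<tau>: "cert_start x + P < \<tau>" by (simp add: \<tau>_def horizon_def cert_start_def P_def)
  have area: "cert_area x (c m)" if "m < P" for m
    using that by (simp add: cert_area_def c_def \<tau>_def P_def)
  \<comment> \<open>The certificate ends at the first cell where the blank is true. Before it the
    blank is false, hence 1 or 2 is true, and where both are true \<open>y\<close> takes 2.\<close>
  define l where "l = (LEAST m. m = P \<or> \<alpha> (FCell 0 0) 0 (c m))"
  define y where "y = map (\<lambda>m. \<alpha> (FCell 0 2) 0 (c m)) [0..<l]"
  let ?w = "word_pair x y"
  have l: "l \<le> P" "l = P \<or> \<alpha> (FCell 0 0) 0 (c l)"
    unfolding l_def by (rule Least_le, simp) (rule LeastI[of _ P], simp)
  then have leny: "length y \<le> poly p (length x)" by (simp add: y_def P_def)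
  have guess: "\<alpha> (FCell 0 (if \<alpha> (FCell 0 2) 0 (c m) then 2 else 1)) 0 (c m)" if "m < l" for m
  proof -
    have "guess_template \<in> templates" by (simp add: templates_def)
    from sat[OF this, of 0 "c m" 0] have "\<alpha> (FCell 0 0) 0 (c m) \<or> \<alpha> (FCell 0 1) 0 (c m) \<or> \<alpha> (FCell 0 2) 0 (c m)"
      using area[of m] that l(1) \<tau> by (auto simp: guess_template_def c_def)
    moreover have "\<not> \<alpha> (FCell 0 0) 0 (c m)"
      using not_less_Least that unfolding l_def by blast
    ultimately show ?thesis by auto
  qed
  have tail: "m < P \<longrightarrow> \<alpha> (FCell 0 0) 0 (c m)" if "l \<le> m" for m
    using that
  proof (induction m rule: dec_induct)
    case base
    then show ?case using l(2) by auto
  next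
    case (step m)
    have "guess_end_template \<in> templates" by (simp add: templates_def)
    from sat[OF this, of 0 "c m" 0] show ?case
      using area[of m] step \<tau> by (auto simp: guess_end_template_def c_def)
  qed
  have cell0: "\<alpha> (FCell 0 (word_cells ?w (int i - int \<tau>))) 0 i" if i: "i < 2 * \<tau> + 1" for i
  proof (cases "cert_area x i")
    case True
    then obtain m where m: "i = c m" "m < P"
      unfolding cert_area_def c_def \<tau>_def P_def by (metis le_Suc_ex nat_add_left_cancel_less)
    have "word_cells ?w (int i - int \<tau>) = word_cells y (int m)"
      unfolding word_cells_word_pair by (simp add: m c_def)
    also have "\<dots> = (if m < l then if \<alpha> (FCell 0 2) 0 (c m) then 2 else 1 else 0)"
      by (simp add: word_cells_def y_def bit_symbol_def)
    finally show ?thesis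
      using guess[of m] tail[of m] m by (cases "m < l") simp_all
  next
    case False
    let ?a = "word_cells ?w (int i - int \<tau>)"
    have "?a \<le> 2" using word_cells_cases[of ?w "int i - int \<tau>"] by auto
    then have "input_template ?a \<in> templates" by (simp add: templates_def)
    from sat[OF this, of 0 i 0] show ?thesis
      using i fixed_input_cell[OF leny False] by (simp add: input_template_def \<tau>_def)
  qed
  have wf: "wf_config t (cfg ?w t)" for t by (rule wf_cfg)
  have init: "cfg ?w 0 = init_config M ?w" by (simp add: cfg_def)
  have "\<alpha> (FState (fst (cfg ?w t))) t 0 \<and>
     (\<forall>j<tapes M. \<alpha> (FHead j) t (nat (snd (snd (cfg ?w t) ! j) + int \<tau>))) \<and>
     (\<forall>j<tapes M. \<forall>i<2 * \<tau> + 1. \<alpha> (FCell j (fst (snd (cfg ?w t) ! j) (int i - int \<tau>))) t i)"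
    if "t \<le> \<tau>" for t
    using that
  proof (induction t)
    case 0
    have "\<alpha> (FState 0) 0 0"
      using sat[of start_state_template 0 0 0] by (simp add: templates_def start_state_template_def)
    moreover have "\<alpha> (FHead j) 0 \<tau>" if "j < tapes M" for j
      using sat[of "start_head_template j" 0 0 0] that by (simp add: templates_def start_head_template_def)
    moreover have "\<alpha> (FCell j (word_cells (if j = 0 then ?w else []) (int i - int \<tau>))) 0 i"
      if "j < tapes M" "i < 2 * \<tau> + 1" for i j
    proof (cases "j = 0")
      case False
      then have "start_blank_template j \<in> templates" using that by (auto simp: templates_def)
      from sat[OF this, of 0 i 0] show ?thesis
        using that False by (simp add: start_blank_template_def word_cells_Nil)
    qed (use cell0 that in simp)
    ultimately show ?case
      using nth_init_config[of _ ?w] by (simp add: init) (simp add: init_config_def)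
  next
    case (Suc t)
    let ?C = "cfg ?w t"
    define s where "s = fst ?C"
    define ss where "ss = map scanned (snd ?C)"
    define hd where "hd j = nat (snd (snd ?C ! j) + int \<tau>)" for j
    have t: "t < \<tau>" using Suc.prems by simp
    have IH: "\<alpha> (FState s) t 0" "\<And>j. j < tapes M \<Longrightarrow> \<alpha> (FHead j) t (hd j)"
      "\<And>i j. j < tapes M \<Longrightarrow> i < 2 * \<tau> + 1 \<Longrightarrow> \<alpha> (FCell j (fst (snd ?C ! j) (int i - int \<tau>))) t i"
      using Suc t by (auto simp: s_def hd_def)
    \<comment> \<open>Since \<open>t < \<tau>\<close>, the heads are strictly inside the window, so
      the cells on both sides still have tape indices.\<close>
    have hd: "0 < hd j" "hd j < 2 * \<tau>" "int (hd j) - int \<tau> = snd (snd ?C ! j)" if "j < tapes M" for j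
      using wf[of t] that t by (auto simp: wf_config_def hd_def abs_le_iff)
    note ss = wf_config_scanned[OF wf[of t], folded ss_def]
    have sit: "(s, ss) \<in> situations"
      using ss wf[of t] by (simp add: situations_def s_def wf_config_def)
    have scan: "\<alpha> (FScan j (ss ! j)) t 0" if j: "j < tapes M" for j
    proof -
      have ssj: "ss ! j = fst (snd ?C ! j) (int (hd j) - int \<tau>)"
        using j ss(1) by (simp add: hd ss_def scanned_fst)
      have "ss ! j < symbols M" using ss j by (metis lessThan_iff nth_mem subsetD)
      then have "scan_template (j, ss ! j) \<in> templates" using j by (simp add: templates_def)
      from sat[OF this, of t "hd j" 0] show ?thesis
        using IH(2)[OF j] IH(3)[OF j, of "hd j"] hd[OF j] t by (auto simp: scan_template_def ssj)
    qed
    then have prem: "\<not> lit_true \<alpha> \<tau> t i i' l" if "l \<in> situation_lits s ss" for i i' l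
      using situation_lits_true[of s ss \<alpha> \<tau> t i i'] IH(1) that by blast
    have state: "\<alpha> (FState (fst (cfg ?w (Suc t)))) (Suc t) 0"
    proof -
      have "state_template (s, ss) \<in> templates" using sit by (simp add: templates_def)
      from sat[OF this, of t 0 0] show ?thesis
        using t prem by (auto simp: state_template_def \<tau>_def cfg_Suc tm_step_next_action s_def ss_def simp del: map_map)
    qed
    have tape: "\<alpha> (FHead j) (Suc t) (nat (snd (snd (cfg ?w (Suc t)) ! j) + int \<tau>)) \<and>
       (\<forall>i<2 * \<tau> + 1. \<alpha> (FCell j (fst (snd (cfg ?w (Suc t)) ! j) (int i - int \<tau>))) (Suc t) i)"
      if j: "j < tapes M" for j
    proof -
      obtain b d where bd: "snd (next_action s ss) ! j = (b, d)" by fastforce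
      have new: "snd (cfg ?w (Suc t)) ! j = ((fst (snd ?C ! j))(snd (snd ?C ! j) := b), snd (snd ?C ! j) + shift d)"
        using nth_tm_step[OF wf j] bd by (simp add: cfg_Suc s_def ss_def)
      have "move_template ((s, ss), j) \<in> templates" using sit j by (simp add: templates_def)
      from sat[OF this, of t "hd j" 0] have "\<alpha> (FHead j) (Suc t) (index_val \<tau> (hd j) 0 (shift_index d))"
        using t hd[OF j] IH(2)[OF j] prem by (auto simp: move_template_def bd \<tau>_def)
      moreover have "index_val \<tau> (hd j) 0 (shift_index d) = nat (snd (snd ?C ! j) + shift d + int \<tau>)"
        using hd[OF j] by (cases d) auto
      ultimately have "\<alpha> (FHead j) (Suc t) (nat (snd (snd (cfg ?w (Suc t)) ! j) + int \<tau>))"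
        by (simp add: new)
      moreover have "\<alpha> (FCell j (fst (snd (cfg ?w (Suc t)) ! j) (int i - int \<tau>))) (Suc t) i"
        if i: "i < 2 * \<tau> + 1" for i
      proof (cases "i = hd j")
        case True
        have "write_template ((s, ss), j) \<in> templates" using sit j by (simp add: templates_def)
        from sat[OF this, of t "hd j" 0] show ?thesis
          using t hd[OF j] IH(2)[OF j] prem by (auto simp: write_template_def bd new True \<tau>_def)
      next
        case False
        let ?a = "fst (snd ?C ! j) (int i - int \<tau>)"
        have "?a < symbols M" using wf[of t] j by (simp add: wf_config_def)
        then have "keep_template (j, ?a) \<in> templates" using j by (simp add: templates_def)
        from sat[OF this, of t i "hd j"] have "\<alpha> (FCell j ?a) (Suc t) i"
          using t hd[OF j] i False IH(2)[OF j] IH(3)[OF j i] by (auto simp: keep_template_def \<tau>_def)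
        moreover have "int i - int \<tau> \<noteq> snd (snd ?C ! j)" using hd[OF j] False by auto
        ultimately show ?thesis by (simp add: new)
      qed
      ultimately show ?thesis by blast
    qed
    show ?case using state tape by blast
  qed
  from this[of \<tau>] have "\<forall>i<2 * \<tau> + 1.
      \<alpha> (FCell (tapes M - 1) (fst (snd (cfg ?w \<tau>) ! (tapes M - 1)) (int i - int \<tau>))) \<tau> i"
    using tapes_pos by simp
  from this[rule_format, of \<tau>]
  have "\<alpha> (FCell (tapes M - 1) (fst (snd (cfg ?w \<tau>) ! (tapes M - 1)) 0)) \<tau> \<tau>"
    by simp
  moreover have "\<not> \<alpha> (FCell (tapes M - 1) 1) \<tau> \<tau>"
    using sat[of accept_template \<tau> 0 0] by (simp add: templates_def accept_template_def \<tau>_def)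
  ultimately have "?w \<in> R"
    using accepts_iff[OF horizon_ge[OF leny]] unfolding \<tau>_def by metis
  then show ?thesis using leny by blast
qed

section \<open>Definability and numbering of the clauses\<close>

lemma definable_horizon: "definable (\<lambda>w \<rho>. horizon w)"
  unfolding horizon_def by (intro definable_intros)

lemma definable_range_bound: "definable (\<lambda>w \<rho>. range_bound w)"
  unfolding range_bound_def by (intro definable_intros definable_horizon)

lemma definable_cert_area:
  "definable i \<Longrightarrow> definable_pred (\<lambda>w \<rho>. cert_area w (i w \<rho>))"
  unfolding cert_area_def cert_start_def by (intro definable_intros definable_horizon)

lemma definable_fixed_input:
  assumes "definable i"
  shows "definable_pred (\<lambda>w \<rho>. fixed_input w (i w \<rho>) a)"
proof -
  have "letter (word_pair x []) k \<longleftrightarrow> (if k < 2 * length x then letter x (k div 2) else k = 2 * length x + 1)"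
    for x k unfolding letter_word_pair by (simp add: letter_def[of "[]"])
  then show ?thesis
    unfolding fixed_input_def cert_start_def
    by (simp only:) (intro definable_intros definable_horizon definable_cert_area assms)
qed

lemma definable_guard_templates:
  assumes "T \<in> templates"
  shows "definable_guard (fst T)"
  using assms unfolding templates_def
  by (auto simp: template_defs definable_guard_def
      intro!: definable_intros definable_horizon definable_cert_area definable_fixed_input)

text \<open>Variables and clauses are numbered by mixed radix: a variable by the code of its fact,
  its time and its place, a clause by its template and the three instantiated parameters. Quotients
  and remainders decode both.\<close>

lemma clauses:
  obtains N C :: "bool list \<Rightarrow> nat" and lit :: "bool \<Rightarrow> bool list \<Rightarrow> nat \<Rightarrow> nat \<Rightarrow> bool"
  where "definable (\<lambda>w \<rho>. N w)" "definable (\<lambda>w \<rho>. C w)"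
    and "\<And>b v c. definable v \<Longrightarrow> definable c \<Longrightarrow> definable_pred (\<lambda>w \<rho>. lit b w (v w \<rho>) (c w \<rho>))"
    and "\<And>w. (\<exists>y. length y \<le> poly p (length w) \<and> word_pair w y \<in> R) \<longleftrightarrow>
      (\<exists>X. \<forall>c<C w. \<exists>v<N w. lit (X v) w v c)"
proof -
  obtain ts where ts: "set ts = templates" using finite_list[OF finite_templates] by blast
  define Fs where "Fs = (\<Union>T\<in>templates. (fst \<circ> snd) ` snd T)"
  have "finite Fs" unfolding Fs_def using finite_templates finite_template by blast
  define K where "K = Suc (Max (to_nat ` Fs))"
  have K: "to_nat f < K" if "f \<in> Fs" for f
    unfolding K_def using \<open>finite Fs\<close> that by (simp add: le_imp_less_Suc)
  define n where "n = length ts"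
  have n0: "0 < n" using ts unfolding n_def templates_def by auto
  define B where "B w = range_bound w + 2" for w
  define var where "var w f t i = to_nat f + K * (t + B w * i)" for w and f :: fact and t i
  define N where "N w = K * (B w * B w)" for w
  define C where "C w = n * (range_bound w * (range_bound w * range_bound w))" for w
  define t_of where "t_of w c = c div n mod range_bound w" for w c
  define i_of where "i_of w c = c div n div range_bound w mod range_bound w" for w c
  define i'_of where "i'_of w c = c div n div range_bound w div range_bound w" for w c
  \<comment> \<open>If the guard fails, the clause contains every literal and holds for any
    assignment. The finite disjunction over the template number \<open>m\<close> allows each guard
    to be definable by itself.\<close>
  define lit where "lit b w v c \<longleftrightarrow> (\<exists>m\<in>{..<n}. c mod n = m \<and>
     (fst (ts ! m) w (t_of w c) (i_of w c) (i'_of w c) \<longrightarrow>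
      (\<exists>l\<in>snd (ts ! m). fst l = b \<and> v = var w (fst (snd l)) (t_of w c + fst (snd (snd l)))
         (index_val (horizon w) (i_of w c) (i'_of w c) (snd (snd (snd l)))))))" for b w v c
  have tm: "ts ! m \<in> templates" if "m < n" for m
    using that ts n_def by (metis nth_mem)
  have B0: "0 < range_bound w" for w by (simp add: range_bound_def)
  have i'_less: "i'_of w c < range_bound w" if "c < C w" for w c
    using that B0[of w] n0 unfolding i'_of_def C_def by (simp add: less_mult_imp_div_less mult_ac)
  have bounds: "t + d < B w \<and> index_val (horizon w) i i' x < B w"
    if "t < range_bound w" "i < range_bound w" "i' < range_bound w" "d \<le> 1" for w t d i i' x
    using that by (cases x) (auto simp: B_def range_bound_def)
  have sat_iff: "(\<exists>v<N w. lit (X v) w v c) \<longleftrightarrow>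
      (fst (ts ! (c mod n)) w (t_of w c) (i_of w c) (i'_of w c) \<longrightarrow>
       (\<exists>l\<in>snd (ts ! (c mod n)). lit_true (\<lambda>f t i. X (var w f t i)) (horizon w) (t_of w c) (i_of w c) (i'_of w c) l))"
    if c: "c < C w" for X w c
  proof -
    have m: "c mod n < n" using n0 by simp
    have less: "t_of w c < range_bound w" "i_of w c < range_bound w" "i'_of w c < range_bound w"
      using B0 i'_less[OF c] by (simp_all add: t_of_def i_of_def)
    have "0 < N w" by (simp add: N_def B_def K_def)
    have less_N: "var w f (t_of w c + d) (index_val (horizon w) (i_of w c) (i'_of w c) x) < N w"
      if "(s, f, d, x) \<in> snd (ts ! (c mod n))" for s f d x
    proof -
      have "f \<in> Fs" using that tm[OF m] unfolding Fs_def by force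
      moreover have "d \<le> 1" using template_time[OF tm[OF m] that] .
      have v: "a + k * (t + b * i) < k * (b * b)" if "a < k" "t < b" "i < b" for a k t b i :: nat
      proof -
        have "t + b * i < b * Suc i" using that by simp
        also have "\<dots> \<le> b * b" using that by (intro mult_le_mono) auto
        finally have "Suc (t + b * i) \<le> b * b" by simp
        then have "k * Suc (t + b * i) \<le> k * (b * b)" by (rule mult_le_mono2)
        then show ?thesis using that by simp
      qed
      ultimately show ?thesis
        unfolding var_def N_def using bounds[OF less \<open>d \<le> 1\<close>] K by (intro v) auto
    qed
    let ?T = "ts ! (c mod n)"
    let ?g = "fst ?T w (t_of w c) (i_of w c) (i'_of w c)"
    let ?true = "lit_true (\<lambda>f t i. X (var w f t i)) (horizon w) (t_of w c) (i_of w c) (i'_of w c)"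
    show ?thesis
    proof (intro iffI impI)
      assume "\<exists>v<N w. lit (X v) w v c" and ?g
      then obtain v where "lit (X v) w v c" by blast
      with \<open>?g\<close> m obtain l where "l \<in> snd ?T" "fst l = X v" "v = var w (fst (snd l))
          (t_of w c + fst (snd (snd l))) (index_val (horizon w) (i_of w c) (i'_of w c) (snd (snd (snd l))))"
        unfolding lit_def by blast
      then show "\<exists>l\<in>snd ?T. ?true l"
        by (cases l) (auto intro!: bexI)
    next
      assume sat: "?g \<longrightarrow> (\<exists>l\<in>snd ?T. ?true l)"
      show "\<exists>v<N w. lit (X v) w v c"
      proof (cases ?g)
        case False
        then have "lit (X 0) w 0 c" using m unfolding lit_def by blast
        then show ?thesis using \<open>0 < N w\<close> by blast
      next
        case True
        with sat obtain s f d x where l: "(s, f, d, x) \<in> snd ?T" "?true (s, f, d, x)"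
          by (metis surj_pair)
        let ?v = "var w f (t_of w c + d) (index_val (horizon w) (i_of w c) (i'_of w c) x)"
        have "lit s w ?v c"
          unfolding lit_def using m l(1) by force
        then show ?thesis using l(2) less_N[OF l(1)] by auto
      qed
    qed
  qed
  show thesis
  proof (rule that[of N C lit])
    show "definable (\<lambda>w \<rho>. N w)" "definable (\<lambda>w \<rho>. C w)"
      unfolding N_def C_def B_def by (intro definable_intros definable_range_bound)+
    fix b v c assume vc: "definable v" "definable c"
    have t: "definable (\<lambda>w \<rho>. t_of w (c w \<rho>))" "definable (\<lambda>w \<rho>. i_of w (c w \<rho>))"
      "definable (\<lambda>w \<rho>. i'_of w (c w \<rho>))"
      unfolding t_of_def i_of_def i'_of_def by (intro definable_intros definable_range_bound vc)+
    have ix: "definable (\<lambda>w \<rho>. index_val (horizon w) (i_of w (c w \<rho>)) (i'_of w (c w \<rho>)) x)" for x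
      by (cases x) (simp_all only: index_val.simps, (intro definable_intros definable_horizon t)+)
    have g: "definable_pred (\<lambda>w \<rho>. fst (ts ! m) w (t_of w (c w \<rho>)) (i_of w (c w \<rho>)) (i'_of w (c w \<rho>)))"
      if "m < n" for m
      using definable_guard_templates[OF tm[OF that]] t unfolding definable_guard_def by blast
    show "definable_pred (\<lambda>w \<rho>. lit b w (v w \<rho>) (c w \<rho>))"
      unfolding lit_def var_def B_def
      by (intro definable_pred_ex_finite definable_intros definable_range_bound finite_template tm
          g t ix vc finite_lessThan; simp)
  next
    fix w
    show "(\<exists>y. length y \<le> poly p (length w) \<and> word_pair w y \<in> R) \<longleftrightarrow>
      (\<exists>X. \<forall>c<C w. \<exists>v<N w. lit (X v) w v c)"
    proof
      assume "\<exists>y. length y \<le> poly p (length w) \<and> word_pair w y \<in> R"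
      then obtain \<alpha> where \<alpha>: "\<And>T. T \<in> templates \<Longrightarrow> satisfies \<alpha> w T"
        using satisfies_complete by metis
      define X where "X v \<longleftrightarrow> (\<exists>f\<in>Fs. \<exists>t<B w. \<exists>i<B w. v = var w f t i \<and> \<alpha> f t i)" for v
      have X: "X (var w f t i) \<longleftrightarrow> \<alpha> f t i" if "f \<in> Fs" "t < B w" "i < B w" for f t i
      proof -
        have "f' = f \<and> t' = t \<and> i' = i"
          if eq: "var w f t i = var w f' t' i'" and "f' \<in> Fs" "t' < B w" "i' < B w" for f' t' i'
        proof -
          have dm: "a = a' \<and> x = x'" if "a + k * x = a' + k * x'" "a < k" "a' < k" for a a' k x x' :: nat
          proof -
            have "a = (a + k * x) mod k" "x = (a + k * x) div k"
              "a' = (a' + k * x') mod k" "x' = (a' + k * x') div k"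
              using that(2,3) by simp_all
            then show ?thesis using that(1) by metis
          qed
          have "to_nat f = to_nat f' \<and> t + B w * i = t' + B w * i'"
            using eq K \<open>f \<in> Fs\<close> \<open>f' \<in> Fs\<close> unfolding var_def by (intro dm) auto
          then show ?thesis
            using dm[of t "B w" i t' i'] \<open>t < B w\<close> \<open>t' < B w\<close> by simp
        qed
        then show ?thesis unfolding X_def using that by metis
      qed
      have "\<exists>v<N w. lit (X v) w v c" if c: "c < C w" for c
        unfolding sat_iff[OF c]
      proof
        let ?T = "ts ! (c mod n)"
        assume "fst ?T w (t_of w c) (i_of w c) (i'_of w c)"
        moreover have T: "?T \<in> templates" using tm n0 by simp
        moreover have less: "t_of w c < range_bound w" "i_of w c < range_bound w" "i'_of w c < range_bound w"
          using B0 i'_less[OF c] by (simp_all add: t_of_def i_of_def)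
        ultimately obtain s f d x where l: "(s, f, d, x) \<in> snd ?T"
          "lit_true \<alpha> (horizon w) (t_of w c) (i_of w c) (i'_of w c) (s, f, d, x)"
          using \<alpha>[OF T] unfolding satisfies_def by (metis surj_pair)
        have "f \<in> Fs" using l(1) T unfolding Fs_def by force
        then have "lit_true (\<lambda>f t i. X (var w f t i)) (horizon w) (t_of w c) (i_of w c) (i'_of w c) (s, f, d, x)"
          using l(2) X bounds[OF less template_time[OF T l(1)]] by simp
        then show "\<exists>l\<in>snd ?T. lit_true (\<lambda>f t i. X (var w f t i)) (horizon w) (t_of w c) (i_of w c) (i'_of w c) l"
          using l(1) by blast
      qed
      then show "\<exists>X. \<forall>c<C w. \<exists>v<N w. lit (X v) w v c" by blast
    next
      assume "\<exists>X. \<forall>c<C w. \<exists>v<N w. lit (X v) w v c"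
      then obtain X where X: "\<And>c. c < C w \<Longrightarrow> \<exists>v<N w. lit (X v) w v c" by blast
      have "satisfies (\<lambda>f t i. X (var w f t i)) w T" if "T \<in> templates" for T
        unfolding satisfies_def
      proof (intro allI impI)
        fix t i i' assume less: "t < range_bound w" "i < range_bound w" "i' < range_bound w"
          and g: "fst T w t i i'"
        obtain m where m: "m < n" "ts ! m = T"
          using \<open>T \<in> templates\<close> ts unfolding n_def by (metis in_set_conv_nth)
        define c where "c = m + n * (t + range_bound w * (i + range_bound w * i'))"
        have "c mod n = m" "c div n = t + range_bound w * (i + range_bound w * i')"
          using m(1) by (simp_all add: c_def)
        then have dec: "c mod n = m" "t_of w c = t" "i_of w c = i" "i'_of w c = i'"
          using less by (simp_all add: t_of_def i_of_def i'_of_def)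
        have "c < C w"
        proof -
          have s: "a + k * x < k * y" if "a < k" "x < y" for a k x y :: nat
          proof -
            have "a + k * x < k * Suc x" using that by simp
            also have "\<dots> \<le> k * y" using that by (intro mult_le_mono) auto
            finally show ?thesis .
          qed
          show ?thesis unfolding c_def C_def by (intro s m less)
        qed
        from X[OF this] sat_iff[OF this] show "\<exists>l\<in>snd T. lit_true (\<lambda>f t i. X (var w f t i)) (horizon w) t i i' l"
          using g unfolding dec m(2) by blast
      qed
      then show "\<exists>y. length y \<le> poly p (length w) \<and> word_pair w y \<in> R"
        by (rule satisfies_sound)
    qed
  qed
qed

end

text \<open>The Cook-Levin theorem with definable formulas: \<open>lit b w v c\<close> says that
  variable \<open>v\<close> occurs in clause \<open>c\<close> with sign \<open>b\<close>, so
  \<open>lit (X v) w v c\<close> is a literal made true by \<open>X\<close>. Clauses may have any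
  length.\<close>

theorem NP_clauses:
  assumes "A \<in> class_NP"
  obtains N C :: "bool list \<Rightarrow> nat" and lit :: "bool \<Rightarrow> bool list \<Rightarrow> nat \<Rightarrow> nat \<Rightarrow> bool"
  where "definable (\<lambda>w \<rho>. N w)" "definable (\<lambda>w \<rho>. C w)"
    and "\<And>b v c. definable v \<Longrightarrow> definable c \<Longrightarrow> definable_pred (\<lambda>w \<rho>. lit b w (v w \<rho>) (c w \<rho>))"
    and "\<And>w. w \<in> A \<longleftrightarrow> (\<exists>X. \<forall>c<C w. \<exists>v<N w. lit (X v) w v c)"
proof -
  obtain R p where R: "R \<in> class_P"
    and A: "\<And>x. x \<in> A \<longleftrightarrow> (\<exists>y. length y \<le> poly p (length x) \<and> word_pair x y \<in> R)"
    using assms unfolding class_NP_def by blast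
  obtain M q where M: "turing_machine M"
    "\<And>w. \<exists>t\<le>poly q (length w). halts_with M ((tm_step M ^^ t) (init_config M w)) [w \<in> R]"
    using R unfolding class_P_def poly_time_def by blast
  interpret verifier M R q p by standard (rule M)+
  show thesis
  proof (rule clauses)
    fix N C :: "bool list \<Rightarrow> nat" and lit :: "bool \<Rightarrow> bool list \<Rightarrow> nat \<Rightarrow> nat \<Rightarrow> bool"
    assume "definable (\<lambda>w \<rho>. N w)" "definable (\<lambda>w \<rho>. C w)"
      and "\<And>b v c. definable v \<Longrightarrow> definable c \<Longrightarrow> definable_pred (\<lambda>w \<rho>. lit b w (v w \<rho>) (c w \<rho>))"
      and "\<And>w. (\<exists>y. length y \<le> poly p (length w) \<and> word_pair w y \<in> R) \<longleftrightarrow>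
        (\<exists>X. \<forall>c<C w. \<exists>v<N w. lit (X v) w v c)"
    then show thesis unfolding A[symmetric] by (rule that[of N C lit])
  qed
qed

section \<open>Subgraphs of the integer grid\<close>

text \<open>Unit steps along the lines of a coarse grid of mesh \<open>D\<close>.\<close>

definition grid_adjacent :: "int \<Rightarrow> ('a \<Rightarrow> int) \<Rightarrow> ('a \<Rightarrow> int) \<Rightarrow> 'a \<Rightarrow> 'a \<Rightarrow> bool" where
  "grid_adjacent D X Y u v \<longleftrightarrow>
     (\<bar>X u - X v\<bar> = 1 \<and> Y u = Y v \<and> D dvd Y u) \<or> (\<bar>Y u - Y v\<bar> = 1 \<and> X u = X v \<and> D dvd X u)"

lemma Complex_segment:
  assumes "z \<in> closed_segment (Complex a b) (Complex c d)"
  obtains t where "0 \<le> t" "t \<le> 1" "Re z = a + t * (c - a)" "Im z = b + t * (d - b)"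
proof -
  obtain u where u: "0 \<le> u" "u \<le> 1" and z: "z = (1 - u) *\<^sub>R Complex a b + u *\<^sub>R Complex c d"
    using assms unfolding closed_segment_def by blast
  show thesis by (rule that[OF u]) (simp_all add: z algebra_simps)
qed

lemma floor_between:
  fixes t :: real and x y :: int
  assumes "0 < t" "t < 1" "\<bar>x - y\<bar> = 1"
    and z: "z = of_int x + t * (of_int y - of_int x)"
  shows "{\<lfloor>z\<rfloor>, \<lceil>z\<rceil>} = {x, y}" "z \<notin> \<int>"
proof -
  consider "y = x + 1" | "y = x - 1" using assms(3) by linarith
  then have "{\<lfloor>z\<rfloor>, \<lceil>z\<rceil>} = {x, y} \<and> \<lfloor>z\<rfloor> \<noteq> \<lceil>z\<rceil>"
  proof cases
    case 1
    then have "z = of_int x + t" using z by simp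
    then have "\<lfloor>z\<rfloor> = x" "\<lceil>z\<rceil> = x + 1" using assms(1,2) by linarith+
    then show ?thesis using 1 by simp
  next
    case 2
    then have "z = of_int x - t" using z by simp
    then have "\<lfloor>z\<rfloor> = x - 1" "\<lceil>z\<rceil> = x" using assms(1,2) by linarith+
    then show ?thesis using 2 by (simp add: insert_commute)
  qed
  then show "{\<lfloor>z\<rfloor>, \<lceil>z\<rceil>} = {x, y}" "z \<notin> \<int>"
    by (auto elim!: Ints_cases)
qed

text \<open>Floor and ceiling of the coordinates recover the two ends of a unit segment from any of
  its points that is not a lattice point. So different segments can meet only in lattice
  points.\<close>

lemma unit_segment:
  fixes x y x' y' :: int
  assumes "z \<in> closed_segment (Complex x y) (Complex x' y')"
    and "(\<bar>x - x'\<bar> = 1 \<and> y = y') \<or> (\<bar>y - y'\<bar> = 1 \<and> x = x')"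
  shows "Re z \<in> \<int> \<and> Im z \<in> \<int> \<Longrightarrow> z = Complex x y \<or> z = Complex x' y'"
    and "\<not> (Re z \<in> \<int> \<and> Im z \<in> \<int>) \<Longrightarrow>
      {Complex x y, Complex x' y'} = {Complex \<lfloor>Re z\<rfloor> \<lfloor>Im z\<rfloor>, Complex \<lceil>Re z\<rceil> \<lceil>Im z\<rceil>}"
proof -
  obtain t :: real where t: "0 \<le> t" "t \<le> 1"
    "Re z = of_int x + t * (of_int x' - of_int x)" "Im z = of_int y + t * (of_int y' - of_int y)"
    using assms(1) by (rule Complex_segment)
  have ends: "z = Complex x y \<and> Re z \<in> \<int> \<and> Im z \<in> \<int>" if "t = 0"
    using t that by (simp add: complex_eq_iff)
  have ends': "z = Complex x' y' \<and> Re z \<in> \<int> \<and> Im z \<in> \<int>" if "t = 1"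
    using t that by (simp add: complex_eq_iff)
  have inner: "{Complex x y, Complex x' y'} = {Complex \<lfloor>Re z\<rfloor> \<lfloor>Im z\<rfloor>, Complex \<lceil>Re z\<rceil> \<lceil>Im z\<rceil>} \<and>
      \<not> (Re z \<in> \<int> \<and> Im z \<in> \<int>)" if "0 < t" "t < 1"
    using assms(2)
  proof
    assume h: "\<bar>x - x'\<bar> = 1 \<and> y = y'"
    then have "Im z = y" using t by simp
    moreover have "{\<lfloor>Re z\<rfloor>, \<lceil>Re z\<rceil>} = {x, x'}" "Re z \<notin> \<int>"
      using floor_between[OF that _ t(3)] h by simp_all
    ultimately show ?thesis using h by (auto simp: doubleton_eq_iff)
  next
    assume h: "\<bar>y - y'\<bar> = 1 \<and> x = x'"
    then have "Re z = x" using t by simp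
    moreover have "{\<lfloor>Im z\<rfloor>, \<lceil>Im z\<rceil>} = {y, y'}" "Im z \<notin> \<int>"
      using floor_between[OF that _ t(4)] h by simp_all
    ultimately show ?thesis using h by (auto simp: doubleton_eq_iff)
  qed
  have cases: "t = 0 \<or> t = 1 \<or> (0 < t \<and> t < 1)" using t(1,2) by linarith
  show "Re z \<in> \<int> \<and> Im z \<in> \<int> \<Longrightarrow> z = Complex x y \<or> z = Complex x' y'"
    using cases ends ends' inner by blast
  show "\<not> (Re z \<in> \<int> \<and> Im z \<in> \<int>) \<Longrightarrow>
      {Complex x y, Complex x' y'} = {Complex \<lfloor>Re z\<rfloor> \<lfloor>Im z\<rfloor>, Complex \<lceil>Re z\<rceil> \<lceil>Im z\<rceil>}"
    using cases ends ends' inner by blast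
qed

text \<open>The straight drawing works: an inner point of an edge determines the edge, and the only
  lattice points on an edge are its ends.\<close>

lemma planar_grid:
  assumes graph: "simple_graph V E"
    and inj: "inj_on (\<lambda>u. (X u, Y u)) V"
    and adj: "\<And>u v. {u, v} \<in> E \<Longrightarrow> grid_adjacent D X Y u v"
  shows "planar V E"
proof -
  define pos where "pos u = Complex (X u) (Y u)" for u
  have inj_pos: "inj_on pos V"
    using inj unfolding inj_on_def pos_def by simp
  have lattice: "Re (pos u) \<in> \<int>" "Im (pos u) \<in> \<int>" for u by (simp_all add: pos_def)
  have "\<exists>u v. e = {u, v} \<and> u \<noteq> v \<and> u \<in> V \<and> v \<in> V" if "e \<in> E" for e
    using graph that unfolding simple_graph_def by (metis card_2_iff insert_subset)
  then obtain a b where ab: "\<And>e. e \<in> E \<Longrightarrow> e = {a e, b e} \<and> a e \<noteq> b e \<and> a e \<in> V \<and> b e \<in> V"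
    by metis
  define \<gamma> where "\<gamma> e = linepath (pos (a e)) (pos (b e))" for e
  have img: "path_image (\<gamma> e) = closed_segment (pos (a e)) (pos (b e))" for e
    by (simp add: \<gamma>_def)
  have pos_e: "pos ` e = {pos (a e), pos (b e)}" if "e \<in> E" for e
    using ab[OF that] by (metis image_empty image_insert)
  have unit: "(\<bar>X (a e) - X (b e)\<bar> = 1 \<and> Y (a e) = Y (b e)) \<or> (\<bar>Y (a e) - Y (b e)\<bar> = 1 \<and> X (a e) = X (b e))"
    if "e \<in> E" for e
    using adj[of "a e" "b e"] ab[OF that] that unfolding grid_adjacent_def by metis
  have seg1: "z \<in> pos ` e" if "e \<in> E" "z \<in> path_image (\<gamma> e)" "Re z \<in> \<int>" "Im z \<in> \<int>" for e z
    using unit_segment(1)[OF _ unit[OF that(1)]] that pos_e[OF that(1)] unfolding img pos_def by blast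
  have seg2: "pos ` e = {Complex \<lfloor>Re z\<rfloor> \<lfloor>Im z\<rfloor>, Complex \<lceil>Re z\<rceil> \<lceil>Im z\<rceil>}"
    if "e \<in> E" "z \<in> path_image (\<gamma> e)" "\<not> (Re z \<in> \<int> \<and> Im z \<in> \<int>)" for e z
    using unit_segment(2)[OF _ unit[OF that(1)]] that pos_e[OF that(1)] unfolding img pos_def by blast
  have e_V: "e \<subseteq> V" if "e \<in> E" for e using graph that by (simp add: simple_graph_def)
  have "arc (\<gamma> e) \<and> {pathstart (\<gamma> e), pathfinish (\<gamma> e)} = pos ` e \<and> path_image (\<gamma> e) \<inter> pos ` V = pos ` e"
    if e: "e \<in> E" for e
  proof (intro conjI)
    have "pos (a e) \<noteq> pos (b e)" using ab[OF e] inj_pos by (metis inj_onD)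
    then show "arc (\<gamma> e)" unfolding \<gamma>_def by (rule arc_linepath)
    show "{pathstart (\<gamma> e), pathfinish (\<gamma> e)} = pos ` e"
      using pos_e[OF e] by (simp add: \<gamma>_def)
    have "pos ` e \<subseteq> path_image (\<gamma> e)" using pos_e[OF e] unfolding img by simp
    then show "path_image (\<gamma> e) \<inter> pos ` V = pos ` e"
      using seg1[OF e] lattice e_V[OF e] by blast
  qed
  moreover have "path_image (\<gamma> e) \<inter> path_image (\<gamma> f) \<subseteq> pos ` (e \<inter> f)"
    if "e \<in> E" "f \<in> E" "e \<noteq> f" for e f
  proof
    fix z assume z: "z \<in> path_image (\<gamma> e) \<inter> path_image (\<gamma> f)"
    have "Re z \<in> \<int> \<and> Im z \<in> \<int>"
    proof (rule ccontr)
      assume "\<not> (Re z \<in> \<int> \<and> Im z \<in> \<int>)"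
      then have "pos ` e = pos ` f" using z seg2 that by (metis IntD1 IntD2)
      then show False
        using inj_on_image_eq_iff[OF inj_pos] e_V that by metis
    qed
    then have "z \<in> pos ` e \<inter> pos ` f" using z seg1 that by blast
    then show "z \<in> pos ` (e \<inter> f)"
      using inj_on_image_Int[OF inj_pos] e_V that by metis
  qed
  ultimately show ?thesis
    unfolding planar_def using inj_pos by blast
qed

text \<open>The lexicographically largest vertex of a cycle has its neighbours on the left and below, so
  it lies on lines of both directions.\<close>

lemma cycle_corner:
  assumes cyc: "is_cycle E vs"
    and inj: "inj_on (\<lambda>u. (X u, Y u)) (set vs)"
    and adj: "\<And>u v. {u, v} \<in> E \<Longrightarrow> grid_adjacent D X Y u v"
  obtains u v where "u \<in> set vs" "v \<in> set vs" "\<forall>w\<in>set vs. X w \<le> X u" "D dvd X u" "X v < X u"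
proof -
  let ?n = "length vs"
  have n: "3 \<le> ?n" and dist: "distinct vs"
    and edge: "\<And>i. i < ?n \<Longrightarrow> {vs ! i, vs ! (Suc i mod ?n)} \<in> E"
    using cyc by (auto simp: is_cycle_def)
  have ne: "set vs \<noteq> {}" using n by auto
  have max: "\<exists>u\<in>S. \<forall>w\<in>S. f w \<le> f u" if "finite S" "S \<noteq> {}" for S :: "'a set" and f :: "'a \<Rightarrow> int"
  proof -
    have "Max (f ` S) \<in> f ` S" using that by (intro Max_in) auto
    then obtain u where "u \<in> S" "Max (f ` S) = f u" by blast
    then show ?thesis using that by (metis Max_ge finite_imageI imageI)
  qed
  obtain u0 where u0: "u0 \<in> set vs" "\<forall>w\<in>set vs. X w \<le> X u0"
    using max[OF finite_set ne, of X] by blast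
  define S where "S = {w \<in> set vs. X w = X u0}"
  have "finite S" "S \<noteq> {}" using u0 by (auto simp: S_def)
  then obtain u where u: "u \<in> S" "\<forall>w\<in>S. Y w \<le> Y u"
    using max[of S Y] by blast
  have u_vs: "u \<in> set vs" and Xu: "\<forall>w\<in>set vs. X w \<le> X u"
    and Yu: "\<And>w. w \<in> set vs \<Longrightarrow> X w = X u \<Longrightarrow> Y w \<le> Y u"
    using u u0 by (auto simp: S_def)
  obtain i where i: "i < ?n" "vs ! i = u" using u_vs by (metis in_set_conv_nth)
  define j where "j = (if i = 0 then ?n - 1 else i - 1)"
  define k where "k = Suc i mod ?n"
  have j: "j < ?n" "Suc j mod ?n = i" using i n by (auto simp: j_def)
  have k: "k < ?n" unfolding k_def by (rule mod_less_divisor) (use n in linarith)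
  have "j \<noteq> k"
  proof (cases "Suc i = ?n")
    case True
    then show ?thesis using n by (auto simp: j_def k_def)
  next
    case False
    then show ?thesis using i n by (auto simp: j_def k_def)
  qed
  then have neq: "vs ! j \<noteq> vs ! k" using dist j k by (simp add: nth_eq_iff_index_eq)
  have mem: "vs ! j \<in> set vs" "vs ! k \<in> set vs" using j k by simp_all
  have adj_u: "grid_adjacent D X Y u (vs ! j)" "grid_adjacent D X Y u (vs ! k)"
    using adj[of u "vs ! j"] adj[of u "vs ! k"] edge[OF j(1)] edge[OF i(1)] i j
    by (simp_all add: k_def insert_commute)
  have opts: "(X w = X u - 1 \<and> Y w = Y u \<and> D dvd Y u) \<or> (X w = X u \<and> Y w = Y u - 1 \<and> D dvd X u)"
    if "w \<in> set vs" "grid_adjacent D X Y u w" for w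
  proof -
    have "X w \<le> X u" "X w = X u \<Longrightarrow> Y w \<le> Y u" using that(1) Xu Yu by auto
    then show ?thesis using that(2) unfolding grid_adjacent_def by (auto simp: abs_if split: if_splits)
  qed
  note nbs = opts[OF mem(1) adj_u(1)] opts[OF mem(2) adj_u(2)]
  have "(X (vs ! j), Y (vs ! j)) \<noteq> (X (vs ! k), Y (vs ! k))"
    using inj_onD[OF inj _ mem] neq by blast
  then have "D dvd X u \<and> (X (vs ! j) < X u \<or> X (vs ! k) < X u)"
    using nbs by auto
  then show thesis
    using that u_vs Xu mem by blast
qed

text \<open>The corner lemma is applied to the cycle and to its reflection in the origin. The
  largest and the smallest abscissa are both multiples of \<open>D\<close> and they differ, hence by
  at least \<open>D\<close>, while each edge changes the abscissa by at most 1.\<close>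

lemma girth_grid:
  assumes graph: "simple_graph V E"
    and inj: "inj_on (\<lambda>u. (X u, Y u)) V"
    and adj: "\<And>u v. {u, v} \<in> E \<Longrightarrow> grid_adjacent (int D) X Y u v"
  shows "enat D \<le> girth E"
  unfolding girth_def
proof (rule INF_greatest)
  fix vs assume "vs \<in> {vs. is_cycle E vs}"
  then have cyc: "is_cycle E vs" by simp
  let ?n = "length vs"
  have edge: "{vs ! i, vs ! (Suc i mod ?n)} \<in> E" if "i < ?n" for i
    using cyc that by (auto simp: is_cycle_def)
  have "set vs \<subseteq> V"
  proof
    fix u assume "u \<in> set vs"
    then obtain i where "i < ?n" "u = vs ! i" by (auto simp: in_set_conv_nth)
    then have "u \<in> {vs ! i, vs ! (Suc i mod ?n)}" by simp
    then show "u \<in> V" using edge[OF \<open>i < ?n\<close>] graph unfolding simple_graph_def by blast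
  qed
  then have inj': "inj_on (\<lambda>u. (X u, Y u)) (set vs)" "inj_on (\<lambda>u. (- X u, - Y u)) (set vs)"
    using inj by (auto simp: inj_on_def)
  have adj': "grid_adjacent (int D) (\<lambda>u. - X u) (\<lambda>u. - Y u) u v" if "{u, v} \<in> E" for u v
    using adj[OF that] unfolding grid_adjacent_def by (simp add: abs_minus_commute)
  obtain u v where u: "u \<in> set vs" "v \<in> set vs" "\<forall>w\<in>set vs. X w \<le> X u" "int D dvd X u" "X v < X u"
    by (rule cycle_corner[OF cyc inj'(1) adj])
  obtain u' where u': "u' \<in> set vs" "\<forall>w\<in>set vs. - X w \<le> - X u'" "int D dvd - X u'"
    by (rule cycle_corner[OF cyc inj'(2) adj']) blast
  have "int D dvd X u - X u'" using u(4) u'(3) by (simp add: dvd_diff)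
  moreover have "0 < X u - X u'" using u(2,5) u'(2) by fastforce
  ultimately have "int D \<le> X u - X u'" by (rule zdvd_imp_le)
  moreover have "X (vs ! i) - X (vs ! j) \<le> int ?n" if "i < ?n" "j < ?n" for i j
  proof -
    have step: "\<bar>X (vs ! i) - X (vs ! Suc i)\<bar> \<le> 1" if "Suc i < ?n" for i
      using adj[OF edge[of i]] that unfolding grid_adjacent_def by auto
    have "\<bar>X (vs ! i) - X (vs ! (i + d))\<bar> \<le> int d" if "i + d < ?n" for i d
      using that
    proof (induction d)
      case (Suc d)
      then show ?case using step[of "i + d"] by (simp add: abs_le_iff)
    qed simp
    from this[of i "j - i"] this[of j "i - j"] show ?thesis
      using that by (cases "i \<le> j") auto
  qed
  ultimately show "enat D \<le> enat ?n"
    using u(1) u'(1) unfolding in_set_conv_nth by fastforce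
qed

section \<open>Coarse grid patterns\<close>

text \<open>Code \<open>m\<close> stands for the set of the colours \<open>1, 2, 3\<close> except \<open>m\<close>.\<close>

definition colours :: "nat \<Rightarrow> nat set" where
  "colours m = {1, 2, 3} - {m}"

text \<open>An edge of the coarse grid that is labelled \<open>m > 0\<close> becomes a path of odd length \<open>D\<close>, all of
  whose inner vertices have the list \<open>colours m\<close>, so the colours of the inner vertices alternate.
  The colour of an end vertex propagates iff it lies in \<open>colours m\<close>.\<close>

definition clash :: "nat \<Rightarrow> nat \<Rightarrow> nat \<Rightarrow> bool" where
  "clash m c d \<longleftrightarrow> m \<noteq> 0 \<and> c = d \<and> c \<noteq> m"

lemma two_colours:
  assumes "x \<in> colours m" "y \<in> colours m" "z \<in> colours m" "m \<in> {1, 2, 3}" "x \<noteq> y" "y \<noteq> z"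
  shows "x = z"
  using assms unfolding colours_def by auto

text \<open>If both ends had the same colour from the list, alternation would give this colour to
  all even positions. The last one, \<open>D - 1\<close>, is adjacent to the far end.\<close>

lemma path_clash:
  assumes m: "m \<in> {1, 2, 3}" and "odd D"
    and neq: "\<And>k. k < D \<Longrightarrow> f k \<noteq> f (Suc k)"
    and inner: "\<And>k. 0 < k \<Longrightarrow> k < D \<Longrightarrow> f k \<in> colours m"
    and f0: "f 0 \<in> {1, 2, 3}"
  shows "\<not> clash m (f 0) (f D)"
proof
  assume cl: "clash m (f 0) (f D)"
  then have f0m: "f 0 \<in> colours m" using f0 by (auto simp: clash_def colours_def)
  have even: "2 * k < D \<Longrightarrow> f (2 * k) = f 0" for k
  proof (induction k)
    case (Suc k)
    have "f (2 * k) \<in> colours m" "f (Suc (2 * k)) \<in> colours m" "f (Suc (Suc (2 * k))) \<in> colours m"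
      using inner f0m Suc by auto
    moreover have "f (2 * k) \<noteq> f (Suc (2 * k))" "f (Suc (2 * k)) \<noteq> f (Suc (Suc (2 * k)))"
      using neq Suc.prems by auto
    ultimately have "f (2 * k) = f (Suc (Suc (2 * k)))" using two_colours m by metis
    then show ?case using Suc by simp
  qed simp
  obtain k where "D = Suc (2 * k)" using \<open>odd D\<close> by (metis oddE Suc_eq_plus1)
  then have "f (2 * k) = f 0" "f (2 * k) \<noteq> f D" using even[of k] neq[of "2 * k"] by auto
  then show False using cl by (simp add: clash_def)
qed

text \<open>The remaining colour, since \<open>1 + 2 + 3 = 6\<close>.\<close>

definition third :: "nat \<Rightarrow> nat \<Rightarrow> nat" where
  "third m c = 6 - m - c"

text \<open>The colour at even positions. It continues \<open>c\<close> if \<open>c\<close> is in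
  the list. Otherwise it only has to differ from \<open>d\<close>, because position
  \<open>D - 1\<close> next to the far end is even; if \<open>d\<close> is not in the list either,
  any colour of the list will do.\<close>

definition path_base :: "nat \<Rightarrow> nat \<Rightarrow> nat \<Rightarrow> nat" where
  "path_base m c d = (if c \<noteq> m then c else if d \<noteq> m then third m d else if m = 1 then 2 else 1)"

definition path_colour :: "nat \<Rightarrow> nat \<Rightarrow> nat \<Rightarrow> nat \<Rightarrow> nat" where
  "path_colour m c d k = (if even k then path_base m c d else third m (path_base m c d))"

lemma path_colour:
  assumes "m \<in> {1, 2, 3}" "c \<in> {1, 2, 3}" "d \<in> {1, 2, 3}" "\<not> clash m c d"
  shows "path_colour m c d k \<in> colours m" "path_colour m c d k \<noteq> path_colour m c d (Suc k)"
    "c \<noteq> path_colour m c d 1" "even k \<Longrightarrow> path_colour m c d k \<noteq> d"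
proof -
  let ?b = "path_base m c d"
  have "?b \<in> {1, 2, 3} \<and> ?b \<noteq> m \<and> ?b \<noteq> d \<and> (c = m \<or> c = ?b)"
    using assms unfolding path_base_def third_def clash_def
    by (elim insertE emptyE) simp_all
  moreover have "third m b \<in> {1, 2, 3} \<and> third m b \<noteq> m \<and> third m b \<noteq> b"
    if "b \<in> {1, 2, 3}" "b \<noteq> m" for b
    using assms(1) that unfolding third_def by (elim insertE emptyE) simp_all
  ultimately have b: "?b \<in> {1, 2, 3}" "?b \<noteq> m" "?b \<noteq> d" "c = m \<or> c = ?b"
    "third m ?b \<in> {1, 2, 3}" "third m ?b \<noteq> m" "third m ?b \<noteq> ?b"
    by blast+
  show "path_colour m c d k \<in> colours m" using b by (simp add: path_colour_def colours_def)
  show "path_colour m c d k \<noteq> path_colour m c d (Suc k)" using b(7) by (simp add: path_colour_def)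
  show "c \<noteq> path_colour m c d 1" using b by (auto simp: path_colour_def)
  show "path_colour m c d k \<noteq> d" if "even k" using b that by (simp add: path_colour_def)
qed

section \<open>From a labelled coarse grid to a graph on the fine grid\<close>

locale grid_pattern =
  fixes W H D :: nat and R U L :: "nat \<Rightarrow> nat \<Rightarrow> nat"
  assumes D: "odd D" "3 \<le> D"
    and R: "\<And>a b. R a b \<noteq> 0 \<Longrightarrow> Suc a < W"
    and U: "\<And>a b. U a b \<noteq> 0 \<Longrightarrow> Suc b < H"
    and codes: "\<And>a b. R a b \<le> 3" "\<And>a b. U a b \<le> 3" "\<And>a b. L a b \<le> 3"
begin

text \<open>At the right and upper border the labels are 0, so the values of \<open>C\<close>
  outside the rectangle do not matter.\<close>

definition pattern_colouring :: "(nat \<Rightarrow> nat \<Rightarrow> nat) \<Rightarrow> bool" where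
  "pattern_colouring C \<longleftrightarrow> (\<forall>a<W. \<forall>b<H. C a b \<in> colours (L a b) \<and>
     \<not> clash (R a b) (C a b) (C (Suc a) b) \<and> \<not> clash (U a b) (C a b) (C a (Suc b)))"

abbreviation width :: nat where "width \<equiv> W * D"
abbreviation height :: nat where "height \<equiv> H * D"
abbreviation vertices :: nat where "vertices \<equiv> width * height"

definition point :: "nat \<Rightarrow> nat \<Rightarrow> nat" where
  "point x y = x + width * y"

definition right_edge :: "nat \<Rightarrow> nat \<Rightarrow> bool" where
  "right_edge x y \<longleftrightarrow> y mod D = 0 \<and> R (x div D) (y div D) \<noteq> 0"

definition up_edge :: "nat \<Rightarrow> nat \<Rightarrow> bool" where
  "up_edge x y \<longleftrightarrow> x mod D = 0 \<and> U (x div D) (y div D) \<noteq> 0"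

definition edge_from :: "nat \<Rightarrow> nat \<Rightarrow> bool" where
  "edge_from u v \<longleftrightarrow> u < vertices \<and>
     ((v = u + 1 \<and> right_edge (u mod width) (u div width)) \<or>
      (v = u + width \<and> up_edge (u mod width) (u div width)))"

definition grid_edges :: "nat set set" where
  "grid_edges = {{u, v} | u v. edge_from u v}"

text \<open>The last case concerns isolated points and points of which no edge starts off the
  corners; their code is an arbitrary admissible one. An inner vertex of a stretched edge is always
  the start of its next unit step and gets the label of that edge.\<close>

definition point_code :: "nat \<Rightarrow> nat \<Rightarrow> nat" where
  "point_code x y = (if x mod D = 0 \<and> y mod D = 0 then L (x div D) (y div D)
     else if right_edge x y then R (x div D) (y div D)
     else if up_edge x y then U (x div D) (y div D) else 3)"

definition grid_list :: "nat \<Rightarrow> nat set" where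
  "grid_list u = colours (point_code (u mod width) (u div width))"

lemma point_bounds:
  assumes "x < width" "y < height"
  shows "point x y < vertices" "point x y mod width = x" "point x y div width = y"
proof -
  have "x + width * y < width * Suc y" using assms by simp
  also have "\<dots> \<le> width * height" using assms by (intro mult_le_mono) auto
  finally show "point x y < vertices" by (simp add: point_def)
  have "(x + w * y) mod w = x \<and> (x + w * y) div w = y" if "x < w" for w
    using that by simp
  from this[OF assms(1)] show "point x y mod width = x" "point x y div width = y"
    by (simp_all only: point_def)
qed

lemma point_inverse: "u = point (u mod width) (u div width)"
  by (simp add: point_def)

lemma point_coordinates:
  assumes "u < vertices"
  shows "u mod width < width" "u div width < height"
proof -
  have "0 < width" using assms by (metis gr_zeroI mult_0 not_less_zero)
  then show "u mod width < width" by simp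
  show "u div width < height" using assms by (simp add: less_mult_imp_div_less mult.commute)
qed

lemma right_edge_inside:
  assumes "right_edge x y"
  shows "Suc x < width"
proof -
  have "Suc (x div D) < W" using assms R by (auto simp: right_edge_def)
  moreover have "x < Suc (x div D) * D" using D by (simp add: dividend_less_div_times)
  ultimately show ?thesis
    by (metis Suc_leI mult_le_mono1 le_less_trans less_le_trans mult_less_cancel2 lessI le_eq_less_or_eq D(2) gr0I not_numeral_le_zero)
qed

lemma up_edge_inside:
  assumes "up_edge x y"
  shows "Suc y < height"
proof -
  have "Suc (y div D) < H" using assms U by (auto simp: up_edge_def)
  moreover have "y < Suc (y div D) * D" using D by (simp add: dividend_less_div_times)
  ultimately show ?thesis
    by (metis Suc_leI mult_le_mono1 le_less_trans less_le_trans mult_less_cancel2 lessI le_eq_less_or_eq D(2) gr0I not_numeral_le_zero)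
qed

lemma edge_from_points:
  "edge_from u v \<longleftrightarrow> (\<exists>x<width. \<exists>y<height. u = point x y \<and>
     ((right_edge x y \<and> v = point (Suc x) y) \<or> (up_edge x y \<and> v = point x (Suc y))))"
proof
  assume e: "edge_from u v"
  then have "u < vertices" by (simp add: edge_from_def)
  then show "\<exists>x<width. \<exists>y<height. u = point x y \<and>
     ((right_edge x y \<and> v = point (Suc x) y) \<or> (up_edge x y \<and> v = point x (Suc y)))"
    using e point_coordinates[of u] point_inverse[of u]
    by (intro exI[of _ "u mod width"] exI[of _ "u div width"] conjI)
      (auto simp: edge_from_def point_def)
next
  assume "\<exists>x<width. \<exists>y<height. u = point x y \<and>
     ((right_edge x y \<and> v = point (Suc x) y) \<or> (up_edge x y \<and> v = point x (Suc y)))"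
  then show "edge_from u v"
    using point_bounds by (auto simp: edge_from_def) (auto simp: point_def)
qed

lemma edge_from_coordinates:
  assumes "edge_from u v"
  obtains x y where "x < width" "y < height" "u = point x y"
    "(right_edge x y \<and> Suc x < width \<and> v = point (Suc x) y) \<or>
     (up_edge x y \<and> Suc y < height \<and> v = point x (Suc y))"
  using assms right_edge_inside up_edge_inside unfolding edge_from_points by blast

lemma simple_graph_grid: "simple_graph {..<vertices} grid_edges"
  unfolding simple_graph_def
proof (intro conjI ballI)
  fix e assume "e \<in> grid_edges"
  then obtain u v where e: "e = {u, v}" "edge_from u v" by (auto simp: grid_edges_def)
  from e(2) obtain x y where xy: "x < width" "y < height" "u = point x y"
    "(right_edge x y \<and> Suc x < width \<and> v = point (Suc x) y) \<or>
     (up_edge x y \<and> Suc y < height \<and> v = point x (Suc y))"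
    by (rule edge_from_coordinates)
  then have "u < vertices" "v < vertices" using point_bounds by blast+
  moreover have "u \<noteq> v" using e(2) xy(1) by (auto simp: edge_from_def)
  ultimately show "e \<subseteq> {..<vertices}" "card e = 2" by (auto simp: e)
qed simp

lemma grid_edges_adjacent:
  assumes "{u, v} \<in> grid_edges"
  shows "grid_adjacent (int D) (\<lambda>u. int (u mod width)) (\<lambda>u. int (u div width)) u v"
proof -
  have adj: "grid_adjacent (int D) (\<lambda>u. int (u mod width)) (\<lambda>u. int (u div width)) u v"
    if "edge_from u v" for u v
  proof -
    from that obtain x y where xy: "x < width" "y < height" "u = point x y"
      "(right_edge x y \<and> Suc x < width \<and> v = point (Suc x) y) \<or>
       (up_edge x y \<and> Suc y < height \<and> v = point x (Suc y))"
      by (rule edge_from_coordinates)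
    then show ?thesis
      using point_bounds unfolding grid_adjacent_def right_edge_def up_edge_def by auto
  qed
  have sym: "grid_adjacent E X Y u v \<Longrightarrow> grid_adjacent E X Y v u" for E X Y and u v :: nat
    unfolding grid_adjacent_def by (auto simp: abs_minus_commute)
  obtain u' v' where "{u, v} = {u', v'}" "edge_from u' v'"
    using assms by (auto simp: grid_edges_def)
  then show ?thesis using adj sym by (auto simp: doubleton_eq_iff)
qed

lemma inj_coordinates:
  "inj_on (\<lambda>u. (int (u mod width), int (u div width))) A"
proof (rule inj_onI)
  fix u v assume "(int (u mod width), int (u div width)) = (int (v mod width), int (v div width))"
  then show "u = v" using point_inverse[of u] point_inverse[of v] by simp
qed

lemma planar_grid_edges: "planar {..<vertices} grid_edges"
  by (rule planar_grid[OF simple_graph_grid inj_coordinates grid_edges_adjacent])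

lemma girth_grid_edges: "enat D \<le> girth grid_edges"
  by (rule girth_grid[OF simple_graph_grid inj_coordinates grid_edges_adjacent])

lemma point_code_le: "point_code x y \<le> 3"
  using codes by (simp add: point_code_def)

lemma grid_list_cases: "grid_list u \<in> {{1, 2}, {1, 3}, {2, 3}, {1, 2, 3}}"
proof -
  have "m = 0 \<or> m = 1 \<or> m = 2 \<or> m = 3" if "m \<le> 3" for m :: nat using that by linarith
  from this[OF point_code_le, of "u mod width" "u div width"] show ?thesis
    unfolding grid_list_def by (elim disjE) (auto simp: colours_def)
qed

lemma grid_instance: "list_colouring_instance 3 vertices grid_edges grid_list"
proof -
  have "grid_list u \<subseteq> {1..} \<and> finite (grid_list u) \<and> card (grid_list u) \<le> 3" for u
    using grid_list_cases[of u] by (elim insertE emptyE) (simp_all add: atLeast_def subset_eq)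
  then show ?thesis using simple_graph_grid by (simp add: list_colouring_instance_def)
qed

lemma label_range: "m \<noteq> 0 \<Longrightarrow> m \<le> 3 \<Longrightarrow> m \<in> {1, 2, 3 :: nat}"
  by auto

lemma pattern_colouring_of_colouring:
  assumes "colouring {..<vertices} grid_edges c" "respects_lists {..<vertices} c grid_list"
  shows "pattern_colouring (\<lambda>a b. c (point (a * D) (b * D)))"
proof -
  have D0: "0 < D" using D by simp
  have list: "c (point x y) \<in> colours (point_code x y)" if "x < width" "y < height" for x y
  proof -
    have "c (point x y) \<in> grid_list (point x y)"
      using assms(2) point_bounds(1)[OF that] by (auto simp: respects_lists_def)
    then show ?thesis by (simp only: grid_list_def point_bounds(2,3)[OF that])
  qed
  have edge: "c u \<noteq> c v" if "edge_from u v" for u v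
  proof -
    have "{u, v} \<in> grid_edges" using that unfolding grid_edges_def by blast
    then show ?thesis using assms(1) unfolding colouring_def by blast
  qed
  have small: "a * D + k < w * D" if "a < w" "k < D" for a w k
  proof -
    have "a * D + k < Suc a * D" using that by simp
    also have "\<dots> \<le> w * D" using that by (intro mult_le_mono) auto
    finally show ?thesis .
  qed
  show ?thesis
    unfolding pattern_colouring_def
  proof (intro allI impI conjI)
    fix a b assume ab: "a < W" "b < H"
    let ?c = "\<lambda>a b. c (point (a * D) (b * D))"
    have pt: "a * D < width" "b * D < height" using small[OF ab(1) D0] small[OF ab(2) D0] by simp_all
    have "point_code (a * D) (b * D) = L a b" using D0 by (simp add: point_code_def)
    with list[OF pt] show cL: "?c a b \<in> colours (L a b)" by simp
    show "\<not> clash (R a b) (?c a b) (?c (Suc a) b)"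
    proof (cases "R a b = 0")
      case False
      have R_k: "right_edge (a * D + k) (b * D)" if "k < D" for k
        using False D0 that by (simp add: right_edge_def)
      define f where "f k = c (point (a * D + k) (b * D))" for k
      have "\<not> clash (R a b) (f 0) (f D)"
      proof (rule path_clash)
        show "R a b \<in> {1, 2, 3}" using label_range[OF False codes(1)] .
        show "odd D" by (rule D)
        show "f 0 \<in> {1, 2, 3}" using cL by (simp add: f_def colours_def)
      next
        fix k assume k: "k < D"
        have "edge_from (point (a * D + k) (b * D)) (point (Suc (a * D + k)) (b * D))"
          unfolding edge_from_points using R_k[OF k] small[OF ab(1) k] pt(2) by blast
        then show "f k \<noteq> f (Suc k)" using edge by (simp add: f_def)
      next
        fix k assume k: "0 < k" "k < D"
        have "point_code (a * D + k) (b * D) = R a b"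
          using k R_k[OF k(2)] D0 by (simp add: point_code_def)
        then show "f k \<in> colours (R a b)"
          using list[OF small[OF ab(1) k(2)] pt(2)] by (simp add: f_def)
      qed
      moreover have "f 0 = ?c a b" "f D = ?c (Suc a) b" by (simp_all add: f_def add.commute)
      ultimately show ?thesis by simp
    qed (simp add: clash_def)
    show "\<not> clash (U a b) (?c a b) (?c a (Suc b))"
    proof (cases "U a b = 0")
      case False
      have U_k: "up_edge (a * D) (b * D + k)" if "k < D" for k
        using False D0 that by (simp add: up_edge_def)
      define f where "f k = c (point (a * D) (b * D + k))" for k
      have "\<not> clash (U a b) (f 0) (f D)"
      proof (rule path_clash)
        show "U a b \<in> {1, 2, 3}" using label_range[OF False codes(2)] .
        show "odd D" by (rule D)
        show "f 0 \<in> {1, 2, 3}" using cL by (simp add: f_def colours_def)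
      next
        fix k assume k: "k < D"
        have "edge_from (point (a * D) (b * D + k)) (point (a * D) (Suc (b * D + k)))"
          unfolding edge_from_points using U_k[OF k] small[OF ab(2) k] pt(1) by blast
        then show "f k \<noteq> f (Suc k)" using edge by (simp add: f_def)
      next
        fix k assume k: "0 < k" "k < D"
        have "\<not> right_edge (a * D) (b * D + k)" using k by (simp add: right_edge_def)
        then have "point_code (a * D) (b * D + k) = U a b"
          using k U_k[OF k(2)] D0 by (simp add: point_code_def)
        then show "f k \<in> colours (U a b)"
          using list[OF pt(1) small[OF ab(2) k(2)]] by (simp add: f_def)
      qed
      moreover have "f 0 = ?c a b" "f D = ?c a (Suc b)" by (simp_all add: f_def add.commute)
      ultimately show ?thesis by simp
    qed (simp add: clash_def)
  qed
qed

definition point_colour :: "(nat \<Rightarrow> nat \<Rightarrow> nat) \<Rightarrow> nat \<Rightarrow> nat \<Rightarrow> nat" where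
  "point_colour C x y = (let a = x div D; b = y div D; r = x mod D; s = y mod D in
     if r = 0 \<and> s = 0 then C a b
     else if right_edge x y then path_colour (R a b) (C a b) (C (Suc a) b) r
     else if up_edge x y then path_colour (U a b) (C a b) (C a (Suc b)) s else 1)"

lemma colouring_of_pattern_colouring:
  assumes "pattern_colouring C"
  shows "\<exists>c. colouring {..<vertices} grid_edges c \<and> respects_lists {..<vertices} c grid_list"
proof -
  have D0: "0 < D" using D by simp
  have C: "C a b \<in> colours (L a b)" "C a b \<in> {1, 2, 3}"
    "\<not> clash (R a b) (C a b) (C (Suc a) b)" "\<not> clash (U a b) (C a b) (C a (Suc b))"
    if "a < W" "b < H" for a b
    using assms that by (auto simp: pattern_colouring_def colours_def)
  have divs: "x div D < W" "y div D < H" if "x < width" "y < height" for x y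
    using that D0 by (simp_all add: less_mult_imp_div_less)
  have pathR: "R a b \<in> {1, 2, 3}" "C a b \<in> {1, 2, 3}" "C (Suc a) b \<in> {1, 2, 3}"
    "\<not> clash (R a b) (C a b) (C (Suc a) b)" if "R a b \<noteq> 0" "a < W" "b < H" for a b
    using C[OF that(2,3)] C(2)[OF R[OF that(1)] that(3)] label_range[OF that(1) codes(1)] by blast+
  have pathU: "U a b \<in> {1, 2, 3}" "C a b \<in> {1, 2, 3}" "C a (Suc b) \<in> {1, 2, 3}"
    "\<not> clash (U a b) (C a b) (C a (Suc b))" if "U a b \<noteq> 0" "a < W" "b < H" for a b
    using C[OF that(2,3)] C(2)[OF that(2) U[OF that(1)]] label_range[OF that(1) codes(2)] by blast+
  have RR: "path_colour (R a b) (C a b) (C (Suc a) b) k \<in> colours (R a b)"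
    "path_colour (R a b) (C a b) (C (Suc a) b) k \<noteq> path_colour (R a b) (C a b) (C (Suc a) b) (Suc k)"
    "C a b \<noteq> path_colour (R a b) (C a b) (C (Suc a) b) 1"
    "even k \<Longrightarrow> path_colour (R a b) (C a b) (C (Suc a) b) k \<noteq> C (Suc a) b"
    if "R a b \<noteq> 0" "a < W" "b < H" for a b k
    using path_colour[OF pathR[OF that]] by blast+
  have UU: "path_colour (U a b) (C a b) (C a (Suc b)) k \<in> colours (U a b)"
    "path_colour (U a b) (C a b) (C a (Suc b)) k \<noteq> path_colour (U a b) (C a b) (C a (Suc b)) (Suc k)"
    "C a b \<noteq> path_colour (U a b) (C a b) (C a (Suc b)) 1"
    "even k \<Longrightarrow> path_colour (U a b) (C a b) (C a (Suc b)) k \<noteq> C a (Suc b)"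
    if "U a b \<noteq> 0" "a < W" "b < H" for a b k
    using path_colour[OF pathU[OF that]] by blast+
  have list: "point_colour C x y \<in> colours (point_code x y)" if xy: "x < width" "y < height" for x y
  proof -
    note d = divs[OF xy]
    consider "x mod D = 0 \<and> y mod D = 0" | "\<not> (x mod D = 0 \<and> y mod D = 0)" "right_edge x y"
      | "\<not> (x mod D = 0 \<and> y mod D = 0)" "\<not> right_edge x y" "up_edge x y"
      | "\<not> (x mod D = 0 \<and> y mod D = 0)" "\<not> right_edge x y" "\<not> up_edge x y"
      by blast
    then show ?thesis
    proof cases
      case 1
      then show ?thesis using C(1)[OF d] by (simp add: point_colour_def point_code_def Let_def)
    next
      case 2
      then have "R (x div D) (y div D) \<noteq> 0" by (simp add: right_edge_def)
      from RR(1)[OF this d] show ?thesis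
        unfolding point_colour_def point_code_def Let_def if_not_P[OF 2(1)] if_P[OF 2(2)] .
    next
      case 3
      then have "U (x div D) (y div D) \<noteq> 0" by (simp add: up_edge_def)
      from UU(1)[OF this d] show ?thesis
        unfolding point_colour_def point_code_def Let_def if_not_P[OF 3(1)] if_not_P[OF 3(2)] if_P[OF 3(3)] .
    next
      case 4
      have "1 \<in> colours 3" by (simp add: colours_def)
      then show ?thesis
        unfolding point_colour_def point_code_def Let_def if_not_P[OF 4(1)] if_not_P[OF 4(2)] if_not_P[OF 4(3)] .
    qed
  qed
  have D1: "even (D - 1)" using D by simp
  have right: "point_colour C x y \<noteq> point_colour C (Suc x) y"
    if e: "right_edge x y" and xy: "x < width" "y < height" for x y
  proof -
    define a b r where "a = x div D" and "b = y div D" and "r = x mod D"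
    note d = divs[OF xy, folded a_def b_def]
    have y: "y mod D = 0" and Rab: "R a b \<noteq> 0" using e by (auto simp: right_edge_def a_def b_def)
    have left: "point_colour C x y = (if r = 0 then C a b else path_colour (R a b) (C a b) (C (Suc a) b) r)"
      using e y by (simp add: point_colour_def Let_def a_def b_def r_def)
    have "r < D" using D0 by (simp add: r_def)
    show ?thesis
    proof (cases "Suc r = D")
      case True
      then have "Suc x mod D = 0" "Suc x div D = Suc a"
        by (simp_all add: r_def a_def mod_Suc div_Suc)
      then have "point_colour C (Suc x) y = C (Suc a) b"
        using y by (simp add: point_colour_def Let_def b_def)
      moreover have "even r" "r \<noteq> 0" using True D D1 by auto
      ultimately show ?thesis using left RR(4)[OF Rab d] by simp
    next
      case False
      then have s: "Suc x mod D = Suc r" "Suc x div D = a"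
        by (simp_all add: r_def a_def mod_Suc div_Suc)
      then have "right_edge (Suc x) y" using y Rab by (simp add: right_edge_def b_def)
      then have "point_colour C (Suc x) y = path_colour (R a b) (C a b) (C (Suc a) b) (Suc r)"
        using s by (simp add: point_colour_def Let_def b_def)
      then show ?thesis using left RR(2,3)[OF Rab d] by simp
    qed
  qed
  have up: "point_colour C x y \<noteq> point_colour C x (Suc y)"
    if e: "up_edge x y" and xy: "x < width" "y < height" for x y
  proof -
    define a b s where "a = x div D" and "b = y div D" and "s = y mod D"
    note d = divs[OF xy, folded a_def b_def]
    have x: "x mod D = 0" and Uab: "U a b \<noteq> 0" using e by (auto simp: up_edge_def a_def b_def)
    have left: "point_colour C x y = (if s = 0 then C a b else path_colour (U a b) (C a b) (C a (Suc b)) s)"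
      using e x by (simp add: point_colour_def Let_def a_def b_def s_def right_edge_def)
    have "s < D" using D0 by (simp add: s_def)
    show ?thesis
    proof (cases "Suc s = D")
      case True
      then have "Suc y mod D = 0" "Suc y div D = Suc b"
        by (simp_all add: s_def b_def mod_Suc div_Suc)
      then have "point_colour C x (Suc y) = C a (Suc b)"
        using x by (simp add: point_colour_def Let_def a_def)
      moreover have "even s" "s \<noteq> 0" using True D D1 by auto
      ultimately show ?thesis using left UU(4)[OF Uab d] by simp
    next
      case False
      then have y: "Suc y mod D = Suc s" "Suc y div D = b"
        by (simp_all add: s_def b_def mod_Suc div_Suc)
      then have "up_edge x (Suc y)" "\<not> right_edge x (Suc y)" using x Uab by (simp_all add: up_edge_def right_edge_def a_def)
      then have "point_colour C x (Suc y) = path_colour (U a b) (C a b) (C a (Suc b)) (Suc s)"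
        using y by (simp add: point_colour_def Let_def a_def)
      then show ?thesis using left UU(2,3)[OF Uab d] by simp
    qed
  qed
  define c where "c u = point_colour C (u mod width) (u div width)" for u
  have c: "c (point x y) = point_colour C x y" if "x < width" "y < height" for x y
    using point_bounds[OF that] by (simp add: c_def)
  have ne: "c u \<noteq> c v" if "edge_from u v" for u v
  proof -
    from that obtain x y where xy: "x < width" "y < height" "u = point x y"
      "(right_edge x y \<and> Suc x < width \<and> v = point (Suc x) y) \<or>
       (up_edge x y \<and> Suc y < height \<and> v = point x (Suc y))"
      by (rule edge_from_coordinates)
    then show ?thesis using c right up by auto
  qed
  have cl: "c u \<in> grid_list u" if "u < vertices" for u
    using list[OF point_coordinates[OF that]] by (simp add: c_def grid_list_def)
  have "1 \<le> c u" if "u < vertices" for u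
    using cl[OF that] grid_list_cases[of u] by auto
  moreover have "c u \<noteq> c v" if "{u, v} \<in> grid_edges" for u v
  proof -
    obtain u' v' where e: "{u, v} = {u', v'}" "edge_from u' v'"
      using \<open>{u, v} \<in> grid_edges\<close> unfolding grid_edges_def mem_Collect_eq by metis
    from e(1) consider "u = u'" "v = v'" | "u = v'" "v = u'" by (auto simp: doubleton_eq_iff)
    then show ?thesis using ne[OF e(2)] by cases auto
  qed
  ultimately show ?thesis
    using cl by (intro exI[of _ c]) (auto simp: colouring_def respects_lists_def)
qed

text \<open>Membership in the language only provides some colourable instance with the same code, so
  injectivity of the encoding is what leads back to this graph.\<close>

theorem grid_colourable_iff:
  "encode_instance vertices grid_edges grid_list \<in> three_list_colouring \<longleftrightarrow> (\<exists>C. pattern_colouring C)"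
proof
  assume "encode_instance vertices grid_edges grid_list \<in> three_list_colouring"
  then obtain n E L' c where eq: "encode_instance vertices grid_edges grid_list = encode_instance n E L'"
    and inst: "list_colouring_instance 3 n E L'"
    and c: "colouring {..<n} E c" "respects_lists {..<n} c L'"
    by (auto simp: three_list_colouring_def)
  have "vertices = n \<and> grid_edges = E \<and> (\<forall>u<vertices. grid_list u = L' u)"
    by (rule encode_instance_inject[OF grid_instance inst eq])
  then have "colouring {..<vertices} grid_edges c" "respects_lists {..<vertices} c grid_list"
    using c by (auto simp: respects_lists_def)
  then show "\<exists>C. pattern_colouring C" using pattern_colouring_of_colouring by blast
next
  assume "\<exists>C. pattern_colouring C"
  then show "encode_instance vertices grid_edges grid_list \<in> three_list_colouring"
    using colouring_of_pattern_colouring grid_instance unfolding three_list_colouring_def by blast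
qed

theorem grid_planar_girth:
  "encode_instance vertices grid_edges grid_list \<in> planar_girth_instances D"
  unfolding planar_girth_instances_def
  using grid_instance planar_grid_edges girth_grid_edges grid_list_cases by blast

end

section \<open>Tiles\<close>

text \<open>A tile is a block of \<open>10 \<times> 11\<close> vertices \<open>(a, b)\<close> of the coarse grid. Entry \<open>! b ! a\<close> of a table is
  the code of the list of \<open>(a, b)\<close>, or of the label of the edge to its right or upper neighbour,
  where \<open>0\<close> means no edge. The variable enters at \<open>(0, 3)\<close>, with colour \<open>1\<close> (true) or \<open>2\<close>, and leaves on the
  right; the signal of the clause enters at \<open>(2, 9)\<close> and leaves at \<open>(2, 0)\<close>, with colour \<open>1\<close> (true) or \<open>3\<close>.
  They cross in the rows \<open>1, \<dots>, 5\<close>. The colour of \<open>(2, 8)\<close> gives a reason for the clause: \<open>3\<close>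
  forces the incoming signal to be true, \<open>1\<close> the outgoing one to be false, and \<open>2\<close> forces
  \<open>(1, 8)\<close> to be \<open>1\<close> if they are linked, so that the edge from \<open>(0, 8)\<close> makes the variable true, and
  the path through \<open>(1, 7)\<close>, \<open>(1, 6)\<close> and \<open>(0, 6)\<close> makes it false. The type of a tile selects the
  list of \<open>(2, 8)\<close> and these links: \<open>0\<close> for a variable that does not occur in the clause, \<open>1\<close> for a
  positive, \<open>2\<close> for a negative and \<open>3\<close> for both occurrences; \<open>4\<close> and \<open>5\<close> have contradictory links,
  hence \<open>2\<close> is excluded, and start the signal as false and require it to be true.\<close>

definition tile_list :: "nat \<Rightarrow> nat \<Rightarrow> nat \<Rightarrow> nat" where
  "tile_list ty a b = (if a = 2 \<and> b = 8 then [2, 0, 0, 0, 3, 1] ! ty else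
    [[3, 3, 2, 2, 2, 2, 2, 2, 3, 3],
     [3, 3, 0, 3, 3, 3, 3, 0, 3, 3],
     [3, 3, 2, 1, 3, 3, 3, 2, 1, 3],
     [3, 1, 2, 3, 3, 3, 1, 2, 3, 3],
     [3, 3, 2, 3, 3, 3, 3, 2, 3, 3],
     [3, 3, 0, 3, 3, 3, 3, 0, 3, 3],
     [3, 1, 2, 2, 2, 2, 2, 2, 3, 3],
     [3, 2, 2, 3, 3, 3, 3, 3, 3, 3],
     [3, 3, 2, 3, 3, 3, 3, 3, 3, 3],
     [3, 3, 2, 3, 3, 3, 3, 3, 3, 3],
     [3, 3, 2, 3, 3, 3, 3, 3, 3, 3]] ! b ! a)"

definition tile_right :: "nat \<Rightarrow> nat \<Rightarrow> nat \<Rightarrow> nat" where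
  "tile_right ty a b =
    (if a = 1 \<and> b = 8 then [0, 1, 1, 0, 1, 1] ! ty
     else if a = 0 \<and> b = 8 then [0, 2, 0, 0, 2, 2] ! ty
     else if a = 0 \<and> b = 6 then [0, 0, 1, 0, 1, 1] ! ty else
    [[0, 0, 2, 2, 2, 2, 2, 0, 0, 0],
     [3, 3, 3, 3, 0, 3, 3, 3, 3, 0],
     [0, 3, 2, 0, 0, 0, 3, 2, 0, 0],
     [0, 1, 3, 0, 3, 0, 1, 3, 0, 3],
     [0, 0, 0, 0, 0, 0, 0, 0, 0, 0],
     [3, 3, 3, 3, 0, 3, 3, 3, 3, 0],
     [0, 0, 2, 2, 2, 2, 2, 0, 0, 0],
     [0, 0, 0, 0, 0, 0, 0, 0, 0, 0],
     [0, 0, 0, 0, 0, 0, 0, 0, 0, 0],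
     [0, 0, 0, 0, 0, 0, 0, 0, 0, 0],
     [0, 0, 0, 0, 0, 0, 0, 0, 0, 0]] ! b ! a)"

definition tile_up :: "nat \<Rightarrow> nat \<Rightarrow> nat \<Rightarrow> nat" where
  "tile_up ty a b =
    (if a = 2 \<and> b = 8 then [2, 1, 1, 1, 1, 1] ! ty
     else if a = 2 \<and> b = 7 then [2, 3, 3, 3, 3, 3] ! ty
     else if a = 1 \<and> (b = 6 \<or> b = 7) then [0, 0, 2, 0, 2, 2] ! ty else
    [[0, 0, 2, 0, 0, 0, 0, 2, 0, 0],
     [3, 0, 2, 0, 3, 3, 0, 2, 0, 3],
     [3, 1, 0, 1, 3, 3, 1, 0, 1, 3],
     [3, 0, 2, 0, 3, 3, 0, 2, 0, 3],
     [3, 0, 2, 0, 3, 3, 0, 2, 0, 3],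
     [3, 0, 2, 0, 0, 0, 0, 2, 0, 0],
     [3, 0, 2, 0, 0, 0, 0, 0, 0, 0],
     [3, 0, 2, 0, 0, 0, 0, 0, 0, 0],
     [0, 0, 2, 0, 0, 0, 0, 0, 0, 0],
     [0, 0, 2, 0, 0, 0, 0, 0, 0, 0],
     [0, 0, 2, 0, 0, 0, 0, 0, 0, 0]] ! b ! a)"

text \<open>\<open>su\<close> is the incoming and \<open>sd\<close> the outgoing signal. For an
  occurring variable, the signal leaves as true only if it was true before or a literal holds. It
  may also fall back to false, which is harmless because it has to be true at the end.\<close>

definition tile_relation :: "nat \<Rightarrow> nat \<Rightarrow> nat \<Rightarrow> nat \<Rightarrow> bool" where
  "tile_relation ty x su sd \<longleftrightarrow>
     (if ty = 0 then su = sd else if ty = 4 then sd = 3 else if ty = 5 then su = 1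
      else sd = 3 \<or> su = 1 \<or> ty = 3 \<or> (ty = 1 \<and> x = 1) \<or> (ty = 2 \<and> x = 2))"

text \<open>A colouring with symbols: vertices that always share a colour share a letter. The check
  of a whole tile then reduces to the short list of conditions in \<open>tile_table_ok\<close>.
  Suffixes \<open>L\<close> and \<open>R\<close> refer to the two halves of the crossing.\<close>

definition tile_table ::
    "nat \<Rightarrow> nat \<Rightarrow> nat \<Rightarrow> nat \<Rightarrow> nat \<Rightarrow> nat \<Rightarrow> nat \<Rightarrow> nat \<Rightarrow> nat \<Rightarrow> nat \<Rightarrow> nat \<Rightarrow>
     nat \<Rightarrow> nat \<Rightarrow> nat \<Rightarrow> nat \<Rightarrow> nat \<Rightarrow> nat \<Rightarrow> nat \<Rightarrow> nat \<Rightarrow> nat \<Rightarrow> nat \<Rightarrow> nat \<Rightarrow> nat list list" where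
  "tile_table x y r s p q eL fL dL gL hL kL eR fR dR gR hR kR z w1 w2 w3 =
    [[y, x, s, r, s, r, s, r, y, x],
     [x, y, gL, y, x, y, x, gR, x, y],
     [y, hL, eL, kL, y, x, hR, eR, kR, x],
     [x, kL, eL, hL, x, y, kR, eR, hR, y],
     [y, x, fL, x, y, x, y, fR, y, x],
     [x, y, dL, y, x, y, x, dR, x, y],
     [y, w3, r, s, r, s, r, s, y, x],
     [x, w2, s, y, x, y, x, y, x, y],
     [y, w1, z, x, y, x, y, x, y, x],
     [x, y, q, y, x, y, x, y, x, y],
     [y, x, p, x, y, x, y, x, y, x]]"

text \<open>Edges that leave the tile through column 9 or row 10 are exempt; they are treated when
  tiles are put together.\<close>

definition tile_ok :: "nat \<Rightarrow> (nat \<Rightarrow> nat \<Rightarrow> nat) \<Rightarrow> nat \<Rightarrow> nat \<Rightarrow> bool" where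
  "tile_ok ty c a b \<longleftrightarrow> c a b \<in> colours (tile_list ty a b) \<and>
     (a = 9 \<or> \<not> clash (tile_right ty a b) (c a b) (c (Suc a) b)) \<and>
     (b = 10 \<or> \<not> clash (tile_up ty a b) (c a b) (c a (Suc b)))"

lemma clash_0 [simp]: "\<not> clash 0 x y"
  by (simp add: clash_def)

lemma all_less_11: "(\<forall>b<11::nat. P b) \<longleftrightarrow> P 0 \<and> P 1 \<and> P 2 \<and> P 3 \<and> P 4 \<and> P 5 \<and> P 6 \<and> P 7 \<and> P 8 \<and> P 9 \<and> P 10"
  by (simp add: numeral_eq_Suc All_less_Suc2)

lemma all_less_10: "(\<forall>a<10::nat. P a) \<longleftrightarrow> P 0 \<and> P 1 \<and> P 2 \<and> P 3 \<and> P 4 \<and> P 5 \<and> P 6 \<and> P 7 \<and> P 8 \<and> P 9"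
  by (simp add: numeral_eq_Suc All_less_Suc2)

lemma tile_table_ok:
  assumes
    "dL \<in> colours 0" "dR \<in> colours 0" "eL \<in> colours 2" "eR \<in> colours 2"
    "fL \<in> colours 2" "fR \<in> colours 2" "gL \<in> colours 0" "gR \<in> colours 0"
    "hL \<in> colours 3" "hR \<in> colours 3" "kL \<in> colours 1" "kR \<in> colours 1"
    "p \<in> colours 2" "q \<in> colours 2" "r \<in> colours 2" "s \<in> colours 2"
    "w1 \<in> colours 3" "w2 \<in> colours 2" "w3 \<in> colours 1" "x \<in> colours 3"
    "y \<in> colours 3" "z \<in> colours (tile_list ty 2 8)"
  and
    "\<not> clash (tile_right ty 0 6) y w3" "\<not> clash (tile_right ty 0 8) y w1"
    "\<not> clash (tile_right ty 1 8) w1 z" "\<not> clash (tile_up ty 1 6) w3 w2"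
    "\<not> clash (tile_up ty 1 7) w2 w1" "\<not> clash (tile_up ty 2 7) s z"
    "\<not> clash (tile_up ty 2 8) z q" "\<not> clash 1 hL kL" "\<not> clash 1 hR kR"
    "\<not> clash 1 kL eL" "\<not> clash 1 kL hL" "\<not> clash 1 kR eR" "\<not> clash 1 kR hR"
    "\<not> clash 2 dL r" "\<not> clash 2 dR s" "\<not> clash 2 eL fL" "\<not> clash 2 eL kL"
    "\<not> clash 2 eR fR" "\<not> clash 2 eR kR" "\<not> clash 2 fL dL" "\<not> clash 2 fR dR"
    "\<not> clash 2 gL eL" "\<not> clash 2 gR eR" "\<not> clash 2 q p" "\<not> clash 2 r gR"
    "\<not> clash 2 r s" "\<not> clash 2 s gL" "\<not> clash 2 s r" "\<not> clash 3 dL y"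
    "\<not> clash 3 dR x" "\<not> clash 3 eL hL" "\<not> clash 3 eR hR" "\<not> clash 3 gL y"
    "\<not> clash 3 gR x" "\<not> clash 3 hL eL" "\<not> clash 3 hR eR" "\<not> clash 3 x dR"
    "\<not> clash 3 x gR" "\<not> clash 3 x y" "\<not> clash 3 y dL" "\<not> clash 3 y gL"
    "\<not> clash 3 y x"
  shows "\<forall>a<10. \<forall>b<11. tile_ok ty (\<lambda>a b. tile_table x y r s p q eL fL dL gL hL kL eR fR dR gR hR kR z w1 w2 w3 ! b ! a) a b"
  unfolding all_less_10 all_less_11 tile_ok_def
  using assms by (simp add: tile_table_def tile_list_def tile_right_def tile_up_def)

text \<open>Here \<open>q\<close> is the incoming and \<open>s\<close> the outgoing signal.\<close>

definition tile_colour :: "nat \<Rightarrow> nat \<Rightarrow> nat \<Rightarrow> nat \<Rightarrow> nat \<Rightarrow> nat \<Rightarrow> nat" where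
  "tile_colour ty x q s a b =
    (let y = 3 - x; r = 4 - s; p = 4 - q;
         eL = (if x = 1 then s else 1); dL = (if x = 1 then s else 2); gL = (if x = 1 then r else 2);
         eR = (if x = 1 then 1 else r); dR = (if x = 1 then 2 else r); gR = (if x = 1 then 2 else s);
         fL = 4 - eL; fR = 4 - eR;
         hL = (if eL = 1 then 2 else 1); kL = (if eL = 1 then 3 else 2);
         hR = (if eR = 1 then 2 else 1); kR = (if eR = 1 then 3 else 2);
         z = (if ty = 0 then p else if ty = 4 then 1 else if ty = 5 then 3
              else if q = 1 then 3 else if s = 3 then 1 else 2);
         w1 = (if z = 2 then 1 else 2); w2 = (if z = 2 then 3 else 1); w3 = (if z = 2 then 2 else 3)
     in tile_table x y r s p q eL fL dL gL hL kL eR fR dR gR hR kR z w1 w2 w3 ! b ! a)"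

lemma tile_complete:
  assumes "ty < 6" "x = 1 \<or> x = 2" "q = 1 \<or> q = 3" "s = 1 \<or> s = 3" "tile_relation ty x q s"
  shows "\<forall>a<10. \<forall>b<11. tile_ok ty (tile_colour ty x q s) a b"
proof -
  have "ty = 0 \<or> ty = 1 \<or> ty = 2 \<or> ty = 3 \<or> ty = 4 \<or> ty = 5" using assms(1) by linarith
  then show ?thesis
    unfolding tile_colour_def Let_def
    by (intro tile_table_ok)
      (use assms(2-5) in \<open>elim disjE; simp add: tile_relation_def tile_list_def tile_right_def tile_up_def
        clash_def colours_def\<close>)+
qed

text \<open>The wire colours 1 and 2 add up to 3, the signal colours 1 and 3 to 4. Hence
  \<open>3 - x\<close> and \<open>4 - x\<close> denote the opposite value throughout.\<close>

lemma alternate_wire: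
  assumes "x \<in> colours 3" "y \<in> colours 3" "\<not> clash 3 x y"
  shows "y = 3 - x"
  using assms by (auto simp: colours_def clash_def)

lemma alternate_signal:
  assumes "x \<in> colours 2" "y \<in> colours 2" "\<not> clash 2 x y"
  shows "y = 4 - x"
  using assms by (auto simp: colours_def clash_def)

lemma no_clash_sym: "clash m x y \<longleftrightarrow> clash m y x"
  by (auto simp: clash_def)

section \<open>What a colouring of a tile enforces\<close>

locale tile_colouring =
  fixes ty :: nat and c :: "nat \<Rightarrow> nat \<Rightarrow> nat"
  assumes ty: "ty < 6"
    and lists: "\<And>a b. a < 10 \<Longrightarrow> b < 11 \<Longrightarrow> c a b \<in> colours (tile_list ty a b)"
    and rights: "\<And>a b. a < 9 \<Longrightarrow> b < 11 \<Longrightarrow> \<not> clash (tile_right ty a b) (c a b) (c (Suc a) b)"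
    and ups: "\<And>a b. a < 10 \<Longrightarrow> b < 10 \<Longrightarrow> \<not> clash (tile_up ty a b) (c a b) (c a (Suc b))"
begin

lemma list_in: "tile_list ty a b = m \<Longrightarrow> a < 10 \<Longrightarrow> b < 11 \<Longrightarrow> c a b \<in> colours m"
  using lists by blast

lemma right_label:
  "tile_right ty a b = m \<Longrightarrow> a' = Suc a \<Longrightarrow> a < 9 \<Longrightarrow> b < 11 \<Longrightarrow> \<not> clash m (c a b) (c a' b)"
  using rights by blast

lemma up_label:
  "tile_up ty a b = m \<Longrightarrow> b' = Suc b \<Longrightarrow> a < 10 \<Longrightarrow> b < 10 \<Longrightarrow> \<not> clash m (c a b) (c a b')"
  using ups by blast

text \<open>One half of the crossing. In this half, the horizontal wire of colour \<open>A\<close> is cut into two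
  pieces, linked by the two vertices \<open>d\<close> and \<open>g\<close> that can also take the third colour \<open>3\<close>. These
  cannot both be \<open>3\<close>, so the pieces agree, and for \<open>A = 1\<close> they transmit the vertical signal.\<close>

lemma half:
  assumes k: "k = 0 \<or> k = 5"
  shows "c (k + 4) 3 = c k 3" "c k 3 = 1 \<Longrightarrow> c (k + 2) 6 \<noteq> c (k + 2) 0"
proof -
  define A where "A = c k 3"
  define h where "h = c (k + 4) 3"
  define d where "d = c (k + 2) 5"
  define g where "g = c (k + 2) 1"
  have L: "c (k + a) b \<in> colours 3"
    if "a \<in> {0, 4} \<and> b \<in> {1,2,3,4,5} \<or> a \<in> {1, 3} \<and> b \<in> {1, 5} \<or> (a, b) \<in> {(3,3),(1,2)}" for a b
    by (rule list_in) (use that k in \<open>auto simp: tile_list_def\<close>)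
  have L2: "c (k + 2) b \<in> colours 2" if "b \<in> {0,2,3,4,6}" for b
    by (rule list_in) (use that k in \<open>auto simp: tile_list_def\<close>)
  have L1: "c (k + 3) 2 \<in> colours 1" "c (k + 1) 3 \<in> colours 1"
    by (rule list_in; use k in \<open>auto simp: tile_list_def\<close>)+
  have L0: "d \<in> colours 0" "g \<in> colours 0"
    unfolding d_def g_def by (rule list_in; use k in \<open>auto simp: tile_list_def\<close>)+
  have R3: "\<not> clash 3 (c (k + a) b) (c (k + a') b)"
    if "(a, a') \<in> {(0, 1), (1, 2), (2, 3), (3, 4)} \<and> b \<in> {1, 5} \<or> (a, a', b) \<in> {(1,2,2),(2,3,3)}" for a a' b
    by (rule right_label) (use that k in \<open>auto simp: tile_right_def\<close>)
  have U3: "\<not> clash 3 (c (k + a) b) (c (k + a) b')"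
    if "a \<in> {0, 4}" "(b, b') \<in> {(1,2),(2,3),(3,4),(4,5)}" for a b b'
    by (rule up_label) (use that k in \<open>auto simp: tile_up_def\<close>)
  have U2: "\<not> clash 2 (c (k + 2) b) (c (k + 2) b')" if "(b, b') \<in> {(0,1),(1,2),(3,4),(4,5),(5,6)}" for b b'
    by (rule up_label) (use that k in \<open>auto simp: tile_up_def\<close>)
  have R1: "\<not> clash 1 (c (k + 1) 3) (c (k + 2) 3)" "\<not> clash 2 (c (k + 2) 2) (c (k + 3) 2)"
    by (rule right_label; use k in \<open>auto simp: tile_right_def\<close>)+
  have U1: "\<not> clash 1 (c (k + 1) 2) (c (k + 1) 3)" "\<not> clash 1 (c (k + 3) 2) (c (k + 3) 3)"
    by (rule up_label; use k in \<open>auto simp: tile_up_def\<close>)+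
  have A: "A = 1 \<or> A = 2" and h: "h = 1 \<or> h = 2"
    using L[of 0 3] L[of 4 3] by (auto simp: A_def h_def colours_def)
  have two: "v = x" if "\<not> clash 3 x y" "\<not> clash 3 y v" "x \<in> colours 3" "y \<in> colours 3" "v \<in> colours 3"
    for x y v using that by (auto simp: clash_def colours_def)
  have col: "c (k + a) 5 = c (k + a) 3 \<and> c (k + a) 3 = c (k + a) 1" if a: "a \<in> {0, 4}" for a
    by (rule conjI; rule two, rule U3[OF a], simp, rule U3[OF a], simp; rule L; use a in simp)
  have "c k 5 = A" and h5: "c (k + 4) 5 = h" and "c k 1 = A" and h1: "c (k + 4) 1 = h"
    using col[of 0] col[of 4] by (simp_all add: A_def h_def)
  then have A5: "c (k + 0) 5 = A" and A1: "c (k + 0) 1 = A" by simp_all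
  have link: "v = B \<or> v = 3"
    if "x \<in> colours 3" "y \<in> colours 3" "\<not> clash 3 x y" "\<not> clash 3 y v" "v \<in> colours 0" "x = B" for x y v B
    using that by (auto simp: clash_def colours_def)
  have dA: "d = A \<or> d = 3"
    by (rule link[OF L[of 0 5] L[of 1 5] R3 R3[of 1 2 5, folded d_def] L0(1) A5]) simp_all
  have gA: "g = A \<or> g = 3"
    by (rule link[OF L[of 0 1] L[of 1 1] R3 R3[of 1 2 1, folded g_def] L0(2) A1]) simp_all
  have R3': "\<not> clash 3 (c (k + a') b) (c (k + a) b)"
    if "(a, a') \<in> {(2, 3), (3, 4)} \<and> b \<in> {1, 5}" for a a' b
    using R3[of a a' b] no_clash_sym that by auto
  have dh: "d = h \<or> d = 3"
    by (rule link[OF L[of 4 5] L[of 3 5] R3' R3'[of 2 3 5, folded d_def] L0(1) h5]) simp_all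
  have gh: "g = h \<or> g = 3"
    by (rule link[OF L[of 4 1] L[of 3 1] R3' R3'[of 2 3 1, folded g_def] L0(2) h1]) simp_all
  \<comment> \<open>An equality gadget made of two detours. If \<open>u = 1\<close>, the right one
    forces \<open>q1 = 2\<close>, \<open>q2 = 3\<close> and \<open>v = 1\<close>; if
    \<open>u = 3\<close>, the left one forces \<open>q3 = 2\<close>, \<open>q4 = 1\<close> and
    \<open>v = 3\<close>.\<close>
  have flip_aux: "u = v"
    if "u \<in> colours 2" "v \<in> colours 2" "q1 \<in> colours 3" "q2 \<in> colours 1" "q3 \<in> colours 1" "q4 \<in> colours 3"
      "\<not> clash 3 u q1" "\<not> clash 1 q2 q1" "\<not> clash 2 v q2"
      "\<not> clash 1 q3 u" "\<not> clash 1 q4 q3" "\<not> clash 3 q4 v" for u v q1 q2 q3 q4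
    using that by (auto simp: clash_def colours_def)
  have flip: "c (k + 2) 3 = c (k + 2) 2"
    by (rule flip_aux[OF L2 L2 L L1(1) L1(2) L R3 U1(2) R1(2) R1(1) U1(1) R3]) simp_all
  have t: "c (k + 2) 4 = 4 - c (k + 2) 3"
    using alternate_signal[OF L2 L2 U2, of 3 4] L2[of 3] L2[of 4] by (auto simp: colours_def)
  have "\<not> clash 2 (c (k + 2) 4) d" "\<not> clash 2 g (c (k + 2) 2)"
    unfolding d_def g_def by (rule U2; simp)+
  \<comment> \<open>With \<open>e\<close> the common colour of rows 2 and 3, \<open>g\<close> must
    avoid \<open>e\<close> and \<open>d\<close> must avoid \<open>4 - e\<close>. So one of the
    colours 1 and 3 is denied to \<open>g\<close> and the other one to \<open>d\<close>. In
    particular one of \<open>d\<close> and \<open>g\<close> is not 3 and equals both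
    \<open>A\<close> and \<open>h\<close>.\<close>
  then have dg: "\<not> (d = 3 \<and> g = 3)" "\<not> (d = 1 \<and> g = 1)"
    using L2[of 3] unfolding t flip by (auto simp: clash_def colours_def)
  have bus: "\<not> clash 2 d (c (k + 2) 6)" "\<not> clash 2 (c (k + 2) 0) g"
    unfolding d_def g_def by (rule U2; simp)+
  show "c (k + 4) 3 = c k 3"
    using dA gA dh gh dg A h unfolding A_def[symmetric] h_def[symmetric] by auto
  \<comment> \<open>For \<open>A = 1\<close>, the vertices \<open>d\<close> and \<open>g\<close>
    have the colours 1 and 3 in some order, and rows 6 and 0 carry the opposite ones. For
    \<open>A = 2\<close>, one of them can be 2 and separates the signal.\<close>
  show "c (k + 2) 6 \<noteq> c (k + 2) 0" if "c k 3 = 1"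
    using that[folded A_def] dA gA dg bus L2[of 0] L2[of 6] by (auto simp: clash_def colours_def)
qed

lemma wire_left:
  "c 0 3 = 1 \<or> c 0 3 = 2" "c 0 6 = 3 - c 0 3" "c 0 8 = 3 - c 0 3"
proof -
  have L: "c 0 b \<in> colours 3" if "b \<in> {3,4,5,6,7,8}" for b
    using that lists[of 0 b] by (elim insertE emptyE) (simp_all add: tile_list_def)
  have U: "\<not> clash 3 (c 0 b) (c 0 (Suc b))" if "b \<in> {3,4,5,6,7}" for b
    using that ups[of 0 b] by (elim insertE emptyE) (simp_all add: tile_up_def)
  have s: "c 0 4 = 3 - c 0 3" "c 0 5 = 3 - c 0 4" "c 0 6 = 3 - c 0 5" "c 0 7 = 3 - c 0 6" "c 0 8 = 3 - c 0 7"
    using alternate_wire[OF L L U, of 3] alternate_wire[OF L L U, of 4] alternate_wire[OF L L U, of 5]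
      alternate_wire[OF L L U, of 6] alternate_wire[OF L L U, of 7] by simp_all
  show x: "c 0 3 = 1 \<or> c 0 3 = 2" using L[of 3] by (auto simp: colours_def)
  then show "c 0 6 = 3 - c 0 3" "c 0 8 = 3 - c 0 3"
    by (elim disjE; simp add: s)+
qed

text \<open>The edge from column 4 to column 5 changes the wire, so one of the halves sees colour 1
  and conducts. Rows 0 and 6 lead the signal from column 2 to column 7 over five edges each, which
  changes both of its ends alike.\<close>

lemma crossing: "c 9 3 = 3 - c 0 3" "c 2 6 \<noteq> c 2 0"
proof -
  have L: "c a b \<in> colours 2" if "a \<in> {2,3,4,5,6,7}" "b = 0 \<or> b = 6" for a b
    using that lists[of a b] by (elim disjE insertE emptyE) (simp_all add: tile_list_def)
  have R: "\<not> clash 2 (c a b) (c (Suc a) b)" if "a \<in> {2,3,4,5,6}" "b = 0 \<or> b = 6" for a b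
    using that rights[of a b] by (elim disjE insertE emptyE) (simp_all add: tile_right_def)
  have bus: "c 7 b = 4 - c 2 b" if b: "b = 0 \<or> b = 6" for b
  proof -
    have s: "c 3 b = 4 - c 2 b" "c 4 b = 4 - c 3 b" "c 5 b = 4 - c 4 b" "c 6 b = 4 - c 5 b" "c 7 b = 4 - c 6 b"
      using alternate_signal[OF L[OF _ b] L[OF _ b] R[OF _ b], of 2] alternate_signal[OF L[OF _ b] L[OF _ b] R[OF _ b], of 3]
        alternate_signal[OF L[OF _ b] L[OF _ b] R[OF _ b], of 4] alternate_signal[OF L[OF _ b] L[OF _ b] R[OF _ b], of 5]
        alternate_signal[OF L[OF _ b] L[OF _ b] R[OF _ b], of 6] by simp_all
    have "c 2 b = 1 \<or> c 2 b = 3" using L[OF _ b, of 2] by (auto simp: colours_def)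
    then show ?thesis by (elim disjE) (simp_all add: s)
  qed
  have L3: "c 4 3 \<in> colours 3" "c 5 3 \<in> colours 3"
    using lists[of 4 3] lists[of 5 3] by (simp_all add: tile_list_def)
  have "\<not> clash 3 (c 4 3) (c 5 3)" using rights[of 4 3] by (simp add: tile_right_def)
  then have "c 5 3 = 3 - c 4 3" using alternate_wire L3 by blast
  moreover have "c 4 3 = c 0 3" "c 9 3 = c 5 3" using half(1)[of 0] half(1)[of 5] by simp_all
  ultimately have x: "c 5 3 = 3 - c 0 3" "c 9 3 = 3 - c 0 3" by simp_all
  then show "c 9 3 = 3 - c 0 3" by simp
  show "c 2 6 \<noteq> c 2 0"
  proof (cases "c 0 3 = 1")
    case True
    from half(2)[of 0] True show ?thesis by (simp add: numeral_2_eq_2)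
  next
    case False
    then have "c 5 3 = 1" using wire_left(1) x by auto
    then have "c 7 6 \<noteq> c 7 0" using half(2)[of 5] by simp
    then show ?thesis using bus by auto
  qed
qed

lemma signals: "c 2 0 = 1 \<or> c 2 0 = 3" "c 2 9 = 1 \<or> c 2 9 = 3" "c 2 10 = 4 - c 2 9" "c 2 7 = c 2 0"
proof -
  have L: "c 2 b \<in> colours 2" if "b \<in> {0,6,7,9,10}" for b
    using that lists[of 2 b] by (elim insertE emptyE) (simp_all add: tile_list_def)
  show s: "c 2 0 = 1 \<or> c 2 0 = 3" "c 2 9 = 1 \<or> c 2 9 = 3"
    using L[of 0] L[of 9] by (auto simp: colours_def)
  have "\<not> clash 2 (c 2 9) (c 2 10)" "\<not> clash 2 (c 2 6) (c 2 7)"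
    using ups[of 2 9] ups[of 2 6] by (simp_all add: tile_up_def)
  then have "c 2 10 = 4 - c 2 9" "c 2 7 = 4 - c 2 6" using alternate_signal L by blast+
  then show "c 2 10 = 4 - c 2 9" "c 2 7 = c 2 0"
    using crossing(2) s L[of 6] by (auto simp: colours_def)
qed

lemma tile_sound: "tile_relation ty (c 0 3) (c 2 9) (c 2 0)"
proof -
  have z: "c 2 8 \<in> colours (tile_list ty 2 8)" "\<not> clash (tile_up ty 2 8) (c 2 8) (c 2 9)"
    "\<not> clash (tile_up ty 2 7) (c 2 7) (c 2 8)" "\<not> clash (tile_right ty 1 8) (c 1 8) (c 2 8)"
    by (rule list_in up_label right_label; simp)+
  have w: "c 1 8 \<in> colours 3" "\<not> clash (tile_right ty 0 8) (c 0 8) (c 1 8)"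
    using lists[of 1 8] rights[of 0 8] by (simp_all add: tile_list_def)
  have q: "c 1 7 \<in> colours 2" "c 1 6 \<in> colours 1" "\<not> clash (tile_up ty 1 7) (c 1 7) (c 1 8)"
    "\<not> clash (tile_up ty 1 6) (c 1 6) (c 1 7)" "\<not> clash (tile_right ty 0 6) (c 0 6) (c 1 6)"
    using lists[of 1 7] lists[of 1 6] ups[of 1 7] ups[of 1 6] rights[of 0 6] by (simp_all add: tile_list_def)
  have types: "ty = 0 \<or> ty = 1 \<or> ty = 2 \<or> ty = 3 \<or> ty = 4 \<or> ty = 5" using ty by linarith
  have facts: "c 2 0 = 1 \<or> c 2 0 = 3" "c 2 9 = 1 \<or> c 2 9 = 3" "c 0 3 = 1 \<or> c 0 3 = 2"
    using signals wire_left by blast+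
  show ?thesis
    using types facts z w q unfolding signals(4) wire_left(2,3)
    by (elim disjE) (auto simp: tile_relation_def tile_list_def tile_right_def tile_up_def clash_def colours_def)
qed

end

section \<open>The grid of a set of clauses\<close>

text \<open>Columns of tiles are clauses. The rows \<open>1, \<dots>, N\<close> are variables; the signal that leaves row
  \<open>N + 1\<close> is false, the signal that enters row \<open>0\<close> is true, and a variable row lets it become true
  only if the variable satisfies the clause.\<close>

definition cell_type :: "(bool \<Rightarrow> nat \<Rightarrow> nat \<Rightarrow> bool) \<Rightarrow> nat \<Rightarrow> nat \<Rightarrow> nat \<Rightarrow> nat" where
  "cell_type lit N i j = (if i = 0 then 5 else if i = Suc N then 4
     else if lit True (i - 1) j then (if lit False (i - 1) j then 3 else 1)
     else if lit False (i - 1) j then 2 else 0)"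

definition clause_right :: "(bool \<Rightarrow> nat \<Rightarrow> nat \<Rightarrow> bool) \<Rightarrow> nat \<Rightarrow> nat \<Rightarrow> nat \<Rightarrow> nat \<Rightarrow> nat" where
  "clause_right lit N C a b = (if Suc a < 10 * C
     then tile_right (cell_type lit N (b div 11) (a div 10)) (a mod 10) (b mod 11) else 0)"

definition clause_up :: "(bool \<Rightarrow> nat \<Rightarrow> nat \<Rightarrow> bool) \<Rightarrow> nat \<Rightarrow> nat \<Rightarrow> nat \<Rightarrow> nat" where
  "clause_up lit N a b = (if Suc b < 11 * (N + 2)
     then tile_up (cell_type lit N (b div 11) (a div 10)) (a mod 10) (b mod 11) else 0)"

definition clause_list :: "(bool \<Rightarrow> nat \<Rightarrow> nat \<Rightarrow> bool) \<Rightarrow> nat \<Rightarrow> nat \<Rightarrow> nat \<Rightarrow> nat" where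
  "clause_list lit N a b = tile_list (cell_type lit N (b div 11) (a div 10)) (a mod 10) (b mod 11)"

lemma cell_type_less: "cell_type lit N i j < 6"
  by (simp add: cell_type_def)

lemma tile_codes:
  assumes "ty < 6" "a < 10" "b < 11"
  shows "tile_right ty a b \<le> 3" "tile_up ty a b \<le> 3" "tile_list ty a b \<le> 3"
proof -
  have ty: "ty = 0 \<or> ty = 1 \<or> ty = 2 \<or> ty = 3 \<or> ty = 4 \<or> ty = 5" using assms(1) by linarith
  have "\<forall>a<10. \<forall>b<11. tile_right ty a b \<le> 3"
    unfolding all_less_10 all_less_11 using ty by (simp add: tile_right_def) (elim disjE; simp)
  then show "tile_right ty a b \<le> 3" using assms by blast
  have "\<forall>a<10. \<forall>b<11. tile_up ty a b \<le> 3"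
    unfolding all_less_10 all_less_11 using ty by (simp add: tile_up_def) (elim disjE; simp)
  then show "tile_up ty a b \<le> 3" using assms by blast
  have "\<forall>a<10. \<forall>b<11. tile_list ty a b \<le> 3"
    unfolding all_less_10 all_less_11 using ty by (simp add: tile_list_def) (elim disjE; simp)
  then show "tile_list ty a b \<le> 3" using assms by blast
qed

lemma grid_pattern_clauses:
  assumes "odd D" "3 \<le> D"
  shows "grid_pattern (10 * C) (11 * (N + 2)) D (clause_right lit N C) (clause_up lit N) (clause_list lit N)"
  using assms tile_codes[OF cell_type_less]
  by unfold_locales (auto simp: clause_right_def clause_up_def clause_list_def split: if_splits)

locale clause_pattern =
  grid_pattern "10 * C" "11 * (N + 2)" D "clause_right lit N C" "clause_up lit N" "clause_list lit N"
  for C N D :: nat and lit :: "bool \<Rightarrow> nat \<Rightarrow> nat \<Rightarrow> bool"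
begin

text \<open>If no literal of a clause were true, the truth demanded at row 0 would have to be
  present at each higher row as well, up to row \<open>N + 1\<close>, where the signal starts as
  false.\<close>

lemma clauses_of_pattern:
  assumes "pattern_colouring col"
  shows "\<exists>X. \<forall>j<C. \<exists>v<N. lit (X v) v j"
proof -
  have inside: "10 * j + a < 10 * C" "11 * i + b < 11 * (N + 2)"
    if "j < C" "i < N + 2" "a < 10" "b < 11" for i j a b
    using mult_le_mono2[of "Suc j" C 10] mult_le_mono2[of "Suc i" "N + 2" 11] that by simp_all
  have P: "col (10 * j + a) (11 * i + b) \<in> colours (tile_list (cell_type lit N i j) a b)"
    "10 * j + Suc a < 10 * C \<Longrightarrow> \<not> clash (tile_right (cell_type lit N i j) a b)
      (col (10 * j + a) (11 * i + b)) (col (10 * j + Suc a) (11 * i + b))"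
    "11 * i + Suc b < 11 * (N + 2) \<Longrightarrow> \<not> clash (tile_up (cell_type lit N i j) a b)
      (col (10 * j + a) (11 * i + b)) (col (10 * j + a) (11 * i + Suc b))"
    if "j < C" "i < N + 2" "a < 10" "b < 11" for i j a b
  proof -
    let ?a = "10 * j + a" and ?b = "11 * i + b"
    have dm: "?a div 10 = j" "?a mod 10 = a" "?b div 11 = i" "?b mod 11 = b"
      using that by simp_all
    have "col ?a ?b \<in> colours (clause_list lit N ?a ?b)"
      "\<not> clash (clause_right lit N C ?a ?b) (col ?a ?b) (col (Suc ?a) ?b)"
      "\<not> clash (clause_up lit N ?a ?b) (col ?a ?b) (col ?a (Suc ?b))"
      using assms inside[OF that] unfolding pattern_colouring_def by blast+
    then show "col ?a ?b \<in> colours (tile_list (cell_type lit N i j) a b)"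
      "10 * j + Suc a < 10 * C \<Longrightarrow> \<not> clash (tile_right (cell_type lit N i j) a b)
        (col ?a ?b) (col (10 * j + Suc a) ?b)"
      "11 * i + Suc b < 11 * (N + 2) \<Longrightarrow> \<not> clash (tile_up (cell_type lit N i j) a b)
        (col ?a ?b) (col ?a (11 * i + Suc b))"
      unfolding clause_list_def clause_right_def clause_up_def dm add_Suc_right by simp_all
  qed
  have T: "tile_colouring (cell_type lit N i j) (\<lambda>a b. col (10 * j + a) (11 * i + b))"
    if "j < C" "i < N + 2" for i j
  proof
    show "cell_type lit N i j < 6" by (rule cell_type_less)
    fix a b :: nat
    show "col (10 * j + a) (11 * i + b) \<in> colours (tile_list (cell_type lit N i j) a b)"
      if "a < 10" "b < 11"
      using P(1) \<open>j < C\<close> \<open>i < N + 2\<close> that by blast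
    show "\<not> clash (tile_right (cell_type lit N i j) a b) (col (10 * j + a) (11 * i + b))
        (col (10 * j + Suc a) (11 * i + b))" if "a < 9" "b < 11"
      using P(2)[of j i a b] inside[of j i "Suc a" b] \<open>j < C\<close> \<open>i < N + 2\<close> that by simp
    show "\<not> clash (tile_up (cell_type lit N i j) a b) (col (10 * j + a) (11 * i + b))
        (col (10 * j + a) (11 * i + Suc b))" if "a < 10" "b < 10"
      using P(3)[of j i a b] inside[of j i a "Suc b"] \<open>j < C\<close> \<open>i < N + 2\<close> that by simp
  qed
  define x where "x i j = col (10 * j) (11 * i + 3)" for i j
  define su where "su i j = col (10 * j + 2) (11 * i + 9)" for i j
  define sd where "sd i j = col (10 * j + 2) (11 * i)" for i j
  have rel: "tile_relation (cell_type lit N i j) (x i j) (su i j) (sd i j)"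
    and x12: "x i j = 1 \<or> x i j = 2" and x9: "col (10 * j + 9) (11 * i + 3) = 3 - x i j"
    and s13: "sd i j = 1 \<or> sd i j = 3" "su i j = 1 \<or> su i j = 3"
    and s10: "col (10 * j + 2) (11 * i + 10) = 4 - su i j"
    if "j < C" "i < N + 2" for i j
    using tile_colouring.tile_sound[OF T[OF that]] tile_colouring.wire_left(1)[OF T[OF that]]
      tile_colouring.crossing(1)[OF T[OF that]] tile_colouring.signals[OF T[OF that]]
    unfolding x_def su_def sd_def add_0_right by blast+
  \<comment> \<open>A tile reverses the wire and the edge to the next tile reverses it again, so a
    variable has the same colour at the entry of all columns.\<close>
  have x_eq: "x i j = x i 0" if "j < C" "i < N + 2" for i j
    using that(1)
  proof (induction j)
    case (Suc j)
    have "\<not> clash 3 (col (10 * j + 9) (11 * i + 3)) (col (10 * Suc j) (11 * i + 3))"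
      using P(2)[of j i 9 3] Suc.prems that(2) by (simp add: tile_right_def add.commute)
    then have "3 - x i j \<noteq> x i (Suc j)"
      using x9[OF _ that(2), of j] x12[OF _ that(2), of j] Suc.prems by (simp add: clash_def x_def) linarith
    moreover have "x i j = 1 \<or> x i j = 2" "x i (Suc j) = 1 \<or> x i (Suc j) = 2" "x i j = x i 0"
      using Suc x12[OF _ that(2)] by simp_all
    ultimately show ?case by (elim disjE) simp_all
  qed simp
  have s_eq: "sd (Suc i) j = su i j" if "j < C" "i < N + 1" for i j
  proof -
    have "\<not> clash 2 (col (10 * j + 2) (11 * i + 10)) (col (10 * j + 2) (11 * Suc i))"
      using P(3)[of j i 2 10] that by (simp add: tile_up_def add.commute)
    then have "4 - su i j \<noteq> sd (Suc i) j"
      using s10[of j i] s13(2)[of j i] that by (simp add: clash_def sd_def) linarith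
    moreover have "su i j = 1 \<or> su i j = 3" "sd (Suc i) j = 1 \<or> sd (Suc i) j = 3"
      using s13(2)[of j i] s13(1)[of j "Suc i"] that by simp_all
    ultimately show ?thesis by (elim disjE) simp_all
  qed
  define X where "X v \<longleftrightarrow> x (Suc v) 0 = 1" for v
  have "\<exists>v<N. lit (X v) v j" if j: "j < C" for j
  proof (rule ccontr)
    assume none: "\<not> (\<exists>v<N. lit (X v) v j)"
    have "su i j = 1" if "i < N + 1" for i
      using that
    proof (induction i)
      case 0
      then show ?case using rel[OF j, of 0] by (simp add: cell_type_def tile_relation_def)
    next
      case (Suc i)
      have sd: "sd (Suc i) j = 1" using s_eq[OF j, of i] Suc by simp
      have i: "i < N" "Suc i < N + 2" using Suc.prems by simp_all
      have X: "X i \<longleftrightarrow> x (Suc i) j = 1" using x_eq[OF j i(2)] by (simp add: X_def)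
      have ty: "cell_type lit N (Suc i) j = (if lit True i j then (if lit False i j then 3 else 1)
          else if lit False i j then 2 else 0)"
        using i(1) by (simp add: cell_type_def)
      have nolit: "\<not> lit (X i) i j" using none i(1) by blast
      show ?case
      proof (cases "x (Suc i) j = 1")
        case True
        then have "\<not> lit True i j" using nolit X by simp
        then show ?thesis
          using rel[OF j i(2)] True unfolding ty sd by (cases "lit False i j") (simp_all add: tile_relation_def)
      next
        case False
        then have "\<not> lit False i j" using nolit X by simp
        then show ?thesis
          using rel[OF j i(2)] False unfolding ty sd by (cases "lit True i j") (simp_all add: tile_relation_def)
      qed
    qed
    then have "sd (Suc N) j = 1" using s_eq[OF j, of N] by simp
    moreover have "sd (Suc N) j = 3"
      using rel[OF j, of "Suc N"] by (simp add: cell_type_def tile_relation_def)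
    ultimately show False by simp
  qed
  then show ?thesis by blast
qed

lemma pattern_of_clauses:
  assumes "\<forall>j<C. \<exists>v<N. lit (X v) v j"
  shows "\<exists>col. pattern_colouring col"
proof -
  obtain v where v: "\<And>j. j < C \<Longrightarrow> v j < N \<and> lit (X (v j)) (v j) j" using assms by metis
  define x where "x i = (if X (i - 1) then 1 else 2 :: nat)" for i
  \<comment> \<open>\<open>s i j\<close> leaves row \<open>i\<close> and \<open>s (Suc i) j\<close>
    enters it. The signal turns true in row \<open>Suc (v j)\<close>, which belongs to a variable
    that satisfies the clause.\<close>
  define s where "s i j = (if i \<le> Suc (v j) then 1 else 3 :: nat)" for i j
  define tc where "tc i j = tile_colour (cell_type lit N i j) (x i) (s (Suc i) j) (s i j)" for i j
  have ok: "tile_ok (cell_type lit N i j) (tc i j) a b"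
    if "j < C" "i < N + 2" "a < 10" "b < 11" for i j a b
  proof -
    have "tile_relation (cell_type lit N i j) (x i) (s (Suc i) j) (s i j)"
      using v[OF that(1)] that(2)
      by (cases "X (v j)"; cases "i - 1 = v j")
        (auto simp: tile_relation_def cell_type_def x_def s_def split: if_splits)
    then show ?thesis
      unfolding tc_def using that tile_complete[OF cell_type_less] by (simp add: x_def s_def)
  qed
  define col where "col a b = tc (b div 11) (a div 10) (a mod 10) (b mod 11)" for a b
  have "col a b \<in> colours (clause_list lit N a b) \<and>
      \<not> clash (clause_right lit N C a b) (col a b) (col (Suc a) b) \<and>
      \<not> clash (clause_up lit N a b) (col a b) (col a (Suc b))"
    if ab: "a < 10 * C" "b < 11 * (N + 2)" for a b
  proof -
    define i j p q where "i = b div 11" and "j = a div 10" and "p = a mod 10" and "q = b mod 11"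
    have ij: "j < C" "i < N + 2" "p < 10" "q < 11"
      using ab by (auto simp: i_def j_def p_def q_def less_mult_imp_div_less mult.commute)
    have cab: "col a b = tc i j p q" by (simp add: col_def i_def j_def p_def q_def)
    note ok = ok[OF ij, unfolded tile_ok_def]
    have "\<not> clash (clause_right lit N C a b) (col a b) (col (Suc a) b)"
    proof (cases "p = 9")
      case True
      have "col (Suc a) b = tc i (Suc j) 0 q"
        using True by (simp add: col_def i_def j_def p_def q_def div_Suc mod_Suc)
      \<comment> \<open>Only the wire in row 3 continues to the tile on the right; likewise only the
        signal in column 2 continues upwards.\<close>
      moreover have "tile_right (cell_type lit N i j) 9 q = (if q = 3 then 3 else 0) \<or>
          tile_right (cell_type lit N i j) 9 q = 0"
        using ij(4) all_less_11[of "\<lambda>q. tile_right (cell_type lit N i j) 9 q = (if q = 3 then 3 else 0)"]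
        by (simp add: tile_right_def)
      moreover have "tc i j 9 3 = 3 - x i" "tc i (Suc j) 0 3 = x i"
        by (simp_all add: tc_def tile_colour_def tile_table_def Let_def)
      ultimately show ?thesis
        unfolding clause_right_def cab using True
        by (auto simp: i_def[symmetric] j_def[symmetric] p_def[symmetric] q_def[symmetric] clash_def x_def
            split: if_splits)
    next
      case False
      then have "col (Suc a) b = tc i j (Suc p) q"
        by (simp add: col_def i_def j_def p_def q_def div_Suc mod_Suc)
      then show ?thesis
        using ok False unfolding clause_right_def cab by (simp add: i_def j_def p_def q_def)
    qed
    moreover have "\<not> clash (clause_up lit N a b) (col a b) (col a (Suc b))"
    proof (cases "q = 10")
      case True
      have "col a (Suc b) = tc (Suc i) j p 0"
        using True by (simp add: col_def i_def j_def p_def q_def div_Suc mod_Suc)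
      moreover have "tile_up (cell_type lit N i j) p 10 = (if p = 2 then 2 else 0) \<or>
          tile_up (cell_type lit N i j) p 10 = 0"
        using ij(3) all_less_10[of "\<lambda>p. tile_up (cell_type lit N i j) p 10 = (if p = 2 then 2 else 0)"]
        by (simp add: tile_up_def)
      moreover have "tc i j 2 10 = 4 - s (Suc i) j" "tc (Suc i) j 2 0 = s (Suc i) j"
        by (simp_all add: tc_def tile_colour_def tile_table_def Let_def)
      ultimately show ?thesis
        unfolding clause_up_def cab using True
        by (auto simp: i_def[symmetric] j_def[symmetric] p_def[symmetric] q_def[symmetric] clash_def s_def
            split: if_splits)
    next
      case False
      then have "col a (Suc b) = tc i j p (Suc q)"
        by (simp add: col_def i_def j_def p_def q_def div_Suc mod_Suc)
      then show ?thesis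
        using ok False unfolding clause_up_def cab by (simp add: i_def j_def p_def q_def)
    qed
    moreover have "col a b \<in> colours (clause_list lit N a b)"
      using ok unfolding clause_list_def cab by (simp add: i_def j_def p_def q_def)
    ultimately show ?thesis by blast
  qed
  then show ?thesis unfolding pattern_colouring_def by blast
qed

end

section \<open>The reduction\<close>

text \<open>Bounded arguments turn any function into a finite case distinction. This is how the tile
  tables become expressions.\<close>

lemma definable_finite_table:
  assumes "definable t" "definable a" "definable b"
    and "\<And>w \<rho>. t w \<rho> < K1" "\<And>w \<rho>. a w \<rho> < K2" "\<And>w \<rho>. b w \<rho> < K3"
  shows "definable (\<lambda>w \<rho>. T (t w \<rho>) (a w \<rho>) (b w \<rho>))"
proof -
  have 1: "definable (\<lambda>w \<rho>. T n m (b w \<rho>))" for n m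
    using definable_table[OF assms(3), of K3 "\<lambda>k w \<rho>. T n m k"] assms(6) definable_const by simp
  have 2: "definable (\<lambda>w \<rho>. T n (a w \<rho>) (b w \<rho>))" for n
    using definable_table[OF assms(2), of K2 "\<lambda>k w \<rho>. T n k (b w \<rho>)"] assms(5) 1 by simp
  show ?thesis
    using definable_table[OF assms(1), of K1 "\<lambda>k w \<rho>. T k (a w \<rho>) (b w \<rho>)"] assms(4) 2 by simp
qed

lemma clauses_reduction:
  fixes N C :: "bool list \<Rightarrow> nat" and lit :: "bool \<Rightarrow> bool list \<Rightarrow> nat \<Rightarrow> nat \<Rightarrow> bool"
  assumes N: "definable (\<lambda>w \<rho>. N w)" and C: "definable (\<lambda>w \<rho>. C w)"
    and lit: "\<And>b v c. definable v \<Longrightarrow> definable c \<Longrightarrow> definable_pred (\<lambda>w \<rho>. lit b w (v w \<rho>) (c w \<rho>))"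
    and A: "\<And>w. w \<in> A \<longleftrightarrow> (\<exists>X. \<forall>c<C w. \<exists>v<N w. lit (X v) w v c)"
    and D: "odd D" "3 \<le> D"
  shows "\<exists>f. poly_time f \<and> (\<forall>w. f w \<in> planar_girth_instances D \<and> (w \<in> A \<longleftrightarrow> f w \<in> three_list_colouring))"
proof -
  define R where "R w = clause_right (\<lambda>b. lit b w) (N w) (C w)" for w
  define U where "U w = clause_up (\<lambda>b. lit b w) (N w)" for w
  define L where "L w = clause_list (\<lambda>b. lit b w) (N w)" for w
  define W where "W w = 10 * C w" for w
  define H where "H w = 11 * (N w + 2)" for w
  have G: "grid_pattern (W w) (H w) D (R w) (U w) (L w)" for w
    unfolding W_def H_def R_def U_def L_def by (rule grid_pattern_clauses[OF D])
  have clause_pattern: "clause_pattern (C w) (N w) D (\<lambda>b. lit b w)" for w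
    unfolding clause_pattern_def by (rule grid_pattern_clauses[OF D])
  define E where "E w = grid_pattern.grid_edges (W w) (H w) D (R w) (U w)" for w
  define Ls where "Ls w = grid_pattern.grid_list (W w) D (R w) (U w) (L w)" for w
  define f where "f w = encode_instance (W w * D * (H w * D)) (E w) (Ls w)" for w
  have "f w \<in> planar_girth_instances D" for w
    unfolding f_def E_def Ls_def by (rule grid_pattern.grid_planar_girth[OF G])
  moreover have "w \<in> A \<longleftrightarrow> f w \<in> three_list_colouring" for w
    using clause_pattern.clauses_of_pattern[OF clause_pattern, of w]
      clause_pattern.pattern_of_clauses[OF clause_pattern, of w]
    unfolding f_def E_def Ls_def grid_pattern.grid_colourable_iff[OF G] A
    unfolding W_def H_def R_def U_def L_def by blast
  moreover have "poly_time f"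
  proof (rule poly_time_definable)
    have W': "definable (\<lambda>w \<rho>. W w)" and H': "definable (\<lambda>w \<rho>. H w)"
      unfolding W_def H_def by (intro definable_intros N C)+
    have ty: "definable (\<lambda>w \<rho>. cell_type (\<lambda>b. lit b w) (N w) (i w \<rho>) (j w \<rho>))"
      if "definable i" "definable j" for i j
      unfolding cell_type_def by (intro definable_intros lit N that)
    have tab: "definable (\<lambda>w \<rho>. T (cell_type (\<lambda>b. lit b w) (N w) (y w \<rho> div 11) (x w \<rho> div 10))
        (x w \<rho> mod 10) (y w \<rho> mod 11))" if "definable x" "definable y" for T x y
      by (rule definable_finite_table[where ?K1.0 = 6 and ?K2.0 = 10 and ?K3.0 = 11])
        (intro ty definable_intros that cell_type_less | simp)+
    have R': "definable (\<lambda>w \<rho>. R w (x w \<rho>) (y w \<rho>))" and U': "definable (\<lambda>w \<rho>. U w (x w \<rho>) (y w \<rho>))"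
      and L': "definable (\<lambda>w \<rho>. L w (x w \<rho>) (y w \<rho>))" if "definable x" "definable y" for x y
      unfolding R_def U_def L_def clause_right_def clause_up_def clause_list_def
      by (intro definable_if definable_pred_less definable_Suc definable_mult definable_add definable_const
          N C that tab)+
    have re: "definable_pred (\<lambda>w \<rho>. grid_pattern.right_edge D (R w) (x w \<rho>) (y w \<rho>))"
      and ue: "definable_pred (\<lambda>w \<rho>. grid_pattern.up_edge D (U w) (x w \<rho>) (y w \<rho>))"
      if "definable x" "definable y" for x y
      unfolding grid_pattern.right_edge_def[OF G] grid_pattern.up_edge_def[OF G]
      by (intro definable_pred_conj definable_pred_not definable_pred_eq definable_mod definable_div
          definable_const R' U' that)+
    have ef: "definable_pred (\<lambda>w \<rho>. grid_pattern.edge_from (W w) (H w) D (R w) (U w) (u w \<rho>) (v w \<rho>))"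
      if "definable u" "definable v" for u v
      unfolding grid_pattern.edge_from_def[OF G]
      by (intro definable_pred_conj definable_pred_disj definable_pred_eq definable_pred_less definable_mod
          definable_div definable_mult definable_add definable_const W' H' re ue that)
    have "{u, v} \<in> E w \<longleftrightarrow> grid_pattern.edge_from (W w) (H w) D (R w) (U w) u v \<or>
        grid_pattern.edge_from (W w) (H w) D (R w) (U w) v u" for u v w
      unfolding E_def grid_pattern.grid_edges_def[OF G] by (auto simp: doubleton_eq_iff)
    then have E': "definable_pred (\<lambda>w \<rho>. {\<rho> 1, \<rho> 0} \<in> E w)"
      by (simp only:) (intro definable_pred_disj ef definable_var)
    have code: "definable (\<lambda>w \<rho>. grid_pattern.point_code D (R w) (U w) (L w) (x w \<rho>) (y w \<rho>))"
      if "definable x" "definable y" for x y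
      unfolding grid_pattern.point_code_def[OF G]
      by (intro definable_if definable_pred_conj definable_pred_eq definable_mod definable_div
          definable_const R' U' L' re ue that)
    have "c \<in> Ls w u \<longleftrightarrow> (c = 1 \<or> c = 2 \<or> c = 3) \<and>
        c \<noteq> grid_pattern.point_code D (R w) (U w) (L w) (u mod (W w * D)) (u div (W w * D))" for c w u
      unfolding Ls_def grid_pattern.grid_list_def[OF G] colours_def by blast
    then have Ls': "definable_pred (\<lambda>w \<rho>. \<rho> 0 \<in> Ls w (\<rho> 1))"
      by (simp only:) (intro definable_pred_conj definable_pred_disj definable_pred_not definable_pred_eq
        code definable_mod definable_div definable_mult definable_var definable_const W')
    have "Ls w u \<subseteq> {..3}" for w u
      unfolding Ls_def grid_pattern.grid_list_def[OF G] colours_def by auto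
    then show "definable_word (\<lambda>w \<rho>. f w)"
      unfolding f_def
      by (intro definable_word_encode_instance[where K = "\<lambda>w \<rho>. 3"] definable_mult definable_const
          W' H' E' Ls')
  qed
  ultimately show ?thesis by blast
qed

theorem NP_reduction:
  assumes "A \<in> class_NP" "odd D" "3 \<le> D"
  shows "\<exists>f. poly_time f \<and> (\<forall>w. f w \<in> planar_girth_instances D \<and> (w \<in> A \<longleftrightarrow> f w \<in> three_list_colouring))"
proof (rule NP_clauses[OF assms(1)])
  fix N C :: "bool list \<Rightarrow> nat" and lit :: "bool \<Rightarrow> bool list \<Rightarrow> nat \<Rightarrow> nat \<Rightarrow> bool"
  assume c: "definable (\<lambda>w \<rho>. N w)" "definable (\<lambda>w \<rho>. C w)"
    "\<And>b v c. definable v \<Longrightarrow> definable c \<Longrightarrow> definable_pred (\<lambda>w \<rho>. lit b w (v w \<rho>) (c w \<rho>))"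
    "\<And>w. w \<in> A \<longleftrightarrow> (\<exists>X. \<forall>c<C w. \<exists>v<N w. lit (X v) w v c)"
  show ?thesis by (rule clauses_reduction[OF c assms(2,3)])
qed

lemma planar_girth_instances_mono:
  assumes "p \<le> D" "x \<in> planar_girth_instances D"
  shows "x \<in> planar_girth_instances p"
proof -
  have "enat p \<le> girth E" if "enat D \<le> girth E" for E :: "nat set set"
    using assms(1) that by (meson enat_ord_simps(1) order_trans)
  then show ?thesis
    using assms(2) unfolding planar_girth_instances_def mem_Collect_eq by blast
qed

theorem theorem13:
  fixes p :: nat
  assumes "p \<ge> 3"
  shows "NP_complete_for three_list_colouring (planar_girth_instances p)"
  unfolding NP_complete_for_def
proof (intro conjI ballI)
  show "three_list_colouring \<in> class_NP" by (rule three_list_colouring_NP)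
  fix A assume "A \<in> class_NP"
  \<comment> \<open>The stretching factor must be odd and at least \<open>p\<close>;
    \<open>2 * p + 1\<close> is both for every \<open>p\<close>.\<close>
  moreover have "odd (2 * p + 1)" "3 \<le> 2 * p + 1" using assms by simp_all
  ultimately obtain f where f: "poly_time f"
    "\<And>w. f w \<in> planar_girth_instances (2 * p + 1)" "\<And>w. w \<in> A \<longleftrightarrow> f w \<in> three_list_colouring"
    using NP_reduction by blast
  have "f w \<in> planar_girth_instances p" for w
    by (rule planar_girth_instances_mono[OF _ f(2)]) simp
  then show "\<exists>f. poly_time f \<and> (\<forall>x. f x \<in> planar_girth_instances p \<and> (x \<in> A \<longleftrightarrow> f x \<in> three_list_colouring))"
    using f(1,3) by blast
qed

end
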